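(* Let $\mathcal{M}$ be a connected Riemannian manifold, $R:T\mathcal{M}\to\mathcal{M}$ a retraction, $F:\mathcal{M}\to\mathbb{R}$ a $C^1$ function, $K$ a compact subset of $\mathcal{M}$, and $A>0$ a constant such that $\nabla F$ is $R$-Lipschitz on $K$ up to radius $A$. Let $(\Omega,\mathcal{F},\mu)$ be a probability space and $H:\mathcal{M}\times\Omega\to T\mathcal{M}$ a function such that: (a) for every $\omega\in\Omega$, $H(\bullet,\omega)$ is a tangent vector field on $\mathcal{M}$; (b) either $\Omega$ is a finite set and $\mathcal{F}$ consists of all subsets of $\Omega$, or $H:(\mathcal{M}\times\Omega,\mathcal{B}_{\mathcal{M}}\otimes\mathcal{F})\to(T\mathcal{M},\mathcal{B}_{T\mathcal{M}})$ is measurable; (c) $\int_\Omega H(x,\omega)\,d\mu=\nabla F(x)$ for every $x\in\mathcal{M}$; (d) $\|H(x,\omega)\|_x\le A$ for all $x\in K$ and $\omega\in\Omega$. For every $t\ge0$ let $\{\hat\Omega_j^t\}_{j=1}^{m^t}$ be a partition of $\Omega$ into finitely many pairwise disjoint events $\hat\Omega_j^t\in\mathcal{F}$ with $\mu(\hat\Omega_j^t)>0$ and $\Omega=\bigcup_{j=1}^{m^t}\hat\Omega_j^t$. Equip $\hat\Omega_j^t$ with the event space $\mathcal{F}_j^t=\{U\in\mathcal{F}: U\subset\hat\Omega_j^t\}$ and the probability measure $\hat\mu_j^t(U)=\mu(U)/\mu(\hat\Omega_j^t)$. For every $t\ge0$ let $b_1^t,\dots,b_{m^t}^t$ be positive integers,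 and let $\{\widetilde\omega^t\}_{t=0}^\infty$ be a sequence of independent random variables such that $\widetilde\omega^t$ takes values in $$\widetilde\Omega^t=(\hat\Omega_1^t)^{b_1^t}\times(\hat\Omega_2^t)^{b_2^t}\times\cdots\times(\hat\Omega_{m^t}^t)^{b_{m^t}^t}$$ with probability distribution $(\hat\mu_1^t)^{\times b_1^t}\times\cdots\times(\hat\mu_{m^t}^t)^{\times b_{m^t}^t}$. For $t\ge0$, $x\in\mathcal{M}$ and $\widetilde\omega=((\omega_{1,1},\dots,\omega_{1,b_1^t}),\dots,(\omega_{m^t,1},\dots,\omega_{m^t,b_{m^t}^t}))\in\widetilde\Omega^t$ with $(\omega_{j,1},\dots,\omega_{j,b_j^t})\in(\hat\Omega_j^t)^{b_j^t}$, define $$\widetilde H^t(x,\widetilde\omega)=\sum_{j=1}^{m^t}\frac{\mu(\hat\Omega_j^t)}{b_j^t}\sum_{k=1}^{b_j^t}H(x,\omega_{j,k}).$$ 1. Let $\{\gamma_t\}_{t=0}^\infty$ be a sequence of positive numbers with $\sum_{t=0}^\infty\gamma_t^2<\infty$, $\sum_{t=0}^\infty\gamma_t=\infty$ and $\gamma_t\le1$ for all $t\ge0$. Let $x_0$ be a fixed point in $K$ and let $\{x_t\}_{t=0}^\infty\subset\mathcal{M}$ be generated by $x_{t+1}=R_{x_t}(-\gamma_t\widetilde H^t(x_t,\widetilde\omega^t))$ for $t\ge0$. If $\{x_t\}_{t=0}^\infty\subset K$, then $F(x_t)$ converges almost surely and $\|\nabla F(x_t)\|_{x_t}\to0$ both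 almost surely and in mean square. 2. Let $x_0$ be a fixed point in $K$ and let $\alpha,\beta,\varepsilon$ be fixed positive numbers with $0<\varepsilon\le\frac12$ and $0<\alpha\le\beta^{\frac12+\varepsilon}$. Let $\{x_t\}_{t=0}^\infty\subset\mathcal{M}$ and $\{\eta_t\}_{t=0}^\infty$ be generated by $$x_{t+1}=R_{x_t}\left(-\eta_t\widetilde H^t(x_t,\widetilde\omega^t)\right),\qquad\eta_t=\frac{\alpha}{\left(\beta+\sum_{p=0}^{t-1}\|\widetilde H^p(x_p,\widetilde\omega^p)\|_{x_p}^2\right)^{\frac12+\varepsilon}}\quad\text{for } t\ge0.$$ If $\{x_t\}_{t=0}^\infty\subset K$, then $F(x_t)$ converges almost surely and $\|\nabla F(x_t)\|_{x_t}\to0$ almost surely.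
   Context: Retraction: a $C^2$ map $R:T\mathcal{M}\to\mathcal{M}$ such that for every $x\in\mathcal{M}$ the restriction $R_x=R|_{T_x\mathcal{M}}$ satisfies $R_x(\mathbf{0}_x)=x$ and $dR_x(\mathbf{0}_x)=\mathrm{id}_{T_x\mathcal{M}}$ (under the standard identification $T_{\mathbf{0}_x}T_x\mathcal{M}\cong T_x\mathcal{M}$). $\langle\cdot,\cdot\rangle_x$ and $\|\cdot\|_x$ are the Riemannian inner product and norm on $T_x\mathcal{M}$; $\nabla F$ is the Riemannian gradient. For $x\in\mathcal{M}$, $\mathbf{u}\in T_x\mathcal{M}$, identify $T_{\mathbf{u}}(T_x\mathcal{M})$ with $T_x\mathcal{M}$, so that $dR_x|_{\mathbf{u}}:T_x\mathcal{M}\to T_{R_x(\mathbf{u})}\mathcal{M}$ is linear, and let $\mathrm{adj}(dR_x|_{\mathbf{u}}):T_{R_x(\mathbf{u})}\mathcal{M}\to T_x\mathcal{M}$ be its adjoint: $\langle\mathbf{v},\mathrm{adj}(dR_x|_{\mathbf{u}})(\mathbf{w})\rangle_x=\langle dR_x|_{\mathbf{u}}(\mathbf{v}),\mathbf{w}\rangle_{R_x(\mathbf{u})}$ for all $\mathbf{v},\mathbf{w}$. $R$-Lipschitz: for a subset $K\subset\mathcal{M}$ and $r>0$, a vector field $\mathbf{v}$ on $\mathcal{M}$ is $R$-Lipschitz on $K$ up to radius $r$ if there is a constant $C>0$ (depending on $K$ and $r$) such that $\|\mathrm{adj}(dR_x|_{\mathbf{u}})(\mathbf{v}(R_x(\mathbf{u})))-\mathbf{v}(x)\|_x\le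 C\|\mathbf{u}\|_x$ for all $x\in K$ and $\mathbf{u}\in T_x\mathcal{M}$ with $\|\mathbf{u}\|_x\le r$. $\mathcal{B}_{\mathcal{M}}$ and $\mathcal{B}_{T\mathcal{M}}$ are the Borel $\sigma$-algebras of $\mathcal{M}$ and $T\mathcal{M}$; $\otimes$ denotes the product $\sigma$-algebra. Superscripts $t$ on $\hat\Omega_j^t$, $m^t$, $b_j^t$, $\widetilde\Omega^t$, $\widetilde\omega^t$, $\widetilde H^t$ are indices, not powers. An empty sum is $0$. "$\|\nabla F(x_t)\|_{x_t}\to0$ in mean square" means $\mathbb{E}(\|\nabla F(x_t)\|_{x_t}^2)\to0$. *)

theory Defs
  imports "HOL-Probability.Probability"
begin

section \<open>Functions of class \<open>C\<^sup>k\<close> on an open set\<close>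

text \<open>
  For an open subset \<open>S\<close> of a finite-dimensional space, iterating over all directional derivatives
  gives the usual notion of a \<open>C\<^sup>k\<close> function.
\<close>

primrec Ck_on ::
  "nat \<Rightarrow> ('a::real_normed_vector \<Rightarrow> 'b::real_normed_vector) \<Rightarrow> 'a set \<Rightarrow> bool" where
  "Ck_on 0 f S \<longleftrightarrow> continuous_on S f"
| "Ck_on (Suc k) f S \<longleftrightarrow>
     (\<forall>x\<in>S. f differentiable (at x)) \<and> (\<forall>v. Ck_on k (\<lambda>x. frechet_derivative f (at x) v) S)"


section \<open>Smooth manifolds\<close>

text \<open>
  The manifold is the whole type \<open>'m\<close>, and its topology is that of the type. A chart is a pair
  \<open>(U, \<phi>)\<close>; only the values of \<open>\<phi>\<close> on \<open>U\<close> are relevant. The model space \<open>'e\<close> is a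
  finite-dimensional inner product space. Its sort is one that every finite-dimensional inner
  product space satisfies; unlike \<open>euclidean_space\<close> it does not exclude dimension \<open>0\<close>.
\<close>

type_synonym ('m, 'e) chart = "'m set \<times> ('m \<Rightarrow> 'e)"

definition chart_inv :: "('m, 'e) chart \<Rightarrow> 'e \<Rightarrow> 'm" where
  "chart_inv c = inv_into (fst c) (snd c)"

definition smooth_atlas ::
  "('m::{t2_space,second_countable_topology},
    'e::{real_inner,banach,heine_borel,second_countable_topology}) chart set \<Rightarrow> bool" where
  "smooth_atlas \<A> \<longleftrightarrow>
     (\<exists>B. finite B \<and> span B = (UNIV :: 'e set)) \<and>
     (\<Union>c\<in>\<A>. fst c) = UNIV \<and>
     (\<forall>c\<in>\<A>. open (fst c) \<and> open (snd c ` fst c) \<and>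
        homeomorphism (fst c) (snd c ` fst c) (snd c) (chart_inv c)) \<and>
     (\<forall>c\<in>\<A>. \<forall>d\<in>\<A>. \<forall>k. Ck_on k (snd d \<circ> chart_inv c) (snd c ` (fst c \<inter> fst d)))"

definition chart_at :: "('m, 'e) chart set \<Rightarrow> 'm \<Rightarrow> ('m, 'e) chart" where
  "chart_at \<A> x = (SOME c. c \<in> \<A> \<and> x \<in> fst c)"

text \<open>Derivative at the point \<open>x\<close> of the transition map from the chart \<open>c\<close> to the chart \<open>d\<close>.\<close>

definition coord_change ::
  "('m, 'e::real_normed_vector) chart \<Rightarrow> ('m, 'e) chart \<Rightarrow> 'm \<Rightarrow> 'e \<Rightarrow> 'e" where
  "coord_change c d x = frechet_derivative (snd d \<circ> chart_inv c) (at (snd c x))"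


section \<open>The tangent bundle\<close>

text \<open>
  A tangent vector at \<open>x\<close> is represented by its coordinates in the chart \<open>chart_at \<A> x\<close>. Thus every
  tangent space \<open>T\<^sub>x M\<close> is a copy of \<open>'e\<close>, and the total space of \<open>TM\<close> is the set of all
  pairs \<open>(x, v)\<close>. As \<open>chart_at\<close> jumps from point to point, the topology and the differentiable
  structure of \<open>TM\<close> are NOT those of the product type \<open>'m \<times> 'e\<close>: they come from the bundle charts,
  in which \<open>v\<close> is re-expressed in one fixed chart \<open>c\<close>.
\<close>

definition bundle_chart ::
  "('m, 'e::real_normed_vector) chart set \<Rightarrow> ('m, 'e) chart \<Rightarrow> 'm \<times> 'e \<Rightarrow> 'e \<times> 'e" where
  "bundle_chart \<A> c = (\<lambda>(x, v). (snd c x, coord_change (chart_at \<A> x) c x v))"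

definition bundle_chart_inv ::
  "('m, 'e::real_normed_vector) chart set \<Rightarrow> ('m, 'e) chart \<Rightarrow> 'e \<times> 'e \<Rightarrow> 'm \<times> 'e" where
  "bundle_chart_inv \<A> c =
     (\<lambda>(p, a). (chart_inv c p, coord_change c (chart_at \<A> (chart_inv c p)) (chart_inv c p) a))"

definition tangent_topology ::
  "('m, 'e::real_normed_vector) chart set \<Rightarrow> ('m \<times> 'e) topology" where
  "tangent_topology \<A> =
     topology_generated_by
       {{(x, v). x \<in> fst c \<and> bundle_chart \<A> c (x, v) \<in> W} | c W. c \<in> \<A> \<and> open W}"

definition tangent_borel ::
  "('m, 'e::real_normed_vector) chart set \<Rightarrow> ('m \<times> 'e) measure" where
  "tangent_borel \<A> = sigma UNIV {U. openin (tangent_topology \<A>) U}"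


section \<open>Riemannian metrics and gradients\<close>

text \<open>\<open>g x\<close> is the inner product on \<open>T\<^sub>x M\<close>, in the representation of tangent vectors above.\<close>

definition riemannian_metric ::
  "('m, 'e::real_normed_vector) chart set \<Rightarrow> ('m \<Rightarrow> 'e \<Rightarrow> 'e \<Rightarrow> real) \<Rightarrow> bool" where
  "riemannian_metric \<A> g \<longleftrightarrow>
     (\<forall>x. bilinear (g x) \<and> (\<forall>v w. g x v w = g x w v) \<and> (\<forall>v. v \<noteq> 0 \<longrightarrow> g x v v > 0)) \<and>
     (\<forall>c\<in>\<A>. \<forall>a b. \<forall>k.
        Ck_on k
          (\<lambda>p. g (chart_inv c p) (snd (bundle_chart_inv \<A> c (p, a))) (snd (bundle_chart_inv \<A> c (p, b))))
          (snd c ` fst c))"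

definition rnorm :: "('m \<Rightarrow> 'e \<Rightarrow> 'e \<Rightarrow> real) \<Rightarrow> 'm \<Rightarrow> 'e \<Rightarrow> real" where
  "rnorm g x v = sqrt (g x v v)"

definition C1_function ::
  "('m, 'e::real_normed_vector) chart set \<Rightarrow> ('m \<Rightarrow> real) \<Rightarrow> bool" where
  "C1_function \<A> F \<longleftrightarrow> (\<forall>c\<in>\<A>. Ck_on 1 (F \<circ> chart_inv c) (snd c ` fst c))"

definition differential ::
  "('m, 'e::real_normed_vector) chart set \<Rightarrow> ('m \<Rightarrow> real) \<Rightarrow> 'm \<Rightarrow> 'e \<Rightarrow> real" where
  "differential \<A> F x =
     frechet_derivative (F \<circ> chart_inv (chart_at \<A> x)) (at (snd (chart_at \<A> x) x))"

definition gradient ::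
  "('m, 'e::real_normed_vector) chart set \<Rightarrow> ('m \<Rightarrow> 'e \<Rightarrow> 'e \<Rightarrow> real) \<Rightarrow> ('m \<Rightarrow> real) \<Rightarrow> 'm \<Rightarrow> 'e" where
  "gradient \<A> g F x = (THE w. \<forall>v. g x w v = differential \<A> F x v)"


section \<open>Retractions and \<open>R\<close>-Lipschitz vector fields\<close>

definition C2_bundle_map ::
  "('m::topological_space, 'e::real_normed_vector) chart set \<Rightarrow> ('m \<times> 'e \<Rightarrow> 'm) \<Rightarrow> bool" where
  "C2_bundle_map \<A> R \<longleftrightarrow>
     continuous_map (tangent_topology \<A>) euclidean R \<and>
     (\<forall>c\<in>\<A>. \<forall>d\<in>\<A>.
        Ck_on 2 (snd d \<circ> R \<circ> bundle_chart_inv \<A> c)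
          {(p, a). p \<in> snd c ` fst c \<and> R (bundle_chart_inv \<A> c (p, a)) \<in> fst d})"

text \<open>
  \<open>fibre_differential \<A> R x u\<close> is the differential at \<open>u\<close> of the restriction of \<open>R\<close> to \<open>T\<^sub>x M\<close>,
  as a map from \<open>T\<^sub>x M\<close> to the tangent space at \<open>R (x, u)\<close>.
\<close>

definition fibre_differential ::
  "('m, 'e::real_normed_vector) chart set \<Rightarrow> ('m \<times> 'e \<Rightarrow> 'm) \<Rightarrow> 'm \<Rightarrow> 'e \<Rightarrow> 'e \<Rightarrow> 'e" where
  "fibre_differential \<A> R x u =
     frechet_derivative (\<lambda>w. snd (chart_at \<A> (R (x, u))) (R (x, w))) (at u)"

definition manifold_retraction ::
  "('m::topological_space, 'e::real_normed_vector) chart set \<Rightarrow> ('m \<times> 'e \<Rightarrow> 'm) \<Rightarrow> bool" where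
  "manifold_retraction \<A> R \<longleftrightarrow>
     C2_bundle_map \<A> R \<and> (\<forall>x. R (x, 0) = x \<and> fibre_differential \<A> R x 0 = id)"

definition adj ::
  "('m \<Rightarrow> 'e \<Rightarrow> 'e \<Rightarrow> real) \<Rightarrow> 'm \<Rightarrow> 'm \<Rightarrow> ('e \<Rightarrow> 'e) \<Rightarrow> 'e \<Rightarrow> 'e" where
  "adj g x y L w = (THE a. \<forall>v. g x v a = g y (L v) w)"

definition R_Lipschitz ::
  "('m, 'e::real_normed_vector) chart set \<Rightarrow> ('m \<Rightarrow> 'e \<Rightarrow> 'e \<Rightarrow> real) \<Rightarrow> ('m \<times> 'e \<Rightarrow> 'm) \<Rightarrow>
    'm set \<Rightarrow> real \<Rightarrow> ('m \<Rightarrow> 'e) \<Rightarrow> bool" where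
  "R_Lipschitz \<A> g R K r V \<longleftrightarrow>
     (\<exists>C>0. \<forall>x\<in>K. \<forall>u. rnorm g x u \<le> r \<longrightarrow>
        rnorm g x (adj g x (R (x, u)) (fibre_differential \<A> R x u) (V (R (x, u))) - V x)
          \<le> C * rnorm g x u)"


section \<open>Stratified mini-batches\<close>

definition conditional_measure :: "'w measure \<Rightarrow> 'w set \<Rightarrow> 'w measure" where
  "conditional_measure P A = scale_measure (inverse (emeasure P A)) (restrict_space P A)"

definition batch_measure ::
  "'w measure \<Rightarrow> nat \<Rightarrow> (nat \<Rightarrow> 'w set) \<Rightarrow> (nat \<Rightarrow> nat) \<Rightarrow> (nat \<Rightarrow> nat \<Rightarrow> 'w) measure" where
  "batch_measure P m A b =
     (\<Pi>\<^sub>M j\<in>{1..m}. \<Pi>\<^sub>M k\<in>{1..b j}. conditional_measure P (A j))"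

text \<open>
  The field \<open>H\<close> takes values in the total space \<open>TM\<close>; since \<open>H (x, \<omega>)\<close> lies over \<open>x\<close>, sums are taken
  in the fibre component.
\<close>

definition batch_estimator ::
  "'w measure \<Rightarrow> ('m \<times> 'w \<Rightarrow> 'm \<times> 'e::real_vector) \<Rightarrow> nat \<Rightarrow> (nat \<Rightarrow> 'w set) \<Rightarrow> (nat \<Rightarrow> nat) \<Rightarrow>
    'm \<Rightarrow> (nat \<Rightarrow> nat \<Rightarrow> 'w) \<Rightarrow> 'e" where
  "batch_estimator P H m A b x w =
     (\<Sum>j\<in>{1..m}. (measure P (A j) / real (b j)) *\<^sub>R (\<Sum>k\<in>{1..b j}. snd (H (x, w j k))))"

end

theory Submission
  imports Defs
begin

text \<open>
  The \<open>R\<close>-Lipschitz condition gives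
  \<open>F (x\<^sub>t\<^sub>+\<^sub>1) = F (x\<^sub>t) - s\<^sub>t \<langle>\<nabla>F (x\<^sub>t), H\<^sub>t\<rangle> + O (s\<^sub>t\<^sup>2 |H\<^sub>t|\<^sup>2)\<close>, where the step \<open>s\<^sub>t\<close> depends only on the past
  and \<open>\<Sum> s\<^sub>t\<^sup>2 |H\<^sub>t|\<^sup>2\<close> is bounded by a constant (for the adaptive steps by comparison with the integral
  of \<open>v\<close> to the power \<open>-(1 + 2 \<epsilon>)\<close>). The stratified batch is unbiased, so
  \<open>s\<^sub>t (\<langle>\<nabla>F, H\<^sub>t\<rangle> - |\<nabla>F|\<^sup>2)\<close> are martingale differences with summable variances, whose series
  converges almost surely by Kolmogorov's maximal inequality. As \<open>F\<close> is bounded on \<open>K\<close>, this yields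
  \<open>\<Sum> s\<^sub>t |\<nabla>F (x\<^sub>t)|\<^sup>2 < \<infinity>\<close> and the convergence of \<open>F (x\<^sub>t)\<close>. Finally, the speed of the iteration is at
  most proportional to \<open>s\<^sub>t\<close>, so with \<open>\<Sum> s\<^sub>t = \<infinity>\<close> the continuous function \<open>|\<nabla>F|\<^sup>2\<close> cannot keep
  returning to values away from \<open>0\<close>.
\<close>

section \<open>Finite-dimensional inner product spaces\<close>

text \<open>Both step rules have the form s_t = \<open>\<sigma> t (V t q)\<close> with V the
  accumulated squared norms, so one descent argument serves both parts. It needs s_t \<le> 1, which
  keeps s_t H_t inside the radius A of the Lipschitz condition: hence \<gamma>_t \<le> 1 and the
  bound on \<alpha>. Further, \<epsilon> > 0 makes the comparison integral finite, and \<epsilon>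
  \<le> 1/2 keeps the steps above a multiple of 1/(t+1). The main obstacle is measurability. To
  average over the new batch with the past frozen, x_t must be measurable for the past; but a
  measurable H is so for the bundle \<sigma>-algebra of TM, and vectors are stored in charts that
  jump from point to point. Hence the passage to fixed charts, countably many of which cover M. F is
  C^1, and the last step works with mere continuity of |grad F|^2: it compares distances in a single
  chart with step lengths instead of estimating increments of |grad F|^2. The sort of the model
  space carries no canonical basis; a finite orthonormal frame obtained from a spanning set takes
  its place in every estimate.\<close>

locale orthonormal_frame =
  fixes C :: "'e::real_inner set"
  assumes finite_frame: "finite C"
    and frame_inner: "c \<in> C \<Longrightarrow> d \<in> C \<Longrightarrow> c \<bullet> d = (if c = d then 1 else 0)"
    and frame_expand: "a = (\<Sum>c\<in>C. (a \<bullet> c) *\<^sub>R c)"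
begin

lemma norm_frame: "c \<in> C \<Longrightarrow> norm c = 1"
  using frame_inner[of c c] by (simp add: norm_eq_sqrt_inner)

lemma abs_inner_frame_le: "c \<in> C \<Longrightarrow> \<bar>a \<bullet> c\<bar> \<le> norm a"
  using Cauchy_Schwarz_ineq2[of a c] norm_frame[of c] by simp

lemma linear_frame:
  fixes f :: "'e \<Rightarrow> 'b::real_vector"
  assumes "linear f"
  shows "f a = (\<Sum>c\<in>C. (a \<bullet> c) *\<^sub>R f c)"
  by (subst frame_expand[of a]) (simp add: linear_sum[OF assms] linear_scale[OF assms])

lemma linear_norm_le:
  fixes f :: "'e \<Rightarrow> 'b::real_normed_vector"
  assumes "linear f"
  shows "norm (f a) \<le> (\<Sum>c\<in>C. norm (f c)) * norm a"
proof -
  have "norm (f a) \<le> (\<Sum>c\<in>C. norm ((a \<bullet> c) *\<^sub>R f c))"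
    by (subst linear_frame[OF assms]) (rule norm_sum)
  also have "\<dots> \<le> (\<Sum>c\<in>C. norm (f c) * norm a)"
  proof (rule sum_mono)
    fix c assume "c \<in> C"
    then show "norm ((a \<bullet> c) *\<^sub>R f c) \<le> norm (f c) * norm a"
      using mult_right_mono[OF abs_inner_frame_le[of c a] norm_ge_zero[of "f c"]] by (simp add: mult.commute)
  qed
  finally show ?thesis by (simp add: sum_distrib_right)
qed

lemma linear_imp_bounded_linear:
  fixes f :: "'e \<Rightarrow> 'b::real_normed_vector"
  assumes "linear f"
  shows "bounded_linear f"
proof (rule bounded_linear_intro[where K = "\<Sum>c\<in>C. norm (f c)"])
  fix x show "norm (f x) \<le> norm x * (\<Sum>c\<in>C. norm (f c))"
    using linear_norm_le[OF assms, of x] by (simp add: mult.commute)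
qed (simp_all add: linear_add[OF assms] linear_scale[OF assms])

text \<open>Expanding the vector in the frame turns continuity for each fixed vector into joint
  continuity in base point and vector. Derivatives and transition maps come with the former; bundle
  maps need the latter.\<close>

lemma continuous_on_linear_family:
  fixes f :: "'x::topological_space \<Rightarrow> 'e \<Rightarrow> 'b::real_normed_vector"
  assumes lin: "\<And>p. p \<in> S \<Longrightarrow> linear (f p)"
    and cont: "\<And>c. c \<in> C \<Longrightarrow> continuous_on S (\<lambda>p. f p c)"
    and a: "continuous_on T a" and q: "continuous_on T q" "q ` T \<subseteq> S"
  shows "continuous_on T (\<lambda>z. f (q z) (a z))"
proof -
  have "continuous_on T (\<lambda>z. \<Sum>c\<in>C. (a z \<bullet> c) *\<^sub>R f (q z) c)"
    by (intro continuous_intros a continuous_on_compose2[OF cont q])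
  moreover have "f (q z) (a z) = (\<Sum>c\<in>C. (a z \<bullet> c) *\<^sub>R f (q z) c)" if "z \<in> T" for z
    using q(2) that by (intro linear_frame lin) auto
  ultimately show ?thesis by (simp cong: continuous_on_cong)
qed

lemma continuous_on_bilinear_family:
  fixes G :: "'x::topological_space \<Rightarrow> 'e \<Rightarrow> 'e \<Rightarrow> real"
  assumes bil: "\<And>p. p \<in> S \<Longrightarrow> bilinear (G p)"
    and cont: "\<And>c d. c \<in> C \<Longrightarrow> d \<in> C \<Longrightarrow> continuous_on S (\<lambda>p. G p c d)"
    and a: "continuous_on T a" and b: "continuous_on T b" and q: "continuous_on T q" "q ` T \<subseteq> S"
  shows "continuous_on T (\<lambda>z. G (q z) (a z) (b z))"
proof -
  have *: "continuous_on T (\<lambda>z. G (q z) c (b z))" if "c \<in> C" for c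
    by (rule continuous_on_linear_family[OF _ _ b q, where f = "\<lambda>p. G p c"])
      (use bil that cont in \<open>auto simp: bilinear_def\<close>)
  have "continuous_on T (\<lambda>z. \<Sum>c\<in>C. (a z \<bullet> c) *\<^sub>R G (q z) c (b z))"
    by (intro continuous_intros a *)
  moreover have "G (q z) (a z) (b z) = (\<Sum>c\<in>C. (a z \<bullet> c) *\<^sub>R G (q z) c (b z))" if "z \<in> T" for z
    using q(2) bil that by (intro linear_frame) (auto simp: bilinear_def)
  ultimately show ?thesis by (simp cong: continuous_on_cong)
qed

text \<open>The map \<open>T\<close> sending w to the frame coefficients of \<open>G w\<close> is
  injective because G is definite, hence onto in finite dimension. This is what gives meaning to the
  definite descriptions in \<open>gradient\<close> and \<open>adj\<close>.\<close>

lemma riesz: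
  fixes G :: "'e \<Rightarrow> 'e \<Rightarrow> real"
  assumes bil: "bilinear G" and pos: "\<And>v. v \<noteq> 0 \<Longrightarrow> G v v > 0" and l: "linear l"
  shows "\<exists>!w. \<forall>v. G w v = l v"
proof -
  have lin1: "linear (\<lambda>w. G w v)" and lin2: "linear (G w)" for v w
    using bil by (auto simp: bilinear_def)
  have span: "span C = UNIV"
  proof -
    have "a \<in> span C" for a
      by (subst frame_expand[of a]) (intro span_sum span_scale span_base)
    then show ?thesis by auto
  qed
  obtain B where B: "B \<subseteq> C" "independent B" "C \<subseteq> span B"
    using maximal_independent_subset[of C] by blast
  \<comment> \<open>A basis cut out of the frame makes the theorem available that an injective
    endomorphism is onto.\<close>
  interpret finite_dimensional_vector_space "(*\<^sub>R) :: real \<Rightarrow> 'e \<Rightarrow> 'e" B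
  proof (unfold_locales, fold dependent_raw_def span_raw_def)
    show "finite B" using B(1) finite_frame by (rule finite_subset)
    show "independent B" by fact
    show "span B = UNIV"
      using B(3) span by (metis span_mono span_span top.extremum_uniqueI)
  qed
  define T where "T w = (\<Sum>c\<in>C. G w c *\<^sub>R c)" for w
  have T_inner: "T w \<bullet> c = G w c" if "c \<in> C" for w c
    unfolding T_def inner_sum_left using that finite_frame
    by (simp add: frame_inner if_distrib cong: if_cong)
  have linT: "linear T"
    unfolding T_def
    by (rule linearI) (simp_all add: linear_add[OF lin1] linear_scale[OF lin1]
        scaleR_add_left sum.distrib scaleR_right.sum)
  have eqI: "G w v = G w' v" if "\<And>c. c \<in> C \<Longrightarrow> G w c = G w' c" for w w' v
    using that by (subst (1 2) linear_frame[OF lin2]) simp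
  have uniq: "w = w'" if "\<And>v. G w v = G w' v" for w w'
  proof (rule ccontr)
    assume "w \<noteq> w'"
    then have "G (w - w') (w - w') > 0" using pos by simp
    moreover have "G (w - w') (w - w') = G w (w - w') - G w' (w - w')"
      by (rule linear_diff[OF lin1])
    ultimately show False using that by simp
  qed
  have "inj T"
  proof (rule injI)
    fix w w' assume "T w = T w'"
    then have "G w c = G w' c" if "c \<in> C" for c using T_inner[OF that] by metis
    then show "w = w'" using eqI uniq by blast
  qed
  then have "surj T" by (rule linear_inj_imp_surj[OF linT[unfolded linear_def]])
  then obtain w where w: "T w = (\<Sum>c\<in>C. l c *\<^sub>R c)" by (metis surjD)
  have "G w c = l c" if "c \<in> C" for c
    using T_inner[OF that, of w] that finite_frame unfolding w inner_sum_left
    by (simp add: frame_inner if_distrib cong: if_cong)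
  then have "G w v = l v" for v
    by (subst linear_frame[OF lin2], subst linear_frame[OF l]) simp
  then show ?thesis using uniq by (metis (no_types, lifting))
qed

end

text \<open>Orthogonalise the spanning set, discard zero and normalise. The expansion holds for
  frame vectors by orthonormality and extends to the span by linearity.\<close>

lemma orthonormal_frame_exists:
  assumes "finite B" "span B = (UNIV :: 'e::real_inner set)"
  shows "\<exists>C :: 'e set. orthonormal_frame C"
proof -
  obtain D where D: "finite D" "span D = (UNIV :: 'e set)" "pairwise orthogonal D"
    using basis_orthogonal[OF assms(1)] assms(2) by metis
  define C where "C = (\<lambda>d. d /\<^sub>R norm d) ` (D - {0})"
  have fin: "finite C" using D(1) by (simp add: C_def)
  have inner: "c \<bullet> d = (if c = d then 1 else 0)" if cd: "c \<in> C" "d \<in> C" for c d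
  proof (cases "c = d")
    case True
    from cd(1) obtain c' where "c' \<noteq> 0" "c = c' /\<^sub>R norm c'" by (auto simp: C_def)
    then have "norm c = 1" using left_inverse[of "norm c'"] by (metis abs_inverse abs_norm_cancel norm_eq_zero norm_scaleR)
    then show ?thesis using True dot_square_norm[of c] by auto
  next
    case False
    with cd obtain c' d' where "c' \<in> D" "d' \<in> D" "c' \<noteq> d'" "c = c' /\<^sub>R norm c'" "d = d' /\<^sub>R norm d'"
      by (auto simp: C_def)
    with D(3) False show ?thesis by (auto simp: pairwise_def orthogonal_def)
  qed
  have spanC: "a \<in> span C" for a :: 'e
  proof -
    have "d \<in> span C" if "d \<in> D" for d
    proof (cases "d = 0")
      case False
      then have "d /\<^sub>R norm d \<in> C" using that by (auto simp: C_def)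
      from span_scale[OF span_base[OF this], of "norm d"] show ?thesis using False by simp
    qed (simp add: span_zero)
    then have "span D \<subseteq> span C" by (simp add: span_minimal subsetI)
    with D(2) show ?thesis by auto
  qed
  have "a = (\<Sum>c\<in>C. (a \<bullet> c) *\<^sub>R c)" for a :: 'e
    using spanC[of a]
  proof (induction rule: span_induct_alt)
    case (step k c y)
    have "(\<Sum>d\<in>C. (c \<bullet> d) *\<^sub>R d) = (\<Sum>d\<in>C. (if c = d then c else 0))"
      by (intro sum.cong) (auto simp: inner[OF step(1)])
    also have "\<dots> = c" using fin step(1) by simp
    finally have "(\<Sum>d\<in>C. (c \<bullet> d) *\<^sub>R d) = c" .
    then have "(\<Sum>d\<in>C. (k *\<^sub>R c \<bullet> d) *\<^sub>R d) = k *\<^sub>R c"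
      by (metis (no_types, lifting) inner_scaleR_left scaleR_right.sum scaleR_scaleR sum.cong)
    with step(2) show ?case
      by (simp add: inner_add_left scaleR_add_left sum.distrib)
  qed simp
  with fin inner have "orthonormal_frame C" by (simp add: orthonormal_frame_def)
  then show ?thesis ..
qed

lemma tendsto_nhds_of_continuous_on:
  "continuous_on S f \<Longrightarrow> open S \<Longrightarrow> x \<in> S \<Longrightarrow> (f \<longlongrightarrow> f x) (nhds x)"
  by (metis at_within_open continuous_on_def tendsto_at_iff_tendsto_nhds)

section \<open>Uniform definiteness of a continuous family of forms\<close>

context orthonormal_frame
begin

text \<open>On the compact unit sphere \<open>G p0\<close> has a positive minimum m. Near p0 the
  coefficients in the frame differ from those at p0 by less than m/2 in total, so \<open>G p\<close>
  stays above m/2 on the sphere, and homogeneity does the rest.\<close>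

lemma eventually_positive_definite_bound:
  fixes G :: "'x::topological_space \<Rightarrow> 'e \<Rightarrow> 'e \<Rightarrow> real"
  assumes cpt: "compact (sphere (0 :: 'e) 1)"
    and bil: "\<And>p. p \<in> S \<Longrightarrow> bilinear (G p)"
    and cont: "\<And>c d. continuous_on S (\<lambda>p. G p c d)"
    and pos: "\<And>v. v \<noteq> 0 \<Longrightarrow> G p0 v v > 0"
    and S: "open S" "p0 \<in> S"
  shows "\<exists>L>0. \<forall>\<^sub>F p in nhds p0. \<forall>a. (norm a)\<^sup>2 \<le> L * G p a a"
proof -
  have bounds: "bounded_bilinear (G p0)"
  proof -
    have "linear (G p0 a)" "linear (\<lambda>x. G p0 x a)" for a using bil[OF S(2)] by (auto simp: bilinear_def)
    note lin = this
    have "norm (G p0 a b) \<le> norm a * norm b * (\<Sum>c\<in>C. \<Sum>d\<in>C. norm (G p0 c d))" for a b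
    proof -
      have "norm (G p0 a b) \<le> (\<Sum>c\<in>C. norm (G p0 c b)) * norm a"
        by (rule linear_norm_le[OF lin(2)])
      also have "\<dots> \<le> (\<Sum>c\<in>C. (\<Sum>d\<in>C. norm (G p0 c d)) * norm b) * norm a"
        by (intro mult_right_mono sum_mono linear_norm_le[OF lin(1)]) auto
      finally show ?thesis by (simp add: sum_distrib_left sum_distrib_right mult_ac)
    qed
    then show ?thesis
      by unfold_locales
        (auto simp: linear_add[OF lin(1)] linear_add[OF lin(2)] linear_scale[OF lin(1)]
          linear_scale[OF lin(2)] intro!: exI)
  qed
  obtain m where m: "m > 0" "\<And>a. norm a = 1 \<Longrightarrow> m \<le> G p0 a a"
  \<comment> \<open>In dimension 0 the unit sphere is empty and there is no minimum to take; any
    positive m then serves.\<close>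
  proof (cases "sphere (0 :: 'e) 1 = {}")
    case True
    then have "\<And>a :: 'e. norm a \<noteq> 1" by (auto simp: sphere_def)
    then show ?thesis using that[of 1] by auto
  next
    case False
    have "continuous_on (sphere 0 1) (\<lambda>a. G p0 a a)"
      by (intro bounded_bilinear.continuous_on[OF bounds] continuous_intros)
    from continuous_attains_inf[OF cpt False this]
    obtain a0 where a0: "a0 \<in> sphere 0 1" "\<And>a. a \<in> sphere 0 1 \<Longrightarrow> G p0 a0 a0 \<le> G p0 a a"
      by blast
    then have "a0 \<noteq> 0" by auto
    show ?thesis using that[of "G p0 a0 a0"] a0 pos[OF \<open>a0 \<noteq> 0\<close>] by auto
  qed
  have "((\<lambda>p. \<Sum>c\<in>C. \<Sum>d\<in>C. \<bar>G p c d - G p0 c d\<bar>) \<longlongrightarrow> (\<Sum>c\<in>C. \<Sum>d\<in>C. \<bar>G p0 c d - G p0 c d\<bar>)) (nhds p0)"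
    by (intro tendsto_intros tendsto_nhds_of_continuous_on[OF cont S])
  then have "\<forall>\<^sub>F p in nhds p0. (\<Sum>c\<in>C. \<Sum>d\<in>C. \<bar>G p c d - G p0 c d\<bar>) < m / 2"
    using m(1) by (intro order_tendstoD(2)) auto
  moreover have "\<forall>\<^sub>F p in nhds p0. p \<in> S" using S by (rule eventually_nhds_in_open)
  ultimately have "\<forall>\<^sub>F p in nhds p0. \<forall>a. (norm a)\<^sup>2 \<le> (2 / m) * G p a a"
  proof eventually_elim
    case (elim p)
    have lin: "linear (G p a)" "linear (\<lambda>x. G p x a)" for a
      using bil[OF elim(2)] by (auto simp: bilinear_def)
    have lin0: "linear (G p0 a)" "linear (\<lambda>x. G p0 x a)" for a
      using bil[OF S(2)] by (auto simp: bilinear_def)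
    show ?case
    proof
      fix a :: 'e
      have unit: "m / 2 \<le> G p a a" if a: "norm a = 1" for a
      proof -
        have lin': "linear (\<lambda>b. G p a b - G p0 a b)" "linear (\<lambda>b. G p b a - G p0 b a)" for a
          by (intro linear_compose_sub lin lin0)+
        have "norm (G p a a - G p0 a a) \<le> (\<Sum>c\<in>C. norm (G p c a - G p0 c a)) * norm a"
          by (rule linear_norm_le[OF lin'(2)])
        also have "\<dots> \<le> (\<Sum>c\<in>C. (\<Sum>d\<in>C. norm (G p c d - G p0 c d)) * norm a) * norm a"
          by (intro mult_right_mono sum_mono linear_norm_le[OF lin'(1)]) auto
        also have "\<dots> < m / 2" using elim(1) a by simp
        finally show ?thesis using m(2)[OF a] unfolding real_norm_def by linarith
      qed
      show "(norm a)\<^sup>2 \<le> (2 / m) * G p a a"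
      proof (cases "a = 0")
        case True
        then show ?thesis using linear_0[OF lin(1)] by simp
      next
        case False
        let ?u = "a /\<^sub>R norm a"
        have "G p ?u ?u = G p a a / (norm a)\<^sup>2"
          by (simp add: linear_scale[OF lin(1)] linear_scale[OF lin(2)] power2_eq_square divide_inverse)
        moreover have "m / 2 \<le> G p ?u ?u" by (rule unit) (use False in simp)
        ultimately have "m / 2 * (norm a)\<^sup>2 \<le> G p a a" using False by (simp add: pos_le_divide_eq)
        with m(1) show ?thesis by (simp add: field_simps)
      qed
    qed
  qed
  then show ?thesis using m(1) by (intro exI[of _ "2 / m"]) simp
qed

end

section \<open>Norms from positive definite forms\<close>

locale positive_form =
  fixes G :: "'e::real_vector \<Rightarrow> 'e \<Rightarrow> real"
  assumes bil: "bilinear G" and sym: "G v w = G w v" and pos: "v \<noteq> 0 \<Longrightarrow> G v v > 0"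
begin

lemma linear_left: "linear (\<lambda>v. G v w)" and linear_right: "linear (G v)"
  using bil by (auto simp: bilinear_def)

lemmas form_simps =
  linear_add[OF linear_left] linear_add[OF linear_right] linear_diff[OF linear_left]
  linear_diff[OF linear_right] linear_scale[OF linear_left] linear_scale[OF linear_right]
  linear_neg[OF linear_left] linear_neg[OF linear_right]
  linear_0[OF linear_left] linear_0[OF linear_right]

lemma nonneg: "0 \<le> G v v"
  using pos[of v] by (cases "v = 0") (auto simp: form_simps)

lemma Cauchy_Schwarz_sq: "(G v w)\<^sup>2 \<le> G v v * G w w"
proof (cases "w = 0")
  case False
  \<comment> \<open>\<open>k\<close> is the coefficient of the projection of v onto w, which
    minimises the form on v - k w.\<close>
  define k where "k = G v w / G w w"
  have "0 \<le> G (v - k *\<^sub>R w) (v - k *\<^sub>R w)" by (rule nonneg)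
  also have "\<dots> = G v v - 2 * k * G v w + k * k * G w w"
    by (simp add: form_simps sym[of w v] algebra_simps)
  also have "\<dots> = G v v - (G v w)\<^sup>2 / G w w"
    using pos[OF False] by (simp add: k_def power2_eq_square field_simps)
  finally show ?thesis using pos[OF False] by (simp add: field_simps)
qed (simp add: form_simps)

lemma Cauchy_Schwarz: "\<bar>G v w\<bar> \<le> sqrt (G v v) * sqrt (G w w)"
  using Cauchy_Schwarz_sq[of v w] by (metis real_sqrt_abs real_sqrt_le_mono real_sqrt_mult)

lemma triangle: "sqrt (G (v + w) (v + w)) \<le> sqrt (G v v) + sqrt (G w w)"
proof (rule real_le_lsqrt)
  have "G (v + w) (v + w) = G v v + 2 * G v w + G w w"
    by (simp add: form_simps sym[of w v])
  also have "\<dots> \<le> G v v + 2 * (sqrt (G v v) * sqrt (G w w)) + G w w"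
    using Cauchy_Schwarz[of v w] by simp
  also have "\<dots> = (sqrt (G v v) + sqrt (G w w))\<^sup>2"
    using nonneg by (simp add: power2_sum)
  finally show "G (v + w) (v + w) \<le> (sqrt (G v v) + sqrt (G w w))\<^sup>2" .
qed (use nonneg in auto)

lemma norm_scale: "sqrt (G (k *\<^sub>R v) (k *\<^sub>R v)) = \<bar>k\<bar> * sqrt (G v v)"
  by (simp add: form_simps real_sqrt_mult flip: mult.assoc)

lemma norm_sum_le: "sqrt (G (\<Sum>i\<in>I. f i) (\<Sum>i\<in>I. f i)) \<le> (\<Sum>i\<in>I. sqrt (G (f i) (f i)))"
proof (induction I rule: infinite_finite_induct)
  case (insert i I)
  then show ?case using triangle[of "f i" "\<Sum>i\<in>I. f i"] by simp
qed (simp_all add: form_simps)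

end

section \<open>Charts and the tangent bundle\<close>

locale atlas = orthonormal_frame C
  for C :: "'e::{real_inner,banach,heine_borel,second_countable_topology} set" +
  fixes \<A> :: "('m::{t2_space,second_countable_topology}, 'e) chart set"
  assumes smooth: "smooth_atlas \<A>"
begin

lemma chart:
  assumes "c \<in> \<A>"
  shows open_domain: "open (fst c)" and open_range: "open (snd c ` fst c)"
    and continuous_chart: "continuous_on (fst c) (snd c)"
    and continuous_chart_inv: "continuous_on (snd c ` fst c) (chart_inv c)"
    and chart_inv_chart: "x \<in> fst c \<Longrightarrow> chart_inv c (snd c x) = x"
    and chart_chart_inv: "p \<in> snd c ` fst c \<Longrightarrow> snd c (chart_inv c p) = p"
    and chart_inv_in: "p \<in> snd c ` fst c \<Longrightarrow> chart_inv c p \<in> fst c"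
proof -
  from smooth assms have "open (fst c)" "open (snd c ` fst c)"
    and h: "homeomorphism (fst c) (snd c ` fst c) (snd c) (chart_inv c)"
    unfolding smooth_atlas_def by blast+
  then show "open (fst c)" "open (snd c ` fst c)" by auto
  from h show "continuous_on (fst c) (snd c)" "continuous_on (snd c ` fst c) (chart_inv c)"
    by (auto simp: homeomorphism_def)
  from h show "x \<in> fst c \<Longrightarrow> chart_inv c (snd c x) = x"
    "p \<in> snd c ` fst c \<Longrightarrow> snd c (chart_inv c p) = p"
    "p \<in> snd c ` fst c \<Longrightarrow> chart_inv c p \<in> fst c"
    unfolding homeomorphism_def by auto
qed

lemma chart_at: "chart_at \<A> x \<in> \<A>" "x \<in> fst (chart_at \<A> x)"
proof -
  have "(\<Union>c\<in>\<A>. fst c) = UNIV" using smooth by (simp add: smooth_atlas_def)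
  then have "\<exists>c. c \<in> \<A> \<and> x \<in> fst c" by blast
  then have "chart_at \<A> x \<in> \<A> \<and> x \<in> fst (chart_at \<A> x)"
    unfolding chart_at_def by (rule someI_ex)
  then show "chart_at \<A> x \<in> \<A>" "x \<in> fst (chart_at \<A> x)" by auto
qed

lemma open_preimage_chart:
  assumes "c \<in> \<A>" "open S"
  shows "open {p \<in> snd c ` fst c. chart_inv c p \<in> S}"
  using continuous_open_preimage[OF continuous_chart_inv[OF assms(1)] open_range[OF assms(1)] assms(2)]
  by (simp add: vimage_def Int_def)

lemma overlap_eq:
  assumes "c \<in> \<A>"
  shows "snd c ` (fst c \<inter> S) = {p \<in> snd c ` fst c. chart_inv c p \<in> S}"
  using chart_inv_chart[OF assms] by auto

lemma transition_has_derivative: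
  assumes "c \<in> \<A>" "d \<in> \<A>" "x \<in> fst c" "x \<in> fst d"
  shows "((snd d \<circ> chart_inv c) has_derivative coord_change c d x) (at (snd c x))"
proof -
  have "Ck_on (Suc 0) (snd d \<circ> chart_inv c) (snd c ` (fst c \<inter> fst d))"
    using smooth assms unfolding smooth_atlas_def by blast
  with assms show ?thesis
    by (auto simp: coord_change_def frechet_derivative_works simp del: o_apply)
qed

lemma linear_coord_change:
  "c \<in> \<A> \<Longrightarrow> d \<in> \<A> \<Longrightarrow> x \<in> fst c \<Longrightarrow> x \<in> fst d \<Longrightarrow> linear (coord_change c d x)"
  by (rule has_derivative_linear[OF transition_has_derivative])

lemma continuous_coord_change:
  assumes "c \<in> \<A>" "d \<in> \<A>"
  shows "continuous_on {p \<in> snd c ` fst c. chart_inv c p \<in> fst d} (\<lambda>p. coord_change c d (chart_inv c p) a)"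
proof -
  have "Ck_on (Suc 0) (snd d \<circ> chart_inv c) (snd c ` (fst c \<inter> fst d))"
    using smooth assms unfolding smooth_atlas_def by blast
  then have "continuous_on (snd c ` (fst c \<inter> fst d)) (\<lambda>p. frechet_derivative (snd d \<circ> chart_inv c) (at p) a)"
    by simp
  then show ?thesis
    unfolding overlap_eq[OF assms(1)] coord_change_def
    by (rule continuous_on_eq) (auto simp: chart_chart_inv[OF assms(1)] chart_inv_chart[OF assms(1)])
qed

text \<open>Near the point, f read in c is f read in d after the transition map, so the chain rule
  applies; the two expressions agree on the open overlap of the charts.\<close>

lemma has_derivative_change_chart:
  assumes c: "c \<in> \<A>" and d: "d \<in> \<A>" and x: "x \<in> fst c" "x \<in> fst d"
    and f: "((f \<circ> chart_inv d) has_derivative f') (at (snd d x))"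
  shows "((f \<circ> chart_inv c) has_derivative (f' \<circ> coord_change c d x)) (at (snd c x))"
proof -
  have "(snd d \<circ> chart_inv c) (snd c x) = snd d x" using chart_inv_chart[OF c x(1)] by simp
  then have "(f \<circ> chart_inv d \<circ> (snd d \<circ> chart_inv c) has_derivative f' \<circ> coord_change c d x) (at (snd c x))"
    using f by (intro diff_chain_at transition_has_derivative assms) simp
  moreover have "open (snd c ` (fst c \<inter> fst d))"
    unfolding overlap_eq[OF c] by (intro open_preimage_chart open_domain c d)
  moreover have "(f \<circ> chart_inv d \<circ> (snd d \<circ> chart_inv c)) p = (f \<circ> chart_inv c) p"
    if "p \<in> snd c ` (fst c \<inter> fst d)" for p
    using that chart_inv_chart[OF c] chart_inv_chart[OF d] by auto
  moreover have "snd c x \<in> snd c ` (fst c \<inter> fst d)" using x by blast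
  ultimately show ?thesis
    by (metis (no_types, lifting) has_derivative_transform_within_open)
qed

text \<open>Both sides are derivatives at the same point of the transition map from c to e, and
  derivatives are unique.\<close>

lemma coord_change_trans:
  assumes c: "c \<in> \<A>" and d: "d \<in> \<A>" and e: "e \<in> \<A>"
    and x: "x \<in> fst c" "x \<in> fst d" "x \<in> fst e"
  shows "coord_change d e x (coord_change c d x a) = coord_change c e x a"
proof -
  have "((snd e \<circ> chart_inv c) has_derivative (coord_change d e x \<circ> coord_change c d x)) (at (snd c x))"
    by (intro has_derivative_change_chart transition_has_derivative assms)
  then have "coord_change d e x \<circ> coord_change c d x = coord_change c e x"
    using transition_has_derivative[OF c e x(1,3)] by (rule has_derivative_unique)
  then show ?thesis by (metis o_apply)
qed

lemma coord_change_id: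
  assumes c: "c \<in> \<A>" and x: "x \<in> fst c"
  shows "coord_change c c x a = a"
proof -
  have "((\<lambda>p. p) has_derivative (\<lambda>a. a)) (at (snd c x))" by (rule has_derivative_ident)
  then have "((snd c \<circ> chart_inv c) has_derivative (\<lambda>a. a)) (at (snd c x))"
    by (rule has_derivative_transform_within_open[OF _ open_range[OF c]])
      (use x chart_chart_inv[OF c] in auto)
  then have "(\<lambda>a. a) = coord_change c c x"
    using transition_has_derivative[OF c c x x] by (rule has_derivative_unique)
  then show ?thesis by metis
qed

text \<open>A vector at x is stored in \<open>chart_at \<A> x\<close>, which varies with x without
  any continuity. Continuity and measurability of vector-valued maps can be expressed after passing
  to \<open>coords c\<close> in one fixed chart; \<open>lift c\<close> goes back.\<close>

definition coords :: "('m, 'e) chart \<Rightarrow> 'm \<Rightarrow> 'e \<Rightarrow> 'e" where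
  "coords c x = coord_change (chart_at \<A> x) c x"

definition lift :: "('m, 'e) chart \<Rightarrow> 'm \<Rightarrow> 'e \<Rightarrow> 'e" where
  "lift c x = coord_change c (chart_at \<A> x) x"

lemma bundle_chart_inv_eq: "bundle_chart_inv \<A> c (p, a) = (chart_inv c p, lift c (chart_inv c p) a)"
  by (simp add: bundle_chart_inv_def lift_def)

lemma coords:
  assumes "c \<in> \<A>" "x \<in> fst c"
  shows linear_coords: "linear (coords c x)" and linear_lift: "linear (lift c x)"
    and lift_coords: "lift c x (coords c x v) = v" and coords_lift: "coords c x (lift c x a) = a"
  unfolding coords_def lift_def using assms chart_at[of x]
  by (simp_all add: linear_coord_change coord_change_trans coord_change_id)

lemma lift_chart_at: "lift (chart_at \<A> x) x a = a"
  unfolding lift_def by (intro coord_change_id chart_at)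

lemma bundle_chart_inv_coords:
  assumes "c \<in> \<A>" "x \<in> fst c"
  shows "bundle_chart_inv \<A> c (snd c x, coords c x v) = (x, v)"
  using assms by (simp add: bundle_chart_inv_eq chart_inv_chart lift_coords)

text \<open>It suffices to test the generators of the tangent topology. On the overlap with d the
  composite with \<open>bundle_chart \<A> d\<close> is the transition map paired with its
  derivative: the cocycle rule has removed \<open>chart_at\<close>, and what remains is jointly
  continuous.\<close>

lemma continuous_bundle_chart_inv:
  assumes c: "c \<in> \<A>"
  shows "continuous_map (top_of_set (snd c ` fst c \<times> UNIV)) (tangent_topology \<A>) (bundle_chart_inv \<A> c)"
  unfolding tangent_topology_def
proof (rule continuous_on_generated_topo)
  let ?D = "snd c ` fst c \<times> (UNIV :: 'e set)"
  fix U assume "U \<in> {{(x, v). x \<in> fst d \<and> bundle_chart \<A> d (x, v) \<in> W} | d W. d \<in> \<A> \<and> open W}"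
  then obtain d W where d: "d \<in> \<A>" "open W"
    and U: "U = {(x, v). x \<in> fst d \<and> bundle_chart \<A> d (x, v) \<in> W}" by blast
  define S where "S = {p \<in> snd c ` fst c. chart_inv c p \<in> fst d}"
  have S: "open S" unfolding S_def by (intro open_preimage_chart open_domain c d)
  define T where "T z = (snd d (chart_inv c (fst z)), coord_change c d (chart_inv c (fst z)) (snd z))"
    for z :: "'e \<times> 'e"
  have "continuous_on (S \<times> UNIV) T"
    unfolding T_def
  proof (intro continuous_on_Pair)
    show "continuous_on (S \<times> UNIV) (\<lambda>z. snd d (chart_inv c (fst z)))"
      by (intro continuous_on_compose2[OF continuous_chart[OF d(1)]]
          continuous_on_compose2[OF continuous_chart_inv[OF c]] continuous_intros) (auto simp: S_def)
    show "continuous_on (S \<times> UNIV) (\<lambda>z. coord_change c d (chart_inv c (fst z)) (snd z))"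
      by (rule continuous_on_linear_family[where f = "\<lambda>p. coord_change c d (chart_inv c p)" and S = S])
        (auto simp: S_def intro!: continuous_intros linear_coord_change continuous_coord_change c d
          chart_inv_in)
  qed
  then have "open ((S \<times> UNIV) \<inter> T -` W)"
    by (intro continuous_open_preimage open_Times S d) auto
  moreover have "bundle_chart_inv \<A> c -` U \<inter> topspace (top_of_set ?D) = (S \<times> UNIV) \<inter> T -` W"
  proof (intro set_eqI iffI)
    fix z assume "z \<in> bundle_chart_inv \<A> c -` U \<inter> topspace (top_of_set ?D)"
    then show "z \<in> (S \<times> UNIV) \<inter> T -` W"
      using c d(1) chart_at
      by (auto simp: U S_def T_def bundle_chart_inv_eq bundle_chart_def lift_def coord_change_trans
          chart_inv_in chart_inv_chart)
  next
    fix z assume "z \<in> (S \<times> UNIV) \<inter> T -` W"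
    then show "z \<in> bundle_chart_inv \<A> c -` U \<inter> topspace (top_of_set ?D)"
      using c d(1) chart_at
      by (auto simp: U S_def T_def bundle_chart_inv_eq bundle_chart_def lift_def coord_change_trans
          chart_inv_in chart_inv_chart)
  qed
  moreover have "(S \<times> UNIV) \<inter> T -` W \<subseteq> ?D" by (auto simp: S_def)
  ultimately show "openin (top_of_set ?D) (bundle_chart_inv \<A> c -` U \<inter> topspace (top_of_set ?D))"
    by (simp add: open_subset)
next
  show "bundle_chart_inv \<A> c ` topspace (top_of_set (snd c ` fst c \<times> UNIV)) \<subseteq>
    \<Union> {{(x, v). x \<in> fst d \<and> bundle_chart \<A> d (x, v) \<in> W} | d W. d \<in> \<A> \<and> open W}"
  proof
    fix z :: "'m \<times> 'e"
    have "z \<in> {(x, v). x \<in> fst (chart_at \<A> (fst z)) \<and> bundle_chart \<A> (chart_at \<A> (fst z)) (x, v) \<in> UNIV}"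
      using chart_at by (auto simp: case_prod_beta)
    then show "z \<in> \<Union> {{(x, v). x \<in> fst d \<and> bundle_chart \<A> d (x, v) \<in> W} | d W. d \<in> \<A> \<and> open W}"
      using chart_at open_UNIV by blast
  qed
qed

lemma continuous_on_charts:
  fixes f :: "'m \<Rightarrow> 'b::topological_space"
  assumes "\<And>c. c \<in> \<A> \<Longrightarrow> continuous_on (snd c ` fst c) (f \<circ> chart_inv c)"
  shows "continuous_on UNIV f"
proof -
  have "continuous_on (fst c) f" if c: "c \<in> \<A>" for c
  proof -
    have "continuous_on (fst c) (f \<circ> chart_inv c \<circ> snd c)"
      by (intro continuous_on_compose continuous_chart assms c)
    then show ?thesis by (rule continuous_on_eq) (simp add: chart_inv_chart[OF c])
  qed
  then have "continuous_on (\<Union>c\<in>\<A>. fst c) f"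
    by (intro continuous_on_open_UN open_domain)
  then show ?thesis using smooth by (simp add: smooth_atlas_def)
qed

end

section \<open>Riemannian metrics and gradients\<close>

locale riemannian = atlas C \<A>
  for C :: "'e::{real_inner,banach,heine_borel,second_countable_topology} set"
    and \<A> :: "('m::{t2_space,second_countable_topology}, 'e) chart set" +
  fixes g :: "'m \<Rightarrow> 'e \<Rightarrow> 'e \<Rightarrow> real"
  assumes metric: "riemannian_metric \<A> g"
begin

sublocale positive_form "g x" for x
  using metric by unfold_locales (auto simp: riemannian_metric_def)

lemma rnorm_nonneg: "0 \<le> rnorm g x v"
  using nonneg by (simp add: rnorm_def)

lemma rnorm_sq: "(rnorm g x v)\<^sup>2 = g x v v"
  using nonneg by (simp add: rnorm_def)

lemma rnorm_Cauchy_Schwarz: "\<bar>g x v w\<bar> \<le> rnorm g x v * rnorm g x w"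
  using Cauchy_Schwarz by (simp add: rnorm_def)

lemma rnorm_scale: "rnorm g x (k *\<^sub>R v) = \<bar>k\<bar> * rnorm g x v"
  using norm_scale by (simp add: rnorm_def)

lemma rnorm_minus: "rnorm g x (- v) = rnorm g x v"
  by (simp add: rnorm_def form_simps)

lemma rnorm_sum_le: "rnorm g x (\<Sum>i\<in>I. f i) \<le> (\<Sum>i\<in>I. rnorm g x (f i))"
  using norm_sum_le by (simp add: rnorm_def)

section \<open>The metric in chart coordinates\<close>

definition chart_metric :: "('m, 'e) chart \<Rightarrow> 'e \<Rightarrow> 'e \<Rightarrow> 'e \<Rightarrow> real" where
  "chart_metric c p a b = g (chart_inv c p) (lift c (chart_inv c p) a) (lift c (chart_inv c p) b)"

lemma chart_metric_coords:
  assumes "c \<in> \<A>" "x \<in> fst c"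
  shows "chart_metric c (snd c x) (coords c x v) (coords c x w) = g x v w"
  using assms by (simp add: chart_metric_def chart_inv_chart lift_coords)

lemma continuous_chart_metric:
  assumes "c \<in> \<A>"
  shows "continuous_on (snd c ` fst c) (\<lambda>p. chart_metric c p a b)"
proof -
  have "Ck_on 0 (\<lambda>p. g (chart_inv c p) (snd (bundle_chart_inv \<A> c (p, a))) (snd (bundle_chart_inv \<A> c (p, b))))
    (snd c ` fst c)"
    using metric assms unfolding riemannian_metric_def by blast
  then show ?thesis by (simp add: bundle_chart_inv_eq chart_metric_def)
qed

lemma bilinear_chart_metric:
  assumes "c \<in> \<A>" "p \<in> snd c ` fst c"
  shows "bilinear (chart_metric c p)"
proof -
  have lin: "linear (lift c (chart_inv c p))"
    using assms by (intro linear_lift chart_inv_in)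
  show ?thesis
    unfolding bilinear_def chart_metric_def
    using linear_compose[OF lin linear_left] linear_compose[OF lin linear_right] by (simp add: o_def)
qed

lemma chart_metric_pos:
  assumes "c \<in> \<A>" "p \<in> snd c ` fst c" "a \<noteq> 0"
  shows "chart_metric c p a a > 0"
proof -
  note x = chart_inv_in[OF assms(1,2)]
  have "lift c (chart_inv c p) a \<noteq> 0"
    using coords_lift[OF assms(1) x, of a] linear_0[OF linear_coords[OF assms(1) x]] assms(3) by metis
  then show ?thesis by (simp add: chart_metric_def pos)
qed

lemma continuous_chart_metric2:
  assumes c: "c \<in> \<A>" and "continuous_on T q" "q ` T \<subseteq> snd c ` fst c"
    "continuous_on T a" "continuous_on T b"
  shows "continuous_on T (\<lambda>z. chart_metric c (q z) (a z) (b z))"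
  by (rule continuous_on_bilinear_family[where S = "snd c ` fst c"])
    (use assms in \<open>auto intro!: bilinear_chart_metric continuous_chart_metric\<close>)

lemma eventually_norm_le_chart_metric:
  assumes c: "c \<in> \<A>" and p0: "p0 \<in> snd c ` fst c"
  shows "\<exists>L>0. \<forall>\<^sub>F p in nhds p0. \<forall>a. (norm a)\<^sup>2 \<le> L * chart_metric c p a a"
proof (rule eventually_positive_definite_bound[where S = "snd c ` fst c" and G = "chart_metric c"])
  have "bounded (sphere (0 :: 'e) 1)" by (rule boundedI[of _ 1]) simp
  moreover have "closed (sphere (0 :: 'e) 1)"
    unfolding sphere_def by (intro closed_Collect_eq continuous_intros)
  ultimately show "compact (sphere (0 :: 'e) 1)" by (simp add: compact_eq_bounded_closed)
qed (fact p0 | rule bilinear_chart_metric[OF c] continuous_chart_metric[OF c] chart_metric_pos[OF c p0]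
    open_range[OF c]; assumption)+

end

locale C1_potential = riemannian C \<A> g
  for C :: "'e::{real_inner,banach,heine_borel,second_countable_topology} set"
    and \<A> :: "('m::{t2_space,second_countable_topology}, 'e) chart set"
    and g :: "'m \<Rightarrow> 'e \<Rightarrow> 'e \<Rightarrow> real" +
  fixes F :: "'m \<Rightarrow> real"
  assumes C1: "C1_function \<A> F"
begin

section \<open>Differential and gradient in chart coordinates\<close>

definition chart_diff :: "('m, 'e) chart \<Rightarrow> 'e \<Rightarrow> 'e \<Rightarrow> real" where
  "chart_diff c p = frechet_derivative (F \<circ> chart_inv c) (at p)"

lemma chart_diff:
  assumes "c \<in> \<A>" "p \<in> snd c ` fst c"
  shows "((F \<circ> chart_inv c) has_derivative chart_diff c p) (at p)"
  using C1 assms by (auto simp: C1_function_def chart_diff_def frechet_derivative_works simp del: o_apply)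

lemma continuous_F: "continuous_on UNIV F"
proof (rule continuous_on_charts)
  fix c assume "c \<in> \<A>"
  then show "continuous_on (snd c ` fst c) (F \<circ> chart_inv c)"
    by (intro continuous_at_imp_continuous_on ballI has_derivative_continuous[OF chart_diff])
qed

lemma linear_chart_diff: "c \<in> \<A> \<Longrightarrow> p \<in> snd c ` fst c \<Longrightarrow> linear (chart_diff c p)"
  by (rule has_derivative_linear[OF chart_diff])

lemma continuous_chart_diff:
  assumes "c \<in> \<A>"
  shows "continuous_on (snd c ` fst c) (\<lambda>p. chart_diff c p a)"
  using C1 assms by (auto simp: C1_function_def chart_diff_def simp del: o_apply)

lemma differential_eq_chart_diff:
  assumes c: "c \<in> \<A>" "x \<in> fst c"
  shows "differential \<A> F x v = chart_diff c (snd c x) (coords c x v)"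
proof -
  have "((F \<circ> chart_inv (chart_at \<A> x)) has_derivative (chart_diff c (snd c x) \<circ> coords c x))
    (at (snd (chart_at \<A> x) x))"
    unfolding coords_def using c chart_at[of x]
    by (intro has_derivative_change_chart chart_diff) auto
  from frechet_derivative_at[OF this] show ?thesis by (metis differential_def o_apply)
qed

lemma gradient: "g x (gradient \<A> g F x) v = differential \<A> F x v"
proof -
  have "linear (differential \<A> F x)"
    unfolding differential_def chart_diff_def[symmetric]
    using chart_at[of x] by (intro linear_chart_diff) auto
  then have "\<exists>!w. \<forall>v. g x w v = differential \<A> F x v" by (intro riesz bil pos)
  from theI'[OF this] show ?thesis unfolding gradient_def by simp
qed

lemma g_gradient_coords:
  assumes "c \<in> \<A>" "x \<in> fst c"
  shows "g x (gradient \<A> g F x) v = chart_diff c (snd c x) (coords c x v)"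
  using assms by (simp add: gradient differential_eq_chart_diff)

definition grad_sq :: "'m \<Rightarrow> real" where
  "grad_sq x = g x (gradient \<A> g F x) (gradient \<A> g F x)"

lemma grad_sq_nonneg: "0 \<le> grad_sq x"
  by (simp add: grad_sq_def nonneg)

lemma rnorm_gradient: "rnorm g x (gradient \<A> g F x) = sqrt (grad_sq x)"
  by (simp add: rnorm_def grad_sq_def)

text \<open>
  In a chart, the gradient \<open>w p\<close> is characterised by \<open>G\<^sub>p (w p) a = \<l>\<^sub>p a\<close>. Then \<open>w p - w p0\<close>
  represents the functional \<open>\<l>\<^sub>p - G\<^sub>p (w p0)\<close>, which is small near \<open>p0\<close>; as the forms \<open>G\<^sub>p\<close> are
  uniformly definite there, \<open>w p - w p0\<close> is small as well.
\<close>

lemma continuous_grad_sq: "continuous_on UNIV grad_sq"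
proof (rule continuous_on_charts)
  fix c assume c: "c \<in> \<A>"
  define V where "V = snd c ` fst c"
  have V: "open V" unfolding V_def by (rule open_range[OF c])
  define w where "w p = coords c (chart_inv c p) (gradient \<A> g F (chart_inv c p))" for p
  have inv: "chart_inv c p \<in> fst c" "snd c (chart_inv c p) = p" if "p \<in> V" for p
    using that chart_inv_in[OF c] chart_chart_inv[OF c] by (auto simp: V_def)
  have w: "chart_metric c p (w p) a = chart_diff c p a" if p: "p \<in> V" for p a
    using chart_metric_coords[OF c inv(1)[OF p], of "gradient \<A> g F (chart_inv c p)" "lift c (chart_inv c p) a"]
      g_gradient_coords[OF c inv(1)[OF p], of "lift c (chart_inv c p) a"]
    by (simp add: inv[OF p] w_def coords_lift[OF c inv(1)[OF p]])
  have "isCont w p0" if p0: "p0 \<in> V" for p0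
  proof -
    define l where "l p a = chart_diff c p a - chart_metric c p (w p0) a" for p a
    obtain L where L: "L > 0" "\<forall>\<^sub>F p in nhds p0. \<forall>a. (norm a)\<^sup>2 \<le> L * chart_metric c p a a"
      using eventually_norm_le_chart_metric[OF c] p0 by (auto simp: V_def)
    have "((\<lambda>p. L * (\<Sum>c\<in>C. \<bar>l p c\<bar>)) \<longlongrightarrow> L * (\<Sum>c\<in>C. \<bar>l p0 c\<bar>)) (nhds p0)"
      unfolding l_def using c V p0
      by (intro tendsto_intros tendsto_nhds_of_continuous_on[of V])
        (auto simp: V_def intro!: continuous_chart_diff continuous_chart_metric)
    moreover have "l p0 a = 0" for a by (simp add: l_def w[OF p0])
    ultimately have lim: "((\<lambda>p. L * (\<Sum>c\<in>C. \<bar>l p c\<bar>)) \<longlongrightarrow> 0) (nhds p0)" by simp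
    have "\<forall>\<^sub>F p in nhds p0. norm (w p - w p0) \<le> L * (\<Sum>c\<in>C. \<bar>l p c\<bar>)"
      using L(2) eventually_nhds_in_open[OF V p0]
    proof eventually_elim
      case (elim p)
      have p: "p \<in> snd c ` fst c" using elim(2) by (simp add: V_def)
      note bl = bilinear_chart_metric[OF c p]
      have lin: "linear (l p)"
        unfolding l_def using bl linear_chart_diff[OF c p]
        by (intro linear_compose_sub) (auto simp: bilinear_def)
      have "(norm (w p - w p0))\<^sup>2 \<le> L * chart_metric c p (w p - w p0) (w p - w p0)" using elim(1) by simp
      also have "chart_metric c p (w p - w p0) (w p - w p0) = l p (w p - w p0)"
        using linear_diff[of "\<lambda>a. chart_metric c p a (w p - w p0)" "w p" "w p0"] bl w[OF elim(2)]
        by (simp add: l_def bilinear_def)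
      also have "L * \<dots> \<le> L * ((\<Sum>c\<in>C. \<bar>l p c\<bar>) * norm (w p - w p0))"
        using linear_norm_le[OF lin, of "w p - w p0"] L(1) by (intro mult_left_mono) auto
      finally have "norm (w p - w p0) * norm (w p - w p0) \<le> (L * (\<Sum>c\<in>C. \<bar>l p c\<bar>)) * norm (w p - w p0)"
        by (simp add: power2_eq_square mult_ac)
      moreover have "0 \<le> L * (\<Sum>c\<in>C. \<bar>l p c\<bar>)" using L(1) by (auto intro!: mult_nonneg_nonneg sum_nonneg)
      ultimately show ?case by (cases "norm (w p - w p0) = 0") (auto dest: mult_right_le_imp_le)
    qed
    then have "((\<lambda>p. w p - w p0) \<longlongrightarrow> 0) (nhds p0)"
      by (intro Lim_null_comparison[OF _ lim])
    then have "(w \<longlongrightarrow> w p0) (nhds p0)" by (simp add: LIM_zero_iff)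
    then show ?thesis by (simp add: isCont_def tendsto_at_iff_tendsto_nhds)
  qed
  then have cont_w: "continuous_on V w" by (simp add: continuous_at_imp_continuous_on)
  \<comment> \<open>The squared length is evaluated as dF applied to the gradient, which in the
    chart is \<open>chart_diff c p (w p)\<close>.\<close>
  have "continuous_on V (\<lambda>p. chart_diff c p (w p))"
    by (rule continuous_on_linear_family[where f = "chart_diff c" and S = V and q = "\<lambda>p. p"])
      (auto simp: V_def[symmetric] cont_w intro!: linear_chart_diff[OF c, folded V_def]
        continuous_chart_diff[OF c, folded V_def])
  moreover have "chart_diff c p (w p) = (grad_sq \<circ> chart_inv c) p" if "p \<in> V" for p
    unfolding o_def grad_sq_def g_gradient_coords[OF c inv(1)[OF that]] inv(2)[OF that] w_def ..
  ultimately show "continuous_on (snd c ` fst c) (grad_sq \<circ> chart_inv c)"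
    unfolding V_def by (rule continuous_on_eq)
qed

end

section \<open>Retractions\<close>

locale retracted = C1_potential C \<A> g F
  for C :: "'e::{real_inner,banach,heine_borel,second_countable_topology} set"
    and \<A> :: "('m::{t2_space,second_countable_topology}, 'e) chart set"
    and g :: "'m \<Rightarrow> 'e \<Rightarrow> 'e \<Rightarrow> real"
    and F :: "'m \<Rightarrow> real" +
  fixes R :: "'m \<times> 'e \<Rightarrow> 'm"
  assumes retraction: "manifold_retraction \<A> R"
begin

lemma R_zero: "R (x, 0) = x"
  using retraction by (simp add: manifold_retraction_def)

lemma continuous_R:
  assumes "c \<in> \<A>"
  shows "continuous_on (snd c ` fst c \<times> UNIV) (R \<circ> bundle_chart_inv \<A> c)"
proof -
  have "continuous_map (tangent_topology \<A>) euclidean R"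
    using retraction by (simp add: manifold_retraction_def C2_bundle_map_def)
  from continuous_map_compose[OF continuous_bundle_chart_inv[OF assms] this]
  show ?thesis by simp
qed

section \<open>The retraction in chart coordinates\<close>

definition R_domain :: "('m, 'e) chart \<Rightarrow> ('m, 'e) chart \<Rightarrow> ('e \<times> 'e) set" where
  "R_domain c d = {(p, a). p \<in> snd c ` fst c \<and> R (bundle_chart_inv \<A> c (p, a)) \<in> fst d}"

definition chart_R :: "('m, 'e) chart \<Rightarrow> ('m, 'e) chart \<Rightarrow> 'e \<times> 'e \<Rightarrow> 'e" where
  "chart_R c d = snd d \<circ> R \<circ> bundle_chart_inv \<A> c"

lemma open_R_domain:
  assumes "c \<in> \<A>" "d \<in> \<A>"
  shows "open (R_domain c d)"
proof -
  have "open ((snd c ` fst c \<times> UNIV) \<inter> (R \<circ> bundle_chart_inv \<A> c) -` fst d)"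
    using assms by (intro continuous_open_preimage continuous_R open_Times open_range open_domain) auto
  also have "(snd c ` fst c \<times> UNIV) \<inter> (R \<circ> bundle_chart_inv \<A> c) -` fst d = R_domain c d"
    by (auto simp: R_domain_def)
  finally show ?thesis .
qed

lemma chart_R:
  assumes "c \<in> \<A>" "d \<in> \<A>"
  shows chart_R_has_derivative: "z \<in> R_domain c d \<Longrightarrow>
      (chart_R c d has_derivative frechet_derivative (chart_R c d) (at z)) (at z)"
    and continuous_chart_R_derivative:
      "continuous_on (R_domain c d) (\<lambda>z. frechet_derivative (chart_R c d) (at z) v)"
proof -
  have "Ck_on (Suc (Suc 0)) (chart_R c d) (R_domain c d)"
    using retraction assms unfolding manifold_retraction_def C2_bundle_map_def chart_R_def R_domain_def
      numeral_2_eq_2 by blast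
  then have *: "\<forall>z\<in>R_domain c d. chart_R c d differentiable (at z)"
    and "Ck_on (Suc 0) (\<lambda>z. frechet_derivative (chart_R c d) (at z) v) (R_domain c d)"
    unfolding Ck_on.simps(2)[of "Suc 0"] by blast+
  from this(2) have **: "\<forall>z\<in>R_domain c d. (\<lambda>z. frechet_derivative (chart_R c d) (at z) v) differentiable (at z)"
    unfolding Ck_on.simps(2)[of 0] by blast
  from * show "z \<in> R_domain c d \<Longrightarrow>
      (chart_R c d has_derivative frechet_derivative (chart_R c d) (at z)) (at z)"
    by (simp add: frechet_derivative_works)
  from ** show "continuous_on (R_domain c d) (\<lambda>z. frechet_derivative (chart_R c d) (at z) v)"
    by (intro continuous_at_imp_continuous_on ballI differentiable_imp_continuous_within) auto
qed

text \<open>\<open>fibre_differential\<close> is a chosen derivative and says something once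
  differentiability is known. That comes from the total derivative of \<open>chart_R\<close>
  restricted to the fibre direction; in the chart \<open>chart_at \<A> x\<close> a stored vector is
  its own coordinate vector.\<close>

lemma R_fibre_has_derivative:
  "((\<lambda>w. snd (chart_at \<A> (R (x, u))) (R (x, w))) has_derivative fibre_differential \<A> R x u) (at u)"
proof -
  let ?c = "chart_at \<A> x" and ?d = "chart_at \<A> (R (x, u))"
  have eq: "bundle_chart_inv \<A> ?c (snd ?c x, w) = (x, w)" for w
    using chart_at[of x] by (simp add: bundle_chart_inv_eq chart_inv_chart lift_chart_at)
  have "(snd ?c x, u) \<in> R_domain ?c ?d"
    using chart_at by (auto simp: R_domain_def eq)
  then have "(chart_R ?c ?d has_derivative frechet_derivative (chart_R ?c ?d) (at (snd ?c x, u))) (at (snd ?c x, u))"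
    using chart_at by (intro chart_R_has_derivative) auto
  moreover have "((\<lambda>w. (snd ?c x, w)) has_derivative (\<lambda>v. (0, v))) (at u)"
    by (auto intro!: derivative_eq_intros)
  ultimately have "(chart_R ?c ?d \<circ> (\<lambda>w. (snd ?c x, w)) has_derivative
      frechet_derivative (chart_R ?c ?d) (at (snd ?c x, u)) \<circ> (\<lambda>v. (0, v))) (at u)"
    by (intro diff_chain_at) auto
  also have "chart_R ?c ?d \<circ> (\<lambda>w. (snd ?c x, w)) = (\<lambda>w. snd ?d (R (x, w)))"
    by (simp add: fun_eq_iff chart_R_def eq)
  finally show ?thesis
    unfolding fibre_differential_def
    using differentiableI frechet_derivative_works by blast
qed

lemma continuous_R_fibre: "continuous_on UNIV (\<lambda>w. R (x, w))"
proof -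
  let ?c = "chart_at \<A> x"
  have eq: "bundle_chart_inv \<A> ?c (snd ?c x, w) = (x, w)" for w
    using chart_at[of x] by (simp add: bundle_chart_inv_eq chart_inv_chart lift_chart_at)
  have "continuous_on UNIV (\<lambda>w. (R \<circ> bundle_chart_inv \<A> ?c) (snd ?c x, w))"
    using chart_at by (intro continuous_on_compose2[OF continuous_R] continuous_intros) auto
  then show ?thesis by (simp add: eq)
qed

text \<open>Chain rule through the chart at R (x, u), in which \<open>coords\<close> is the identity
  at that point. Factoring F through this chart is valid for those w with R (x, w) in its domain, an
  open set containing u.\<close>

lemma F_R_has_derivative:
  "((\<lambda>w. F (R (x, w))) has_derivative
    (\<lambda>v. g (R (x, u)) (gradient \<A> g F (R (x, u))) (fibre_differential \<A> R x u v))) (at u)"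
proof -
  let ?y = "R (x, u)" let ?d = "chart_at \<A> ?y"
  have d: "?d \<in> \<A>" "?y \<in> fst ?d" by (rule chart_at)+
  have "((F \<circ> chart_inv ?d) \<circ> (\<lambda>w. snd ?d (R (x, w))) has_derivative
      (chart_diff ?d (snd ?d ?y) \<circ> fibre_differential \<A> R x u)) (at u)"
    using d by (intro diff_chain_at R_fibre_has_derivative chart_diff) auto
  moreover have "open ((\<lambda>w. R (x, w)) -` fst ?d)"
    using continuous_R_fibre open_domain[OF d(1)] by (rule open_vimage[rotated])
  ultimately have "((\<lambda>w. F (R (x, w))) has_derivative
      (chart_diff ?d (snd ?d ?y) \<circ> fibre_differential \<A> R x u)) (at u)"
    by (rule has_derivative_transform_within_open) (use d in \<open>auto simp: chart_inv_chart\<close>)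
  moreover have "coords ?d ?y v = v" for v
    using d by (simp add: coords_def coord_change_id)
  ultimately show ?thesis by (simp add: g_gradient_coords[OF d] o_def)
qed

text \<open>The definite description in \<open>adj\<close> is resolved by \<open>riesz\<close>; its
  unknown sits in the second slot of \<open>g x\<close>, hence the use of symmetry.\<close>

lemma g_adj:
  assumes "linear L"
  shows "g x v (adj g x y L w) = g y (L v) w"
proof -
  have "linear (\<lambda>v. g y (L v) w)"
    using linear_compose[OF assms linear_left] by (simp add: o_def)
  then have "\<exists>!a. \<forall>v. g x a v = g y (L v) w" by (intro riesz bil pos)
  then have "\<exists>!a. \<forall>v. g x v a = g y (L v) w" by (simp add: sym)
  from theI'[OF this] show ?thesis unfolding adj_def by simp
qed

text \<open>
  By the chain rule the derivative of \<open>s \<mapsto> F (R (x, s u))\<close> is the inner product of \<open>u\<close> with the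
  adjoint of \<open>dR\<close> applied to the gradient, which is what \<open>R\<close>-Lipschitz continuity controls.
\<close>

lemma descent:
  assumes lip: "R_Lipschitz \<A> g R K A (gradient \<A> g F)"
  shows "\<exists>Q>0. \<forall>x\<in>K. \<forall>u. rnorm g x u \<le> A \<longrightarrow>
    \<bar>F (R (x, u)) - F x - g x (gradient \<A> g F x) u\<bar> \<le> Q * (rnorm g x u)\<^sup>2"
proof -
  let ?D = "gradient \<A> g F"
  obtain Q where Q: "Q > 0"
    and lip': "\<And>x u. x \<in> K \<Longrightarrow> rnorm g x u \<le> A \<Longrightarrow>
      rnorm g x (adj g x (R (x, u)) (fibre_differential \<A> R x u) (?D (R (x, u))) - ?D x) \<le> Q * rnorm g x u"
    using lip unfolding R_Lipschitz_def by blast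
  have "\<bar>F (R (x, u)) - F x - g x (?D x) u\<bar> \<le> Q * (rnorm g x u)\<^sup>2"
    if x: "x \<in> K" and u: "rnorm g x u \<le> A" for x u
  proof -
    define ad where "ad s = adj g x (R (x, s *\<^sub>R u)) (fibre_differential \<A> R x (s *\<^sub>R u)) (?D (R (x, s *\<^sub>R u)))"
      for s
    have der: "((\<lambda>s. F (R (x, s *\<^sub>R u))) has_real_derivative g x u (ad s)) (at s)" for s
    proof -
      let ?L = "fibre_differential \<A> R x (s *\<^sub>R u)"
      have lin: "linear ?L" by (rule has_derivative_linear[OF R_fibre_has_derivative])
      have "((\<lambda>s. s *\<^sub>R u) has_derivative (\<lambda>h. h *\<^sub>R u)) (at s)"
        by (auto intro!: derivative_eq_intros)
      from diff_chain_at[OF this F_R_has_derivative]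
      have "((\<lambda>s. F (R (x, s *\<^sub>R u))) has_derivative
          (\<lambda>h. g (R (x, s *\<^sub>R u)) (?D (R (x, s *\<^sub>R u))) (?L (h *\<^sub>R u)))) (at s)"
        by (simp add: o_def)
      also have "(\<lambda>h. g (R (x, s *\<^sub>R u)) (?D (R (x, s *\<^sub>R u))) (?L (h *\<^sub>R u))) = (*) (g x u (ad s))"
        by (simp add: fun_eq_iff ad_def g_adj[OF lin] linear_scale[OF lin] form_simps sym mult.commute)
      finally show ?thesis by (simp add: has_field_derivative_def)
    qed
    \<comment> \<open>The mean value theorem stands in for integrating the derivative over [0, 1],
      at the cost of a factor 2 in the constant. The intermediate vector s u is no longer than u and
      so stays within radius A.\<close>
    have "\<exists>s>0. s < 1 \<and> F (R (x, 1 *\<^sub>R u)) - F (R (x, 0 *\<^sub>R u)) = (1 - 0) * g x u (ad s)"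
      by (intro MVT2 der) simp_all
    then obtain s where s: "0 < s" "s < 1" "F (R (x, u)) - F x = g x u (ad s)"
      by (auto simp: R_zero)
    have su: "rnorm g x (s *\<^sub>R u) \<le> rnorm g x u"
      using s(1,2) rnorm_nonneg[of x u] by (simp add: rnorm_scale mult_left_le_one_le)
    have "\<bar>F (R (x, u)) - F x - g x (?D x) u\<bar> = \<bar>g x u (ad s - ?D x)\<bar>"
      by (simp add: s(3) form_simps sym[of x u "?D x"])
    also have "\<dots> \<le> rnorm g x u * rnorm g x (ad s - ?D x)" by (rule rnorm_Cauchy_Schwarz)
    also have "\<dots> \<le> rnorm g x u * (Q * rnorm g x (s *\<^sub>R u))"
      unfolding ad_def using su u by (intro mult_left_mono lip' x rnorm_nonneg) simp
    also have "\<dots> \<le> rnorm g x u * (Q * rnorm g x u)"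
      using su Q by (intro mult_left_mono rnorm_nonneg) auto
    finally show ?thesis by (simp add: power2_eq_square mult_ac)
  qed
  with Q show ?thesis by blast
qed

text \<open>In a chart R is continuously differentiable and fixes the zero section, so its
  displacement is at most a bound on the fibre derivative times the coordinate norm; definiteness of
  the metric bounds that norm by \<open>rnorm\<close>. Both bounds hold uniformly near x0. Remaining
  in the chart domain is part of the claim because chart distances mean nothing outside it.\<close>

lemma local_displacement:
  fixes x0 :: 'm
  defines "c \<equiv> chart_at \<A> x0"
  shows "\<exists>r>0. \<exists>\<delta>>0. \<exists>L>0. \<forall>x\<in>fst c. dist (snd c x) (snd c x0) < r \<longrightarrow>
    (\<forall>u. rnorm g x u \<le> \<delta> \<longrightarrow> R (x, u) \<in> fst c \<and> norm (snd c (R (x, u)) - snd c x) \<le> L * rnorm g x u)"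
proof -
  have c: "c \<in> \<A>" "x0 \<in> fst c" by (simp_all add: c_def chart_at)
  define p0 where "p0 = snd c x0"
  have p0: "p0 \<in> snd c ` fst c" using c(2) by (simp add: p0_def)
  define D where "D z = frechet_derivative (chart_R c c) (at z)" for z
  \<comment> \<open>The sum over the frame dominates the operator norm of the fibre derivative at
    the zero vector over x0; the added 1 leaves room for nearby points and makes M positive.\<close>
  define M where "M = (\<Sum>e\<in>C. norm (D (p0, 0) (0, e))) + 1"
  have zero: "R (bundle_chart_inv \<A> c (p, 0)) = chart_inv c p" if "p \<in> snd c ` fst c" for p
    using linear_0[OF linear_lift[OF c(1) chart_inv_in[OF c(1) that]]] by (simp add: bundle_chart_inv_eq R_zero)
  have z0: "(p0, 0) \<in> R_domain c c"
    using p0 zero[OF p0] chart_inv_in[OF c(1) p0] by (simp add: R_domain_def)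
  have "((\<lambda>z. \<Sum>e\<in>C. norm (D z (0, e))) \<longlongrightarrow> (\<Sum>e\<in>C. norm (D (p0, 0) (0, e)))) (nhds (p0, 0))"
    unfolding D_def
    by (intro tendsto_intros tendsto_nhds_of_continuous_on[OF continuous_chart_R_derivative open_R_domain] c z0)
  then have "\<forall>\<^sub>F z in nhds (p0, 0). (\<Sum>e\<in>C. norm (D z (0, e))) < M"
    by (rule order_tendstoD(2)) (simp add: M_def)
  then have "\<forall>\<^sub>F z in nhds p0 \<times>\<^sub>F nhds 0. (\<Sum>e\<in>C. norm (D z (0, e))) < M \<and> z \<in> R_domain c c"
    unfolding nhds_prod[symmetric]
    using eventually_nhds_in_open[OF open_R_domain[OF c(1) c(1)] z0] by (rule eventually_conj)
  then obtain P1 P2 where P: "eventually P1 (nhds p0)" "eventually P2 (nhds 0)"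
    and P12: "\<And>p a. P1 p \<Longrightarrow> P2 a \<Longrightarrow> (\<Sum>e\<in>C. norm (D (p, a) (0, e))) < M \<and> (p, a) \<in> R_domain c c"
    unfolding eventually_prod_filter by blast
  obtain L where L: "L > 0" "\<forall>\<^sub>F p in nhds p0. \<forall>a. (norm a)\<^sup>2 \<le> L * chart_metric c p a a"
    using eventually_norm_le_chart_metric[OF c(1) p0] by blast
  obtain r1 where r1: "r1 > 0" "\<And>p. dist p p0 < r1 \<Longrightarrow> P1 p \<and> (\<forall>a. (norm a)\<^sup>2 \<le> L * chart_metric c p a a)"
    using eventually_conj[OF P(1) L(2)] unfolding eventually_nhds_metric by blast
  obtain r2 where r2: "r2 > 0" "\<And>a. norm a < r2 \<Longrightarrow> P2 a"
    using P(2) unfolding eventually_nhds_metric by auto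
  have M: "M > 0" unfolding M_def by (intro add_nonneg_pos sum_nonneg) auto
  have "R (x, u) \<in> fst c \<and> norm (snd c (R (x, u)) - snd c x) \<le> M * sqrt L * rnorm g x u"
    \<comment> \<open>The radius r2 / (2 sqrt L) forces coordinate norms of at most r2 / 2, so the
      whole segment from 0 to the coordinate vector lies where the derivative bound holds.\<close>
    if x: "x \<in> fst c" "dist (snd c x) p0 < r1" and u: "rnorm g x u \<le> r2 / (2 * sqrt L)" for x u
  proof -
    define p where "p = snd c x"
    define a where "a = coords c x u"
    have p: "dist p p0 < r1" "p \<in> snd c ` fst c" "chart_inv c p = x"
      using x chart_inv_chart[OF c(1)] by (auto simp: p_def)
    have "norm a = sqrt ((norm a)\<^sup>2)" by simp
    also have "\<dots> \<le> sqrt (L * chart_metric c p a a)"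
      using r1(2)[OF p(1)] by (intro real_sqrt_le_mono) auto
    also have "\<dots> = sqrt L * rnorm g x u"
      unfolding p_def a_def chart_metric_coords[OF c(1) x(1)] by (simp add: real_sqrt_mult rnorm_def)
    finally have norm_a: "norm a \<le> sqrt L * rnorm g x u" .
    also have "\<dots> \<le> sqrt L * (r2 / (2 * sqrt L))" using u L(1) by (intro mult_left_mono) auto
    also have "\<dots> < r2" using L(1) r2(1) by simp
    finally have a: "a \<in> ball 0 r2" by simp
    have in_dom: "(p, b) \<in> R_domain c c" and bound: "(\<Sum>e\<in>C. norm (D (p, b) (0, e))) \<le> M"
      if "b \<in> ball 0 r2" for b
      using P12[of p b] r1(2)[OF p(1)] r2(2)[of b] that by auto
    \<comment> \<open>Mean value inequality along the fibre over the fixed base point p, on a ball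
      and hence on a convex set.\<close>
    have "norm (chart_R c c (p, a) - chart_R c c (p, 0)) \<le> M * norm (a - 0)"
    proof (rule differentiable_bound[where S = "ball 0 r2"])
      fix b :: 'e assume b: "b \<in> ball 0 r2"
      have der: "(chart_R c c has_derivative D (p, b)) (at (p, b))"
        unfolding D_def using in_dom[OF b] by (rule chart_R_has_derivative[OF c(1) c(1)])
      moreover have "((\<lambda>b. (p, b)) has_derivative (\<lambda>v. (0, v))) (at b)"
        by (auto intro!: derivative_eq_intros)
      ultimately have "(chart_R c c \<circ> (\<lambda>b. (p, b)) has_derivative D (p, b) \<circ> (\<lambda>v. (0, v))) (at b)"
        by (intro diff_chain_at)
      then have d: "((\<lambda>b. chart_R c c (p, b)) has_derivative (\<lambda>v. D (p, b) (0, v))) (at b)"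
        by (simp add: o_def)
      then show "((\<lambda>b. chart_R c c (p, b)) has_derivative (\<lambda>v. D (p, b) (0, v))) (at b within ball 0 r2)"
        by (rule has_derivative_at_withinI)
      show "onorm (\<lambda>v. D (p, b) (0, v)) \<le> M"
      proof (rule onorm_bound)
        show "0 \<le> M" using M by simp
        fix v
        have "norm (D (p, b) (0, v)) \<le> (\<Sum>e\<in>C. norm (D (p, b) (0, e))) * norm v"
          by (rule linear_norm_le[OF has_derivative_linear[OF d]])
        also have "\<dots> \<le> M * norm v" by (intro mult_right_mono bound b) auto
        finally show "norm (D (p, b) (0, v)) \<le> M * norm v" .
      qed
    qed (use a r2(1) in auto)
    moreover have "chart_R c c (p, a) = snd c (R (x, u))"
      unfolding chart_R_def p_def a_def using bundle_chart_inv_coords[OF c(1) x(1)] by simp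
    moreover have "chart_R c c (p, 0) = p"
      unfolding chart_R_def using zero[OF p(2)] chart_chart_inv[OF c(1) p(2)] by simp
    ultimately have "norm (snd c (R (x, u)) - snd c x) \<le> M * norm a" by (simp add: p_def)
    also have "\<dots> \<le> M * (sqrt L * rnorm g x u)" using M norm_a by (intro mult_left_mono) auto
    finally have "norm (snd c (R (x, u)) - snd c x) \<le> M * sqrt L * rnorm g x u" by (simp add: mult_ac)
    moreover have "R (x, u) \<in> fst c"
      using in_dom[OF a] bundle_chart_inv_coords[OF c(1) x(1), of u] by (simp add: R_domain_def p_def a_def)
    ultimately show ?thesis by blast
  qed
  moreover have "r2 / (2 * sqrt L) > 0" "M * sqrt L > 0" using r2(1) L(1) M by auto
  ultimately show ?thesis using r1(1) unfolding p0_def by blast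
qed

text \<open>
  If \<open>h\<close> stayed above \<open>2 \<epsilon>\<close> infinitely often, the points would return arbitrarily late to a chart
  ball on which \<open>h > \<epsilon>\<close>. As long as they remain there, the distance travelled is at most a
  constant times \<open>\<Sum> s h / \<epsilon>\<close>, which is small; so they never leave, and \<open>\<Sum> s \<le> \<Sum> s h / \<epsilon>\<close> is finite.
\<close>

lemma tendsto_zero_along_steps:
  fixes x :: "nat \<Rightarrow> 'm" and h :: "'m \<Rightarrow> real"
  assumes K: "compact K" "\<And>t. x t \<in> K"
    and h: "continuous_on UNIV h" "\<And>x. 0 \<le> h x"
    and s: "\<And>t. 0 < s t" "s \<longlonglongrightarrow> 0" "\<not> summable s"
    and sh: "summable (\<lambda>t. s t * h (x t))"
    and step: "\<And>t. x (Suc t) = R (x t, - (s t *\<^sub>R v t))"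
    and v: "\<And>t. rnorm g (x t) (v t) \<le> A" and A: "A > 0"
  shows "(\<lambda>t. h (x t)) \<longlonglongrightarrow> 0"
proof (rule ccontr)
  assume "\<not> ?thesis"
  then obtain e where e: "e > 0" "\<exists>\<^sub>F t in sequentially. e \<le> h (x t)"
    using h(2) unfolding tendsto_iff frequently_def by (auto simp: not_le)
  \<comment> \<open>By continuity h is at least e at the limit point of the high iterates; the
    strictly smaller level e / 2 is therefore exceeded on a whole neighbourhood.\<close>
  define \<epsilon> where "\<epsilon> = e / 2"
  have \<epsilon>: "\<epsilon> > 0" using e by (simp add: \<epsilon>_def)
  have "infinite {t. e \<le> h (x t)}"
    using e(2) by (simp add: frequently_cofinite[symmetric] cofinite_eq_sequentially)
  then obtain k :: "nat \<Rightarrow> nat" where k: "strict_mono k" "\<And>n. e \<le> h (x (k n))"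
    using infinite_enumerate[of "{t. e \<le> h (x t)}"] by auto
  obtain l k' where l: "l \<in> K" and k': "strict_mono k'" and lim: "((x \<circ> k) \<circ> k') \<longlonglongrightarrow> l"
    using seq_compactE[OF compact_imp_seq_compact[OF K(1)], of "x \<circ> k"] K(2) by (metis o_apply)
  define c where "c = chart_at \<A> l"
  have c: "c \<in> \<A>" "l \<in> fst c" by (simp_all add: c_def chart_at)
  have inv: "chart_inv c (snd c y) = y" if "y \<in> fst c" for y using chart_inv_chart[OF c(1) that] .
  have "(\<lambda>n. h (((x \<circ> k) \<circ> k') n)) \<longlonglongrightarrow> h l"
    by (rule continuous_on_tendsto_compose[OF h(1) lim]) auto
  then have "e \<le> h l" by (rule tendsto_lowerbound) (auto simp: k(2))
  obtain r \<delta> L where r: "r > 0" and \<delta>: "\<delta> > 0" and L: "L > 0"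
    and move: "\<And>y u. y \<in> fst c \<Longrightarrow> dist (snd c y) (snd c l) < r \<Longrightarrow> rnorm g y u \<le> \<delta> \<Longrightarrow>
      R (y, u) \<in> fst c \<and> norm (snd c (R (y, u)) - snd c y) \<le> L * rnorm g y u"
    using local_displacement[of l] unfolding c_def by meson
  have "open {p \<in> snd c ` fst c. chart_inv c p \<in> {y. \<epsilon> < h y}}"
    by (intro open_preimage_chart c open_Collect_less continuous_intros h(1))
  moreover have "snd c l \<in> {p \<in> snd c ` fst c. chart_inv c p \<in> {y. \<epsilon> < h y}}"
    using c inv \<open>e \<le> h l\<close> e(1) by (auto simp: \<epsilon>_def)
  ultimately obtain r1 where r1: "r1 > 0" "ball (snd c l) r1 \<subseteq> {p \<in> snd c ` fst c. chart_inv c p \<in> {y. \<epsilon> < h y}}"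
    by (meson openE)
  define \<rho> where "\<rho> = min r r1"
  have \<rho>: "\<rho> > 0" using r r1 by (simp add: \<rho>_def)
  have high: "\<epsilon> < h y" if "y \<in> fst c" "dist (snd c y) (snd c l) < \<rho>" for y
  proof -
    have "snd c y \<in> ball (snd c l) r1" using that(2) by (simp add: \<rho>_def dist_commute)
    with r1(2) have "\<epsilon> < h (chart_inv c (snd c y))" by blast
    then show ?thesis by (simp add: inv[OF that(1)])
  qed
  have "\<forall>\<^sub>F t in sequentially. s t < \<delta> / A"
    using s(2) \<delta> A by (intro order_tendstoD(2)[of _ 0]) auto
  then obtain T1 where T1: "\<And>t. t \<ge> T1 \<Longrightarrow> s t < \<delta> / A" by (auto simp: eventually_sequentially)
  \<comment> \<open>The tail is so small that, divided by \<epsilon> and multiplied by the speed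
    bound L A, it allows a drift of \<rho>/2. The starting point is chosen in the ball of radius
    \<rho>/2, so the iteration stays in the ball of radius \<rho>.\<close>
  obtain T2 where T2: "\<And>m n. m \<ge> T2 \<Longrightarrow> norm (\<Sum>t\<in>{m..<n}. s t * h (x t)) < \<epsilon> * \<rho> / (2 * L * A)"
    using sh[unfolded summable_Cauchy, rule_format, of "\<epsilon> * \<rho> / (2 * L * A)"] \<epsilon> \<rho> L A by auto
  have kk: "filterlim (k \<circ> k') at_top sequentially"
    using k(1) k' by (intro filterlim_subseq strict_mono_o)
  have "\<forall>\<^sub>F n in sequentially. ((x \<circ> k) \<circ> k') n \<in> fst c \<inter> snd c -` ball (snd c l) (\<rho> / 2)"
  proof (rule topological_tendstoD[OF lim])
    show "open (fst c \<inter> snd c -` ball (snd c l) (\<rho> / 2))"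
      by (intro continuous_open_preimage continuous_chart open_domain c open_ball)
    show "l \<in> fst c \<inter> snd c -` ball (snd c l) (\<rho> / 2)" using c \<rho> by simp
  qed
  moreover have "\<forall>\<^sub>F n in sequentially. max T1 T2 \<le> (k \<circ> k') n"
    using kk unfolding filterlim_at_top by blast
  ultimately have "\<forall>\<^sub>F n in sequentially. x ((k \<circ> k') n) \<in> fst c \<inter> snd c -` ball (snd c l) (\<rho> / 2) \<and> max T1 T2 \<le> (k \<circ> k') n"
    by eventually_elim simp
  then have "\<exists>n. x n \<in> fst c \<inter> snd c -` ball (snd c l) (\<rho> / 2) \<and> max T1 T2 \<le> n"
    using eventually_happens'[OF sequentially_bot] by blast
  then obtain n where n: "x n \<in> fst c" "dist (snd c (x n)) (snd c l) < \<rho> / 2" "T1 \<le> n" "T2 \<le> n"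
    by (auto simp: dist_commute)
  \<comment> \<open>The three claims feed each other: staying near bounds the sum of the steps by
    that of s h, and this bound keeps the drift small enough for the next step to stay near.\<close>
  have stay: "x (n + j) \<in> fst c \<and> dist (snd c (x (n + j))) (snd c (x n)) \<le> L * A * (\<Sum>t\<in>{n..<n + j}. s t) \<and>
      \<epsilon> * (\<Sum>t\<in>{n..<n + j}. s t) \<le> (\<Sum>t\<in>{n..<n + j}. s t * h (x t))" for j
  proof (induction j)
    case 0
    then show ?case using n(1) by simp
  next
    case (Suc j)
    let ?y = "x (n + j)" and ?u = "- (s (n + j) *\<^sub>R v (n + j))"
    have "L * A * (\<Sum>t\<in>{n..<n + j}. s t) \<le> L * A * ((\<Sum>t\<in>{n..<n + j}. s t * h (x t)) / \<epsilon>)"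
      using Suc \<epsilon> L A by (intro mult_left_mono) (auto simp: field_simps)
    also have "\<dots> < L * A * ((\<epsilon> * \<rho> / (2 * L * A)) / \<epsilon>)"
      using T2[OF n(4), of "n + j"] \<epsilon> L A by (intro mult_strict_left_mono divide_strict_right_mono) auto
    also have "\<dots> = \<rho> / 2" using \<epsilon> L A by simp
    finally have "dist (snd c ?y) (snd c (x n)) < \<rho> / 2" using Suc by linarith
    then have near: "dist (snd c ?y) (snd c l) < \<rho>"
      using n(2) dist_triangle[of "snd c ?y" "snd c l" "snd c (x n)"] by linarith
    have y: "?y \<in> fst c" using Suc by blast
    have "rnorm g ?y ?u = s (n + j) * rnorm g ?y (v (n + j))"
      using s(1)[of "n + j"] by (simp add: rnorm_minus rnorm_scale)
    also have le: "\<dots> \<le> s (n + j) * A"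
      using v s(1)[of "n + j"] by (intro mult_left_mono) auto
    finally have u: "rnorm g ?y ?u \<le> s (n + j) * A" .
    also have "\<dots> \<le> \<delta>" using T1[of "n + j"] n(3) A by (simp add: field_simps)
    finally have "rnorm g ?y ?u \<le> \<delta>" .
    with move[OF y, of ?u] near have "x (Suc (n + j)) \<in> fst c"
      and "norm (snd c (x (Suc (n + j))) - snd c ?y) \<le> L * rnorm g ?y ?u"
      by (auto simp: step \<rho>_def)
    note this(1)
    moreover have "norm (snd c (x (Suc (n + j))) - snd c ?y) \<le> L * (s (n + j) * A)"
      using \<open>norm _ \<le> L * rnorm g ?y ?u\<close> mult_left_mono[OF u, of L] L by linarith
    then have "dist (snd c (x (Suc (n + j)))) (snd c (x n)) \<le> L * (s (n + j) * A) + L * A * (\<Sum>t\<in>{n..<n + j}. s t)"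
      using Suc dist_triangle[of "snd c (x (Suc (n + j)))" "snd c (x n)" "snd c ?y"]
      unfolding dist_norm[of "snd c (x (Suc (n + j)))" "snd c ?y"] by linarith
    moreover have "\<epsilon> * s (n + j) \<le> s (n + j) * h ?y"
      using high[OF y near] s(1)[of "n + j"] by (simp add: mult.commute)
    ultimately show ?case using Suc by (simp add: algebra_simps)
  qed
  \<comment> \<open>The iteration is trapped where h exceeds \<epsilon>, so the steps themselves
    have bounded partial sums, contrary to their divergence.\<close>
  have "summable (\<lambda>j. s (n + j))"
  proof (rule summableI_nonneg_bounded)
    fix j
    have "(\<Sum>i<j. s (n + i)) = (\<Sum>t\<in>{n..<n + j}. s t)"
      by (simp add: sum.shift_bounds_nat_ivl[of s 0 n j, simplified] atLeast0LessThan add.commute)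
    also have "\<dots> \<le> (\<Sum>t\<in>{n..<n + j}. s t * h (x t)) / \<epsilon>"
      using stay[of j] \<epsilon> by (simp add: field_simps)
    also have "\<dots> \<le> (\<epsilon> * \<rho> / (2 * L * A)) / \<epsilon>"
      using T2[OF n(4), of "n + j"] \<epsilon> by (intro divide_right_mono) auto
    finally show "(\<Sum>i<j. s (n + i)) \<le> (\<epsilon> * \<rho> / (2 * L * A)) / \<epsilon>" .
  qed (use s(1) less_imp_le in auto)
  then have "summable s" by (subst summable_iff_shift[of s n, symmetric]) (simp add: add.commute)
  with s(3) show False by blast
qed

end

section \<open>Almost sure summability of martingale differences\<close>

definition bounded_fun_on :: "'a set \<Rightarrow> ('a \<Rightarrow> real) \<Rightarrow> bool" where
  "bounded_fun_on S f \<longleftrightarrow> (\<exists>B. \<forall>q\<in>S. \<bar>f q\<bar> \<le> B)"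

lemma bounded_fun_onI: "(\<And>q. q \<in> S \<Longrightarrow> \<bar>f q\<bar> \<le> B) \<Longrightarrow> bounded_fun_on S f"
  by (auto simp: bounded_fun_on_def)

lemma bounded_fun_on_const: "bounded_fun_on S (\<lambda>q. k)"
  by (rule bounded_fun_onI[of _ _ "\<bar>k\<bar>"]) simp

lemma bounded_fun_on_add:
  assumes "bounded_fun_on S f" "bounded_fun_on S h"
  shows "bounded_fun_on S (\<lambda>q. f q + h q)"
proof -
  from assms obtain B B' where "\<forall>q\<in>S. \<bar>f q\<bar> \<le> B" "\<forall>q\<in>S. \<bar>h q\<bar> \<le> B'"
    by (auto simp: bounded_fun_on_def)
  then show ?thesis by (intro bounded_fun_onI[of _ _ "B + B'"]) (auto intro: order_trans[OF abs_triangle_ineq] add_mono)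
qed

lemma bounded_fun_on_mult:
  assumes "bounded_fun_on S f" "bounded_fun_on S h"
  shows "bounded_fun_on S (\<lambda>q. f q * h q)"
proof -
  from assms obtain B B' where "\<forall>q\<in>S. \<bar>f q\<bar> \<le> B" "\<forall>q\<in>S. \<bar>h q\<bar> \<le> B'"
    by (auto simp: bounded_fun_on_def)
  then have "\<bar>f q * h q\<bar> \<le> B * B'" if "q \<in> S" for q
    using that abs_ge_zero[of "f q"] unfolding abs_mult by (intro mult_mono) (auto intro: order_trans)
  then show ?thesis by (rule bounded_fun_onI)
qed

lemma bounded_fun_on_sum:
  "(\<And>i. i \<in> I \<Longrightarrow> bounded_fun_on S (f i)) \<Longrightarrow> bounded_fun_on S (\<lambda>q. \<Sum>i\<in>I. f i q)"
  by (induction I rule: infinite_finite_induct) (auto intro: bounded_fun_on_const bounded_fun_on_add)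

lemma (in prob_space) integrable_bounded_fun:
  assumes "f \<in> borel_measurable M" "bounded_fun_on (space M) f"
  shows "integrable M f"
proof -
  from assms(2) obtain B where "\<And>q. q \<in> space M \<Longrightarrow> \<bar>f q\<bar> \<le> B" by (auto simp: bounded_fun_on_def)
  then show ?thesis by (intro integrable_const_bound[of f B]) (simp_all add: assms(1))
qed

text \<open>Vanishing conditional expectation of \<open>\<xi> t\<close> given \<open>\<F> t\<close>
  is stated as orthogonality to all bounded \<open>\<F> t\<close>-measurable functions, the form in
  which it is verified and applied.\<close>

locale martingale_differences = prob_space M for M :: "'a measure" +
  fixes \<F> :: "nat \<Rightarrow> 'a measure" and \<xi> :: "nat \<Rightarrow> 'a \<Rightarrow> real"
  assumes space_\<F>: "space (\<F> t) = space M"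
    and sets_\<F>: "sets (\<F> t) \<subseteq> sets M"
    and sets_\<F>_Suc: "sets (\<F> t) \<subseteq> sets (\<F> (Suc t))"
    and \<xi>_measurable: "\<xi> t \<in> borel_measurable (\<F> (Suc t))"
    and \<xi>_bounded: "bounded_fun_on (space M) (\<xi> t)"
    and orthogonal: "Y \<in> borel_measurable (\<F> t) \<Longrightarrow> bounded_fun_on (space M) Y \<Longrightarrow>
      expectation (\<lambda>q. Y q * \<xi> t q) = 0"
begin

lemma measurable_\<F>_M: "f \<in> measurable (\<F> t) N \<Longrightarrow> f \<in> measurable M N"
  using measurable_mono[of N N "\<F> t" M] sets_\<F> space_\<F> by auto

lemma measurable_\<F>_mono:
  assumes "t \<le> u" "f \<in> measurable (\<F> t) N"
  shows "f \<in> measurable (\<F> u) N"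
proof -
  have "sets (\<F> t) \<subseteq> sets (\<F> u)" using assms(1) sets_\<F>_Suc by (rule lift_Suc_mono_le[rotated])
  with assms(2) show ?thesis using measurable_mono[of N N "\<F> t" "\<F> u"] space_\<F> by auto
qed

lemma \<xi>_measurable_le: "t < u \<Longrightarrow> \<xi> t \<in> borel_measurable (\<F> u)"
  using \<xi>_measurable by (rule measurable_\<F>_mono[rotated]) simp

lemma \<xi>_measurable_M [measurable]: "\<xi> t \<in> borel_measurable M"
  using \<xi>_measurable by (rule measurable_\<F>_M)

text \<open>In the expansion of the square, \<open>\<xi> n\<close> is multiplied in the cross term
  by an earlier partial sum and by \<open>c n\<close>, both known at time n; orthogonality removes
  it.\<close>

lemma expectation_transform_sq:
  assumes c: "\<And>t. c t \<in> borel_measurable (\<F> t)" "\<And>t. bounded_fun_on (space M) (c t)"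
  shows "expectation (\<lambda>q. (\<Sum>t<n. c t q * \<xi> t q)\<^sup>2) = (\<Sum>t<n. expectation (\<lambda>q. (c t q * \<xi> t q)\<^sup>2))"
proof (induction n)
  case (Suc n)
  define T where "T q = (\<Sum>t<n. c t q * \<xi> t q)" for q
  have T: "T \<in> borel_measurable (\<F> n)"
    unfolding T_def
    by (intro borel_measurable_sum borel_measurable_times \<xi>_measurable_le measurable_\<F>_mono[OF _ c(1)]) auto
  have bT: "bounded_fun_on (space M) T"
    unfolding T_def by (intro bounded_fun_on_sum bounded_fun_on_mult c \<xi>_bounded)
  have [measurable]: "T \<in> borel_measurable M" "c n \<in> borel_measurable M"
    using T c(1) by (auto intro: measurable_\<F>_M)
  have int: "integrable M (\<lambda>q. (T q)\<^sup>2)" "integrable M (\<lambda>q. 2 * (T q * c n q * \<xi> n q))"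
    "integrable M (\<lambda>q. (c n q * \<xi> n q)\<^sup>2)"
    unfolding power2_eq_square
    by (intro integrable_bounded_fun bounded_fun_on_mult bounded_fun_on_const bT c \<xi>_bounded; measurable)+
  have "expectation (\<lambda>q. T q * c n q * \<xi> n q) = 0"
    by (intro orthogonal borel_measurable_times bounded_fun_on_mult T bT c)
  then have zero: "expectation (\<lambda>q. 2 * (T q * c n q * \<xi> n q)) = 0" by simp
  have "expectation (\<lambda>q. (\<Sum>t<Suc n. c t q * \<xi> t q)\<^sup>2)
      = expectation (\<lambda>q. (T q)\<^sup>2 + (c n q * \<xi> n q)\<^sup>2 + 2 * (T q * c n q * \<xi> n q))"
    by (rule Bochner_Integration.integral_cong) (simp_all add: T_def power2_sum mult_ac)
  also have "\<dots> = expectation (\<lambda>q. (T q)\<^sup>2) + expectation (\<lambda>q. (c n q * \<xi> n q)\<^sup>2)"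
    using int zero by simp
  finally show ?case using Suc by (simp add: T_def)
qed simp

text \<open>Kolmogorov's argument: switching the differences off once the threshold is reached keeps them orthogonal.\<close>

lemma maximal_inequality:
  fixes S :: "nat \<Rightarrow> 'a \<Rightarrow> real"
  defines "S \<equiv> \<lambda>k q. \<Sum>t<k. \<xi> t q"
  assumes l: "l > 0"
  shows "prob {q \<in> space M. \<exists>k\<in>{n..N}. l \<le> \<bar>S k q - S n q\<bar>} \<le> (\<Sum>t\<in>{n..<N}. expectation (\<lambda>q. (\<xi> t q)\<^sup>2)) / l\<^sup>2"
proof -
  \<comment> \<open>\<open>c t\<close> inspects the sums S k for k up to t, which involve
    \<open>\<xi>\<close> before t, so it is known at time t. If the threshold is first reached at
    \<tau>, the switch is on exactly for n \<le> t < \<tau>, and \<open>T\<close> freezes at the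
    value S \<tau> - S n.\<close>
  define c where "c t q = (if n \<le> t \<and> (\<forall>k\<in>{n..t}. \<bar>S k q - S n q\<bar> < l) then 1 else 0 :: real)" for t q
  define T where "T q = (\<Sum>t<N. c t q * \<xi> t q)" for q
  have c_bdd: "bounded_fun_on (space M) (c t)" for t
    by (rule bounded_fun_onI[of _ _ 1]) (simp add: c_def)
  have c_meas: "c t \<in> borel_measurable (\<F> t)" for t
  proof -
    have S: "S k \<in> borel_measurable (\<F> t)" if "k \<le> t" for k
      unfolding S_def using that by (intro borel_measurable_sum \<xi>_measurable_le) auto
    have "{q \<in> space (\<F> t). n \<le> t \<and> (\<forall>k\<in>{n..t}. \<bar>S k q - S n q\<bar> < l)} \<in> sets (\<F> t)"
    proof (cases "n \<le> t")
      case True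
      have "{q \<in> space (\<F> t). \<forall>k\<in>{n..t}. \<bar>S k q - S n q\<bar> < l} \<in> sets (\<F> t)"
        by (intro sets.sets_Collect_finite_All borel_measurable_less borel_measurable_abs
            borel_measurable_diff borel_measurable_const S) (use True in auto)
      with True show ?thesis by simp
    qed simp
    then show ?thesis unfolding c_def[abs_def] by (rule measurable_If[rotated 2]) simp_all
  qed
  have [measurable]: "c t \<in> borel_measurable M" for t using c_meas by (rule measurable_\<F>_M)
  have [measurable]: "T \<in> borel_measurable M" unfolding T_def by measurable
  have c1: "(c t q)\<^sup>2 \<le> 1" and c0: "t < n \<Longrightarrow> c t q = 0" for t q by (auto simp: c_def)
  have T_big: "l \<le> \<bar>T q\<bar>" if q: "\<exists>k\<in>{n..N}. l \<le> \<bar>S k q - S n q\<bar>" for q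
  proof -
    define \<tau> where "\<tau> = (LEAST k. n \<le> k \<and> l \<le> \<bar>S k q - S n q\<bar>)"
    from q obtain k where k: "n \<le> k" "k \<le> N" "l \<le> \<bar>S k q - S n q\<bar>" by auto
    have \<tau>: "n \<le> \<tau>" "l \<le> \<bar>S \<tau> q - S n q\<bar>"
      unfolding \<tau>_def using LeastI[of "\<lambda>k. n \<le> k \<and> l \<le> \<bar>S k q - S n q\<bar>" k] k by auto
    have "\<tau> \<le> k" unfolding \<tau>_def using k by (intro Least_le) auto
    then have "\<tau> \<le> N" using k by simp
    have "c t q = (if t \<in> {n..<\<tau>} then 1 else 0)" for t
    proof -
      have "\<bar>S k q - S n q\<bar> < l" if "n \<le> k" "k < \<tau>" for k
        using that not_less_Least[of k "\<lambda>k. n \<le> k \<and> l \<le> \<bar>S k q - S n q\<bar>"] by (auto simp: \<tau>_def)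
      then have "n \<le> t \<Longrightarrow> t < \<tau> \<Longrightarrow> \<forall>k\<in>{n..t}. \<bar>S k q - S n q\<bar> < l" by auto
      moreover have "\<not> (\<forall>k\<in>{n..t}. \<bar>S k q - S n q\<bar> < l)" if "\<tau> \<le> t" using that \<tau> by (auto simp: not_less)
      ultimately show ?thesis by (cases "t < \<tau>") (auto simp: c_def)
    qed
    then have "T q = (\<Sum>t<N. if t \<in> {n..<\<tau>} then \<xi> t q else 0)"
      unfolding T_def by (intro sum.cong) auto
    also have "\<dots> = (\<Sum>t\<in>{n..<\<tau>}. \<xi> t q)"
      using \<open>\<tau> \<le> N\<close> by (subst sum.inter_restrict[symmetric]) (auto intro!: sum.cong)
    also have "\<dots> = S \<tau> q - S n q"
      unfolding S_def using \<tau>(1) by (simp add: sum_diff_nat_ivl[of 0 n \<tau>, symmetric] atLeast0LessThan[symmetric])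
    finally show ?thesis using \<tau>(2) by simp
  qed
  have "prob {q \<in> space M. \<exists>k\<in>{n..N}. l \<le> \<bar>S k q - S n q\<bar>} \<le> prob {q \<in> space M. l\<^sup>2 \<le> (T q)\<^sup>2}"
  proof (rule finite_measure_mono)
    show "{q \<in> space M. \<exists>k\<in>{n..N}. l \<le> \<bar>S k q - S n q\<bar>} \<subseteq> {q \<in> space M. l\<^sup>2 \<le> (T q)\<^sup>2}"
      using T_big l by (auto simp flip: abs_le_square_iff)
  qed simp
  also have "\<dots> \<le> expectation (\<lambda>q. (T q)\<^sup>2) / l\<^sup>2"
  proof (rule integral_Markov_inequality_measure[where A = "space M"])
    have "bounded_fun_on (space M) T"
      unfolding T_def by (intro bounded_fun_on_sum bounded_fun_on_mult c_bdd \<xi>_bounded)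
    then show "integrable M (\<lambda>q. (T q)\<^sup>2)"
      unfolding power2_eq_square by (intro integrable_bounded_fun bounded_fun_on_mult) auto
  qed (use l in auto)
  also have "expectation (\<lambda>q. (T q)\<^sup>2) = (\<Sum>t<N. expectation (\<lambda>q. (c t q * \<xi> t q)\<^sup>2))"
    unfolding T_def by (rule expectation_transform_sq[OF c_meas c_bdd])
  also have "\<dots> \<le> (\<Sum>t<N. if t \<in> {n..<N} then expectation (\<lambda>q. (\<xi> t q)\<^sup>2) else 0)"
  proof (intro sum_mono)
    fix t assume t: "t \<in> {..<N}"
    show "expectation (\<lambda>q. (c t q * \<xi> t q)\<^sup>2) \<le> (if t \<in> {n..<N} then expectation (\<lambda>q. (\<xi> t q)\<^sup>2) else 0)"
    proof (cases "n \<le> t")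
      case True
      have "expectation (\<lambda>q. (c t q * \<xi> t q)\<^sup>2) \<le> expectation (\<lambda>q. (\<xi> t q)\<^sup>2)"
      proof (rule integral_mono)
        show "integrable M (\<lambda>q. (c t q * \<xi> t q)\<^sup>2)" "integrable M (\<lambda>q. (\<xi> t q)\<^sup>2)"
          unfolding power2_eq_square
          by (intro integrable_bounded_fun bounded_fun_on_mult c_bdd \<xi>_bounded; measurable)+
        show "(c t q * \<xi> t q)\<^sup>2 \<le> (\<xi> t q)\<^sup>2" for q
          using mult_right_mono[OF c1[of t q], of "(\<xi> t q)\<^sup>2"] by (simp add: power_mult_distrib)
      qed
      with True t show ?thesis by simp
    qed (simp add: c0)
  qed
  also have "\<dots> = (\<Sum>t\<in>{n..<N}. expectation (\<lambda>q. (\<xi> t q)\<^sup>2))"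
    by (subst sum.inter_restrict[symmetric]) (auto intro!: sum.cong)
  finally show ?thesis using l by (simp add: divide_right_mono)
qed

text \<open>Letting N tend to infinity in the maximal inequality, the probability that the sums ever
  move by l after time n is at most the variance tail from n divided by l squared, which tends to 0.
  Hence the partial sums are almost surely Cauchy.\<close>

lemma AE_summable:
  assumes B: "\<And>n. (\<Sum>t<n. expectation (\<lambda>q. (\<xi> t q)\<^sup>2)) \<le> B"
  shows "AE q in M. summable (\<lambda>t. \<xi> t q)"
proof -
  define v where "v t = expectation (\<lambda>q. (\<xi> t q)\<^sup>2)" for t
  define S where "S k q = (\<Sum>t<k. \<xi> t q)" for k q
  have [measurable]: "S k \<in> borel_measurable M" for k unfolding S_def by measurable
  have v: "0 \<le> v t" for t by (simp add: v_def)
  then have "summable v" using B unfolding v_def by (intro summableI_nonneg_bounded) auto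
  \<comment> \<open>Thresholds of the form 1/(j+1) form a countable family, so one null set serves
    them all.\<close>
  have "AE q in M. \<exists>n. \<forall>k\<ge>n. \<bar>S k q - S n q\<bar> < 1 / real (Suc j)" for j
  proof -
    define l where "l = 1 / real (Suc j)"
    have l: "l > 0" by (simp add: l_def)
    define E where "E n N = {q \<in> space M. \<exists>k\<in>{n..N}. l \<le> \<bar>S k q - S n q\<bar>}" for n N
    define D where "D n = {q \<in> space M. \<exists>k\<ge>n. l \<le> \<bar>S k q - S n q\<bar>}" for n
    have [measurable]: "E n N \<in> events" "D n \<in> events" for n N unfolding E_def D_def by measurable
    have D_le: "prob (D n) \<le> (\<Sum>t. v (t + n)) / l\<^sup>2" for n
    proof (rule LIMSEQ_le_const2)
      have "D n = (\<Union>N. E n N)" unfolding D_def E_def by (auto intro!: bexI)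
      moreover have "incseq (E n)" unfolding E_def incseq_def by fastforce
      ultimately show "(\<lambda>N. prob (E n N)) \<longlonglongrightarrow> prob (D n)"
        using finite_Lim_measure_incseq[of "E n"] by (simp add: image_subset_iff)
      have "prob (E n N) \<le> (\<Sum>t. v (t + n)) / l\<^sup>2" for N
      proof -
        have "prob (E n N) \<le> (\<Sum>t\<in>{n..<N}. v t) / l\<^sup>2"
          using maximal_inequality[OF l, of n N] by (simp add: E_def S_def v_def)
        also have "(\<Sum>t\<in>{n..<N}. v t) = (\<Sum>t<N - n. v (t + n))"
          by (simp add: sum.atLeastLessThan_shift_0[of v n N] atLeast0LessThan add.commute)
        also have "\<dots> \<le> (\<Sum>t. v (t + n))"
          using v \<open>summable v\<close> by (intro sum_le_suminf) (auto simp: summable_iff_shift)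
        finally show ?thesis using l by (simp add: divide_right_mono)
      qed
      then show "\<exists>N0. \<forall>N\<ge>N0. prob (E n N) \<le> (\<Sum>t. v (t + n)) / l\<^sup>2" by blast
    qed
    have "(\<lambda>n. (\<Sum>t. v (t + n)) / l\<^sup>2) \<longlonglongrightarrow> 0 / l\<^sup>2"
      using suminf_exist_split2[OF \<open>summable v\<close>] l by (intro tendsto_divide tendsto_const) auto
    moreover have "prob (\<Inter>n. D n) \<le> (\<Sum>t. v (t + n)) / l\<^sup>2" for n
      by (rule order_trans[OF finite_measure_mono D_le]) auto
    ultimately have "prob (\<Inter>n. D n) \<le> 0"
      by (intro LIMSEQ_le_const[where X = "\<lambda>n. (\<Sum>t. v (t + n)) / l\<^sup>2"]) auto
    then have "prob (\<Inter>n. D n) = 0" using measure_nonneg[of M] by (simp add: antisym)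
    then have "AE q in M. q \<notin> (\<Inter>n. D n)"
      by (intro AE_not_in) (auto simp: null_sets_def emeasure_eq_measure)
    moreover have "AE q in M. q \<in> space M" by (rule AE_space)
    ultimately show ?thesis
      by eventually_elim (simp add: D_def l_def not_le, meson leD)
  qed
  then have "AE q in M. \<forall>j. \<exists>n. \<forall>k\<ge>n. \<bar>S k q - S n q\<bar> < 1 / real (Suc j)"
    by (simp add: AE_all_countable)
  then show ?thesis
  proof eventually_elim
    case (elim q)
    have "Cauchy (\<lambda>k. S k q)"
    proof (rule metric_CauchyI)
      fix e :: real assume "e > 0"
      then obtain j where j: "1 / real (Suc j) < e / 2"
        using nat_approx_posE[of "e / 2"] by auto
      from elim obtain n where n: "\<And>k. k \<ge> n \<Longrightarrow> \<bar>S k q - S n q\<bar> < 1 / real (Suc j)" by blast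
      have "dist (S k q) (S k' q) < e" if "k \<ge> n" "k' \<ge> n" for k k'
        using n[OF that(1)] n[OF that(2)] j by (simp add: dist_real_def)
      then show "\<exists>n. \<forall>k\<ge>n. \<forall>k'\<ge>n. dist (S k q) (S k' q) < e" by blast
    qed
    then show ?case
      by (simp add: S_def summable_iff_convergent Cauchy_convergent_iff)
  qed
qed

end

section \<open>The filtration of an independent sequence\<close>

context prob_space
begin

text \<open>The \<sigma>-algebra generated by \<open>X 0\<close>, ..., \<open>X (t - 1)\<close>,
  trivial for t = 0. Presenting it as the preimage of a product \<sigma>-algebra makes each past
  event an event about one finite history, to which independence of index blocks applies.\<close>

definition past :: "(nat \<Rightarrow> 'b measure) \<Rightarrow> (nat \<Rightarrow> 'a \<Rightarrow> 'b) \<Rightarrow> nat \<Rightarrow> 'a measure" where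
  "past N X t = vimage_algebra (space M) (\<lambda>q. \<lambda>i\<in>{..<t}. X i q) (PiM {..<t} N)"

lemma space_past: "space (past N X t) = space M"
  by (simp add: past_def)

context
  fixes N :: "nat \<Rightarrow> 'b measure" and X :: "nat \<Rightarrow> 'a \<Rightarrow> 'b"
  assumes indep: "indep_vars N X UNIV"
begin

lemma random_variable_X: "random_variable (N t) (X t)"
  using indep by (simp add: indep_vars_def)

lemma X_space: "q \<in> space M \<Longrightarrow> X t q \<in> space (N t)"
  using random_variable_X by (rule measurable_space)

lemma restrict_X_space: "(\<lambda>q. \<lambda>i\<in>{..<t}. X i q) \<in> space M \<rightarrow> space (PiM {..<t} N)"
  using X_space by (simp add: space_PiM restrict_PiE_iff)

lemma measurable_X_past:
  assumes "t < u"
  shows "X t \<in> measurable (past N X u) (N t)"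
proof -
  have "(\<lambda>q. \<lambda>i\<in>{..<u}. X i q) \<in> measurable (past N X u) (PiM {..<u} N)"
    unfolding past_def by (rule measurable_vimage_algebra1[OF restrict_X_space])
  then have "(\<lambda>q. (\<lambda>i\<in>{..<u}. X i q) t) \<in> measurable (past N X u) (N t)"
    by (rule measurable_compose) (use assms in \<open>auto intro!: measurable_component_singleton\<close>)
  then show ?thesis using assms by simp
qed

lemma sets_past_mono: "t \<le> u \<Longrightarrow> sets (past N X t) \<subseteq> sets (past N X u)"
  unfolding past_def[of N X t]
  by (rule sets_image_in_sets)
    (auto simp: space_past intro!: measurable_restrict measurable_X_past)

lemma sets_past: "sets (past N X t) \<subseteq> events"
  unfolding past_def
  by (rule sets_image_in_sets) (auto intro!: measurable_restrict random_variable_X)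

lemma measurable_past_mono: "t \<le> u \<Longrightarrow> f \<in> measurable (past N X t) L \<Longrightarrow> f \<in> measurable (past N X u) L"
  using measurable_mono[of L L "past N X t" "past N X u"] sets_past_mono by (auto simp: space_past)

lemma measurable_past_M: "f \<in> measurable (past N X t) L \<Longrightarrow> f \<in> measurable M L"
  using measurable_mono[of L L "past N X t" M] sets_past by (auto simp: space_past)

lemma random_variable_past: "random_variable (past N X t) (\<lambda>q. q)"
  by (rule measurable_past_M[where t = t]) (rule measurable_ident_sets[OF refl])

text \<open>Independence of the past and \<open>X t\<close> in the form needed for Fubini: the
  identity of M, seen as a random variable into the past, and \<open>X t\<close> have a product law.
  This is checked on rectangles.\<close>

lemma distr_past:
  "distr M (past N X t) (\<lambda>q. q) \<Otimes>\<^sub>M distr M (N t) (X t) = distr M (past N X t \<Otimes>\<^sub>M N t) (\<lambda>q. (q, X t q))"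
proof -
  let ?P = "distr M (past N X t) (\<lambda>q. q)" and ?Q = "distr M (N t) (X t)"
  \<comment> \<open>\<open>?W\<close> is the history and \<open>?V\<close> the present observation
    as a one-element family; both are restrictions to disjoint index blocks.\<close>
  let ?W = "\<lambda>q. \<lambda>i\<in>{..<t}. X i q" and ?V = "\<lambda>q. \<lambda>i\<in>{t}. X i q"
  note rv = random_variable_past[of t] random_variable_X[of t]
  interpret P: prob_space ?P by (rule prob_space_distr[OF rv(1)])
  interpret Q: prob_space ?Q by (rule prob_space_distr[OF rv(2)])
  show ?thesis
  proof (rule pair_measure_eqI)
    fix A B assume A: "A \<in> sets ?P" and B: "B \<in> sets ?Q"
    from sets_vimage_algebra2[OF restrict_X_space[of t]] A obtain A' where A': "A' \<in> sets (PiM {..<t} N)" "A = ?W -` A' \<inter> space M"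
      by (auto simp: past_def)
    define B' where "B' = {v \<in> space (PiM {t} N). v t \<in> B}"
    have B': "B' \<in> sets (PiM {t} N)"
      unfolding B'_def using B by (intro measurable_sets_Collect[OF measurable_component_singleton]) auto
    have VB: "?V -` B' \<inter> space M = X t -` B \<inter> space M"
      using X_space by (auto simp: B'_def space_PiM)
    have "indep_var (PiM {..<t} N) ?W (PiM {t} N) ?V"
      by (intro indep_var_restrict[OF indep]) auto
    from indep_varD[OF this A'(1) B']
    have "prob (A \<inter> (X t -` B \<inter> space M)) = prob A * prob (X t -` B \<inter> space M)"
      unfolding A'(2) VB[symmetric] by (simp add: vimage_def Int_def conj_ac)
    moreover have "A \<in> events" using A rv(1) sets_past by auto
    moreover have "(\<lambda>q. (q, X t q)) -` (A \<times> B) \<inter> space M = A \<inter> (X t -` B \<inter> space M)"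
      using \<open>A \<in> events\<close> sets.sets_into_space by auto
    moreover have "(\<lambda>q. q) -` A \<inter> space M = A" using \<open>A \<in> events\<close> sets.sets_into_space by auto
    ultimately show "emeasure ?P A * emeasure ?Q B =
        emeasure (distr M (past N X t \<Otimes>\<^sub>M N t) (\<lambda>q. (q, X t q))) (A \<times> B)"
      using A B rv by (simp add: emeasure_distr emeasure_eq_measure ennreal_mult measurable_Pair)
  qed (auto simp: P.sigma_finite_measure_axioms Q.sigma_finite_measure_axioms cong: sets_pair_measure_cong)
qed

text \<open>The freezing rule: the joint law is a product, so Fubini integrates the new variable
  first, with the past held fixed.\<close>

lemma expectation_past:
  fixes \<phi> :: "'a \<times> 'b \<Rightarrow> real"
  assumes distr: "distr M (N t) (X t) = N t"
    and \<phi>: "\<phi> \<in> borel_measurable (past N X t \<Otimes>\<^sub>M N t)"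
    and bdd: "bounded_fun_on (space M \<times> space (N t)) \<phi>"
  shows "expectation (\<lambda>q. \<phi> (q, X t q)) = expectation (\<lambda>q. \<integral>w. \<phi> (q, w) \<partial>N t)"
proof -
  let ?P = "distr M (past N X t) (\<lambda>q. q)"
  note id = random_variable_past[of t]
  interpret P: prob_space ?P by (rule prob_space_distr[OF id])
  interpret N: prob_space "N t"
    using prob_space_distr[OF random_variable_X[of t]] by (simp add: distr)
  interpret PN: pair_prob_space ?P "N t" ..
  have \<phi>': "\<phi> \<in> borel_measurable (?P \<Otimes>\<^sub>M N t)"
    using \<phi> by (simp cong: measurable_cong_sets)
  have int: "integrable (?P \<Otimes>\<^sub>M N t) \<phi>"
    using \<phi>' bdd by (intro PN.P.integrable_bounded_fun) (auto simp: space_pair_measure space_past)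
  have "expectation (\<lambda>q. \<phi> (q, X t q)) = integral\<^sup>L (distr M (past N X t \<Otimes>\<^sub>M N t) (\<lambda>q. (q, X t q))) \<phi>"
    by (rule integral_distr[symmetric, OF measurable_Pair[OF id random_variable_X] \<phi>])
  also have "\<dots> = integral\<^sup>L (?P \<Otimes>\<^sub>M N t) \<phi>" using distr_past[of t] by (simp add: distr)
  also have "\<dots> = (\<integral>q. (\<integral>w. \<phi> (q, w) \<partial>N t) \<partial>?P)"
    by (rule PN.integral_fst'[symmetric, OF int])
  also have "\<dots> = expectation (\<lambda>q. \<integral>w. \<phi> (q, w) \<partial>N t)"
    by (rule integral_distr[OF id]) (use \<phi> in measurable)
  finally show ?thesis .
qed

text \<open>For orthogonality, a test function Y of the past is constant in the inner integral of
  the freezing rule and can be pulled out; what is left is the centred integral, which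
  vanishes.\<close>

lemma martingale_differences_past:
  fixes \<phi> :: "nat \<Rightarrow> 'a \<times> 'b \<Rightarrow> real"
  assumes distr: "\<And>t. distr M (N t) (X t) = N t"
    and \<phi>: "\<And>t. \<phi> t \<in> borel_measurable (past N X t \<Otimes>\<^sub>M N t)"
    and bdd: "\<And>t. bounded_fun_on (space M \<times> space (N t)) (\<phi> t)"
    and centred: "\<And>t q. q \<in> space M \<Longrightarrow> (\<integral>w. \<phi> t (q, w) \<partial>N t) = 0"
  shows "martingale_differences M (past N X) (\<lambda>t q. \<phi> t (q, X t q))"
proof
  fix t
  show "space (past N X t) = space M" by (rule space_past)
  show "sets (past N X t) \<subseteq> events" by (rule sets_past)
  show "sets (past N X t) \<subseteq> sets (past N X (Suc t))" by (rule sets_past_mono) simp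
  show "(\<lambda>q. \<phi> t (q, X t q)) \<in> borel_measurable (past N X (Suc t))"
    by (rule measurable_compose[OF measurable_Pair \<phi>])
      (auto intro!: measurable_past_mono[of t "Suc t"] measurable_X_past simp: measurable_ident_sets)
  show "bounded_fun_on (space M) (\<lambda>q. \<phi> t (q, X t q))"
    using bdd[of t] X_space unfolding bounded_fun_on_def by blast
  fix Y assume Y: "Y \<in> borel_measurable (past N X t)" "bounded_fun_on (space M) Y"
  have "expectation (\<lambda>q. Y q * \<phi> t (q, X t q)) = expectation (\<lambda>q. (\<lambda>(q, w). Y q * \<phi> t (q, w)) (q, X t q))"
    by simp
  also have "\<dots> = expectation (\<lambda>q. \<integral>w. (\<lambda>(q, w). Y q * \<phi> t (q, w)) (q, w) \<partial>N t)"
  proof (rule expectation_past[OF distr])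
    show "(\<lambda>(q, w). Y q * \<phi> t (q, w)) \<in> borel_measurable (past N X t \<Otimes>\<^sub>M N t)"
      using Y \<phi> by measurable
    have "bounded_fun_on (space M \<times> space (N t)) (\<lambda>z. Y (fst z) * \<phi> t z)"
      using Y(2) bdd by (intro bounded_fun_on_mult) (auto simp: bounded_fun_on_def)
    then show "bounded_fun_on (space M \<times> space (N t)) (\<lambda>(q, w). Y q * \<phi> t (q, w))"
      by (auto simp: bounded_fun_on_def)
  qed
  also have "\<dots> = expectation (\<lambda>q. 0)"
    by (rule Bochner_Integration.integral_cong) (simp_all add: centred)
  finally show "expectation (\<lambda>q. Y q * \<phi> t (q, X t q)) = 0" by simp
qed

end

end

section \<open>Stratified mini-batches\<close>

lemma scale_measure_eq_density: "scale_measure r M = density M (\<lambda>_. r)"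
  by (rule measure_eqI) (simp_all add: emeasure_density_const)

lemma sets_conditional_measure: "sets (conditional_measure P A) = sets (restrict_space P A)"
  by (simp add: conditional_measure_def)

lemma space_conditional_measure: "space (conditional_measure P A) = A \<inter> space P"
  by (simp add: conditional_measure_def space_scale_measure space_restrict_space)

lemma measurable_from_conditional: "f \<in> measurable P N \<Longrightarrow> f \<in> measurable (conditional_measure P A) N"
  using measurable_restrict_space1[of f P N A] measurable_cong_sets[OF sets_conditional_measure refl]
  by blast

context prob_space
begin

context
  fixes A assumes A: "A \<in> events" "prob A > 0"
begin

lemma conditional_measure_eq_density:
  "conditional_measure M A = density (restrict_space M A) (\<lambda>_. ennreal (1 / prob A))"
  using A(2) by (simp add: conditional_measure_def scale_measure_eq_density emeasure_eq_measure
      inverse_ennreal inverse_eq_divide)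

lemma prob_space_conditional: "prob_space (conditional_measure M A)"
proof
  have "emeasure (restrict_space M A) (A \<inter> space M) = ennreal (prob A)"
    using A by (simp add: emeasure_restrict_space emeasure_eq_measure Int_absorb2 sets.sets_into_space)
  moreover have "inverse (ennreal (prob A)) * ennreal (prob A) = 1"
    using A(2) by (simp add: inverse_ennreal ennreal_mult[symmetric])
  ultimately show "emeasure (conditional_measure M A) (space (conditional_measure M A)) = 1"
    using A by (simp add: conditional_measure_def space_scale_measure space_restrict_space emeasure_eq_measure)
qed

text \<open>The right-hand side is an integral over all of M cut off by an indicator, so that the
  contributions of the strata can later be added under one integral.\<close>

lemma conditional_integral:
  fixes f :: "'a \<Rightarrow> 'b::{banach, second_countable_topology}"
  assumes f: "integrable M f"
  shows "integrable (conditional_measure M A) f"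
    and "integral\<^sup>L (conditional_measure M A) f = (1 / prob A) *\<^sub>R (\<integral>w. indicator A w *\<^sub>R f w \<partial>M)"
proof -
  have meas: "f \<in> borel_measurable (restrict_space M A)"
    using f by (intro measurable_restrict_space1) auto
  have "A \<inter> space M \<in> events" using A by auto
  note this[simp]
  have "integrable M (\<lambda>w. indicator A w *\<^sub>R f w)"
    using A(1) f by (rule integrable_mult_indicator)
  then have int: "integrable (restrict_space M A) f"
    by (subst integrable_restrict_space) auto
  show "integrable (conditional_measure M A) f"
    unfolding conditional_measure_eq_density using meas int A(2)
    by (subst integrable_density) auto
  show "integral\<^sup>L (conditional_measure M A) f = (1 / prob A) *\<^sub>R (\<integral>w. indicator A w *\<^sub>R f w \<partial>M)"
    unfolding conditional_measure_eq_density using meas A(2)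
    by (subst integral_density) (auto simp: integral_restrict_space)
qed

end

end

locale stratification = prob_space P for P :: "'w measure" +
  fixes m :: nat and \<Omega> :: "nat \<Rightarrow> 'w set" and b :: "nat \<Rightarrow> nat"
  assumes stratum: "j \<in> {1..m} \<Longrightarrow> \<Omega> j \<in> events" "j \<in> {1..m} \<Longrightarrow> prob (\<Omega> j) > 0"
    and disjoint: "disjoint_family_on \<Omega> {1..m}"
    and cover: "(\<Union>j\<in>{1..m}. \<Omega> j) = space P"
    and b_pos: "j \<in> {1..m} \<Longrightarrow> b j > 0"
begin

abbreviation "batch \<equiv> batch_measure P m \<Omega> b"

lemma prob_space_conditional_stratum: "j \<in> {1..m} \<Longrightarrow> prob_space (conditional_measure P (\<Omega> j))"
  by (intro prob_space_conditional stratum)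

lemma prob_space_batch: "prob_space batch"
  unfolding batch_measure_def
  by (intro prob_space_PiM prob_space_conditional_stratum)

text \<open>A sample is reached by two nested coordinate projections, each of which maps a product
  of probability measures to the corresponding factor.\<close>

lemma batch_component:
  assumes "j \<in> {1..m}" "k \<in> {1..b j}"
  shows measurable_batch_component_conditional:
      "(\<lambda>w. w j k) \<in> measurable batch (conditional_measure P (\<Omega> j))"
    and distr_batch_component:
      "distr batch (conditional_measure P (\<Omega> j)) (\<lambda>w. w j k) = conditional_measure P (\<Omega> j)"
proof -
  let ?I = "\<lambda>j. \<Pi>\<^sub>M k\<in>{1..b j}. conditional_measure P (\<Omega> j)"
  have m1: "(\<lambda>w. w j) \<in> measurable batch (?I j)"
    unfolding batch_measure_def using assms by (intro measurable_component_singleton) auto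
  have m2: "(\<lambda>w. w k) \<in> measurable (?I j) (conditional_measure P (\<Omega> j))"
    using assms by (intro measurable_component_singleton) auto
  from measurable_compose[OF m1 m2]
  show "(\<lambda>w. w j k) \<in> measurable batch (conditional_measure P (\<Omega> j))" .
  have "distr batch (?I j) (\<lambda>w. w j) = ?I j"
    unfolding batch_measure_def using assms
    by (intro distr_PiM_component prob_space_PiM prob_space_conditional_stratum) auto
  moreover have "distr (?I j) (conditional_measure P (\<Omega> j)) (\<lambda>w. w k) = conditional_measure P (\<Omega> j)"
    using assms by (intro distr_PiM_component prob_space_conditional_stratum) auto
  ultimately show "distr batch (conditional_measure P (\<Omega> j)) (\<lambda>w. w j k) = conditional_measure P (\<Omega> j)"
    using distr_distr[OF m2 m1] by (simp add: o_def)
qed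

lemma measurable_batch_component:
  assumes "j \<in> {1..m}" "k \<in> {1..b j}"
  shows "(\<lambda>w. w j k) \<in> measurable batch P"
  by (rule measurable_compose[OF measurable_batch_component_conditional[OF assms]])
    (intro measurable_from_conditional measurable_ident_sets refl)

lemma batch_component_space:
  "w \<in> space batch \<Longrightarrow> j \<in> {1..m} \<Longrightarrow> k \<in> {1..b j} \<Longrightarrow> w j k \<in> space P"
  by (rule measurable_space[OF measurable_batch_component])

lemma sum_indicator_strata:
  assumes "w \<in> space P"
  shows "(\<Sum>j\<in>{1..m}. indicator (\<Omega> j) w) = (1 :: real)"
proof -
  obtain i where i: "i \<in> {1..m}" "w \<in> \<Omega> i" using assms cover by blast
  have "indicator (\<Omega> j) w = (if j = i then 1 else 0 :: real)" if "j \<in> {1..m}" for j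
    using disjoint_family_onD[OF disjoint that i(1)] i(2) by (auto simp: indicator_def)
  then have "(\<Sum>j\<in>{1..m}. indicator (\<Omega> j) w) = (\<Sum>j\<in>{1..m}. if j = i then 1 else 0 :: real)"
    by (rule sum.cong[OF refl])
  then show ?thesis using i(1) by simp
qed

lemma sum_strata: "(\<Sum>j\<in>{1..m}. prob (\<Omega> j)) = 1"
proof -
  have "prob (\<Union>j\<in>{1..m}. \<Omega> j) = (\<Sum>j\<in>{1..m}. prob (\<Omega> j))"
    using stratum disjoint by (intro finite_measure_finite_Union) auto
  then show ?thesis unfolding cover prob_space by simp
qed

lemma integral_batch_component:
  fixes f :: "'w \<Rightarrow> real"
  assumes f: "integrable P f" and jk: "j \<in> {1..m}" "k \<in> {1..b j}"
  shows "integrable batch (\<lambda>w. f (w j k))"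
    and "(\<integral>w. f (w j k) \<partial>batch) = (1 / prob (\<Omega> j)) * (\<integral>w. indicator (\<Omega> j) w * f w \<partial>P)"
proof -
  let ?C = "conditional_measure P (\<Omega> j)"
  note m = measurable_batch_component_conditional[OF jk]
  note c = conditional_integral[OF stratum[OF jk(1)] f]
  have meas: "f \<in> borel_measurable ?C" using c(1) by auto
  show "integrable batch (\<lambda>w. f (w j k))"
    using c(1) integrable_distr_eq[OF m meas] by (simp add: distr_batch_component[OF jk])
  have "(\<integral>w. f (w j k) \<partial>batch) = integral\<^sup>L ?C f"
    using integral_distr[OF m meas] by (simp add: distr_batch_component[OF jk])
  then show "(\<integral>w. f (w j k) \<partial>batch) = (1 / prob (\<Omega> j)) * (\<integral>w. indicator (\<Omega> j) w * f w \<partial>P)"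
    by (simp add: c(2))
qed

text \<open>Each stratum enters with its exact mass, which makes the batch average unbiased.\<close>

lemma has_integral_batch_average:
  fixes f :: "'w \<Rightarrow> real"
  assumes f: "integrable P f"
  shows "has_bochner_integral batch (\<lambda>w. \<Sum>j\<in>{1..m}. prob (\<Omega> j) / real (b j) * (\<Sum>k\<in>{1..b j}. f (w j k)))
    (integral\<^sup>L P f)"
proof -
  have "has_bochner_integral batch (\<lambda>w. \<Sum>j\<in>{1..m}. prob (\<Omega> j) / real (b j) * (\<Sum>k\<in>{1..b j}. f (w j k)))
    (\<Sum>j\<in>{1..m}. prob (\<Omega> j) / real (b j) * (\<Sum>k\<in>{1..b j}. (1 / prob (\<Omega> j)) * (\<integral>w. indicator (\<Omega> j) w * f w \<partial>P)))"
    by (intro has_bochner_integral_sum has_bochner_integral_mult_right)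
      (auto simp: has_bochner_integral_iff integral_batch_component[OF f])
  also have "(\<Sum>j\<in>{1..m}. prob (\<Omega> j) / real (b j) * (\<Sum>k\<in>{1..b j}. (1 / prob (\<Omega> j)) * (\<integral>w. indicator (\<Omega> j) w * f w \<partial>P)))
      = (\<Sum>j\<in>{1..m}. \<integral>w. indicator (\<Omega> j) w * f w \<partial>P)"
    using stratum(2) b_pos by (intro sum.cong refl) (auto simp: less_imp_neq[symmetric])
  also have "\<dots> = (\<integral>w. (\<Sum>j\<in>{1..m}. indicator (\<Omega> j) w * f w) \<partial>P)"
  proof (rule Bochner_Integration.integral_sum[symmetric])
    fix j assume "j \<in> {1..m}"
    then show "integrable P (\<lambda>w. indicator (\<Omega> j) w * f w)"
      using integrable_mult_indicator[OF stratum(1) f] by simp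
  qed
  also have "\<dots> = integral\<^sup>L P f"
    by (rule Bochner_Integration.integral_cong)
      (simp_all add: sum_distrib_right[symmetric] sum_indicator_strata del: One_nat_def)
  finally show ?thesis .
qed

text \<open>Singletons of a finite product are measurable boxes, and every set of batches is a
  finite union of them. This serves the alternative in which the sample space is finite and H is an
  arbitrary function of the point.\<close>

lemma finite_discrete_batch:
  assumes "finite (space P)" "sets P = Pow (space P)"
  shows "finite (space batch)" "sets batch = Pow (space batch)"
proof -
  have PiM: "finite (space (PiM I N)) \<and> sets (PiM I N) = Pow (space (PiM I N))"
    if I: "finite I" and N: "\<And>i. i \<in> I \<Longrightarrow> finite (space (N i)) \<and> sets (N i) = Pow (space (N i))"
    for I :: "nat set" and N :: "nat \<Rightarrow> 'c measure"
  proof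
    show fin: "finite (space (PiM I N))"
      unfolding space_PiM using I N by (intro finite_PiE) auto
    have "{w} \<in> sets (PiM I N)" if w: "w \<in> space (PiM I N)" for w
    proof -
      have "{w} = (\<Pi>\<^sub>E i\<in>I. {w i})"
        using w by (subst PiE_singleton) (auto simp: space_PiM PiE_def)
      also have "\<dots> \<in> sets (PiM I N)"
        using w N by (intro sets_PiM_I_finite I) (auto simp: space_PiM)
      finally show ?thesis .
    qed
    then have "S \<in> sets (PiM I N)" if "S \<subseteq> space (PiM I N)" for S
      using that finite_subset[OF that fin] sets.countable[of S "PiM I N"] by (auto intro: countable_finite)
    then show "sets (PiM I N) = Pow (space (PiM I N))"
      using sets.space_closed by auto
  qed
  have C: "finite (space (conditional_measure P A)) \<and>
      sets (conditional_measure P A) = Pow (space (conditional_measure P A))" for A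
    using assms by (auto simp: sets_conditional_measure space_conditional_measure sets_restrict_space image_iff)
  have "finite (space batch) \<and> sets batch = Pow (space batch)"
    unfolding batch_measure_def by (intro PiM C finite_atLeastAtMost)
  then show "finite (space batch)" "sets batch = Pow (space batch)" by auto
qed

end

text \<open>Slicing by the finitely many w writes any preimage as a finite union of rectangles. The
  state space may be uncountable, since each slice is an arbitrary set and all of those are
  measurable.\<close>

lemma measurable_count_space_pair:
  assumes D: "finite (space D)" "sets D = Pow (space D)"
    and f: "\<And>s w. w \<in> space D \<Longrightarrow> f (s, w) \<in> space N"
  shows "f \<in> measurable (count_space UNIV \<Otimes>\<^sub>M D) N"
proof (rule measurableI)
  fix S
  have "f -` S \<inter> space (count_space UNIV \<Otimes>\<^sub>M D) = (\<Union>w\<in>space D. {s. f (s, w) \<in> S} \<times> {w})"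
    by (auto simp: space_pair_measure)
  also have "\<dots> \<in> sets (count_space UNIV \<Otimes>\<^sub>M D)"
    using D by (intro sets.finite_UN) auto
  finally show "f -` S \<inter> space (count_space UNIV \<Otimes>\<^sub>M D) \<in> sets (count_space UNIV \<Otimes>\<^sub>M D)" .
qed (use f in \<open>auto simp: space_pair_measure\<close>)

section \<open>Measurability of the stochastic gradient step\<close>

locale stochastic_gradient =
  retracted C \<A> g F R + stratification P m \<Omega> b
  for C :: "'e::{real_inner,banach,heine_borel,second_countable_topology} set"
    and \<A> :: "('m::{t2_space,second_countable_topology}, 'e) chart set"
    and g :: "'m \<Rightarrow> 'e \<Rightarrow> 'e \<Rightarrow> real"
    and F :: "'m \<Rightarrow> real"
    and R :: "'m \<times> 'e \<Rightarrow> 'm"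
    and P :: "'w measure" and m :: nat and \<Omega> :: "nat \<Rightarrow> 'w set" and b :: "nat \<Rightarrow> nat" +
  fixes H :: "'m \<times> 'w \<Rightarrow> 'm \<times> 'e"
  assumes fst_H: "w \<in> space P \<Longrightarrow> fst (H (x, w)) = x"
    and integral_H: "has_bochner_integral P (\<lambda>w. snd (H (x, w))) (gradient \<A> g F x)"
begin

abbreviation "Hb \<equiv> batch_estimator P H m \<Omega> b"

lemma g_Hb:
  "g x v (Hb x w) = (\<Sum>j\<in>{1..m}. prob (\<Omega> j) / real (b j) * (\<Sum>k\<in>{1..b j}. g x v (snd (H (x, w j k)))))"
  unfolding batch_estimator_def
  by (simp add: linear_sum[OF linear_right] linear_scale[OF linear_right])

lemma integral_g_H: "has_bochner_integral P (\<lambda>w. g x v (snd (H (x, w)))) (g x v (gradient \<A> g F x))"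
  using linear_imp_bounded_linear[OF linear_right] integral_H by (rule has_bochner_integral_bounded_linear)

text \<open>Unbiasedness is tested against a fixed tangent vector v, which reduces it to the
  stratified average of a real function.\<close>

lemma integral_g_Hb: "has_bochner_integral batch (\<lambda>w. g x v (Hb x w)) (g x v (gradient \<A> g F x))"
  using has_integral_batch_average[of "\<lambda>w. g x v (snd (H (x, w)))"] integral_g_H[of x v]
  by (simp add: g_Hb has_bochner_integral_iff)

text \<open>The masses of the strata add up to 1, so the batch estimate is a convex combination of
  values of H, each of norm at most A.\<close>

lemma rnorm_Hb_le:
  assumes "\<And>w. w \<in> space P \<Longrightarrow> rnorm g x (snd (H (x, w))) \<le> A" and w: "w \<in> space batch"
  shows "rnorm g x (Hb x w) \<le> A"
proof -
  have "rnorm g x (Hb x w) \<le> (\<Sum>j\<in>{1..m}. prob (\<Omega> j) / real (b j) * (\<Sum>k\<in>{1..b j}. A))"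
    unfolding batch_estimator_def
  proof (intro order_trans[OF rnorm_sum_le] sum_mono)
    fix j assume j: "j \<in> {1..m}"
    have *: "rnorm g x (\<Sum>k\<in>{1..b j}. snd (H (x, w j k))) \<le> (\<Sum>k\<in>{1..b j}. A)"
      using batch_component_space[OF w j] by (intro order_trans[OF rnorm_sum_le] sum_mono assms(1))
    show "rnorm g x ((prob (\<Omega> j) / real (b j)) *\<^sub>R (\<Sum>k\<in>{1..b j}. snd (H (x, w j k))))
        \<le> prob (\<Omega> j) / real (b j) * (\<Sum>k\<in>{1..b j}. A)"
      using mult_left_mono[OF *, of "prob (\<Omega> j) / real (b j)"]
      by (simp add: rnorm_scale del: sum_constant One_nat_def)
  qed
  also have "\<dots> = (\<Sum>j\<in>{1..m}. prob (\<Omega> j) * A)"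
  proof (rule sum.cong[OF refl])
    fix j assume "j \<in> {1..m}"
    from b_pos[OF this] show "prob (\<Omega> j) / real (b j) * (\<Sum>k\<in>{1..b j}. A) = prob (\<Omega> j) * A" by simp
  qed
  also have "\<dots> = A" unfolding sum_distrib_right[symmetric] sum_strata by simp
  finally show ?thesis .
qed

text \<open>Testing the mean of H against the gradient itself bounds |grad F|^2 by A |grad
  F|.\<close>

lemma rnorm_gradient_le:
  assumes "\<And>w. w \<in> space P \<Longrightarrow> rnorm g x (snd (H (x, w))) \<le> A"
  shows "rnorm g x (gradient \<A> g F x) \<le> A"
proof -
  let ?D = "gradient \<A> g F x"
  have "g x ?D ?D = (\<integral>w. g x ?D (snd (H (x, w))) \<partial>P)"
    using integral_g_H[of x ?D] by (simp add: has_bochner_integral_iff)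
  also have "\<dots> \<le> (\<integral>w. rnorm g x ?D * A \<partial>P)"
  proof (rule integral_mono)
    show "integrable P (\<lambda>w. g x ?D (snd (H (x, w))))"
      using integral_g_H[of x ?D] by (simp add: has_bochner_integral_iff)
    fix w assume w: "w \<in> space P"
    have "g x ?D (snd (H (x, w))) \<le> rnorm g x ?D * rnorm g x (snd (H (x, w)))"
      using rnorm_Cauchy_Schwarz by (rule abs_le_D1)
    also have "\<dots> \<le> rnorm g x ?D * A" by (intro mult_left_mono assms w rnorm_nonneg)
    finally show "g x ?D (snd (H (x, w))) \<le> rnorm g x ?D * A" .
  qed simp
  finally have "rnorm g x ?D * rnorm g x ?D \<le> rnorm g x ?D * A"
    by (simp add: rnorm_sq[symmetric] power2_eq_square prob_space)
  moreover obtain w where "w \<in> space P" using not_empty by blast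
  then have "0 \<le> A" using assms[of w] rnorm_nonneg[of x "snd (H (x, w))"] by linarith
  ultimately show ?thesis
    using rnorm_nonneg[of x ?D] by (cases "rnorm g x ?D = 0") (auto simp: mult_le_cancel_left)
qed

text \<open>
  The state of the iteration consists of the accumulated squared norms and the current point. When
  the sample space is finite, nothing is known about \<open>H\<close> as a function of the point, but the
  discrete \<open>\<sigma>\<close>-algebra of states may be used.
\<close>

definition step :: "(real \<Rightarrow> real) \<Rightarrow> (real \<times> 'm) \<times> (nat \<Rightarrow> nat \<Rightarrow> 'w) \<Rightarrow> real \<times> 'm" where
  "step \<sigma> = (\<lambda>((V, x), w). (V + (rnorm g x (Hb x w))\<^sup>2, R (x, - (\<sigma> V *\<^sub>R Hb x w))))"

text \<open>The measurability facts that propagate along the iteration, isolated so that the finite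
  and the measurable alternative can be treated alike afterwards. The step function \<sigma> ranges
  over all Borel functions because it changes with the rule and with t.\<close>

definition state_algebra :: "(real \<times> 'm) measure \<Rightarrow> bool" where
  "state_algebra N \<longleftrightarrow>
    (\<lambda>((V, x), w). g x (gradient \<A> g F x) (Hb x w)) \<in> borel_measurable (N \<Otimes>\<^sub>M batch) \<and>
    (\<forall>\<sigma>\<in>borel_measurable borel. step \<sigma> \<in> measurable (N \<Otimes>\<^sub>M batch) N)"

lemma state_algebra_count_space:
  assumes "finite (space P)" "sets P = Pow (space P)"
  shows "state_algebra (count_space UNIV)"
  unfolding state_algebra_def
  by (intro conjI ballI measurable_count_space_pair finite_discrete_batch assms) simp_all

section \<open>Chartwise measurability for a measurable field\<close>

context
  assumes H_measurable: "H \<in> borel \<Otimes>\<^sub>M P \<rightarrow>\<^sub>M tangent_borel \<A>"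
begin

text \<open>Fixing a chart and an open set of fibre coordinates describes a generator of the tangent
  topology. H preserves base points, so its preimage is the event that x lies in the chart and the
  coordinates lie in W. The default value 0 off the chart contributes the complementary rectangle
  when 0 is in W.\<close>

lemma measurable_coords_H:
  assumes c: "c \<in> \<A>"
  shows "(\<lambda>(x, w). if x \<in> fst c then coords c x (snd (H (x, w))) else 0) \<in> borel_measurable (borel \<Otimes>\<^sub>M P)"
    (is "?f \<in> _")
proof (rule borel_measurableI)
  fix W :: "'e set" assume W: "open W"
  define G where "G = {(x, v). x \<in> fst c \<and> bundle_chart \<A> c (x, v) \<in> UNIV \<times> W}"
  have "openin (tangent_topology \<A>) G"
    unfolding tangent_topology_def G_def
    using c open_Times[OF open_UNIV W] by (intro topology_generated_by_Basis) blast
  then have "G \<in> sets (tangent_borel \<A>)"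
    unfolding tangent_borel_def by (simp add: sets_measure_of)
  from measurable_sets[OF H_measurable this]
  have G: "H -` G \<inter> space (borel \<Otimes>\<^sub>M P) \<in> sets (borel \<Otimes>\<^sub>M P)" .
  have "(- fst c) \<times> space P \<in> sets (borel \<Otimes>\<^sub>M P)"
    using open_domain[OF c] by (intro pair_measureI) auto
  then have D: "(if 0 \<in> W then (- fst c) \<times> space P else {}) \<in> sets (borel \<Otimes>\<^sub>M P)" by simp
  have "z \<in> H -` G \<longleftrightarrow> fst z \<in> fst c \<and> coords c (fst z) (snd (H z)) \<in> W" if "snd z \<in> space P" for z
    using fst_H[OF that, of "fst z"] by (cases "H z") (auto simp: G_def bundle_chart_def coords_def)
  then have "z \<in> ?f -` W \<inter> space (borel \<Otimes>\<^sub>M P) \<longleftrightarrow>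
      z \<in> H -` G \<inter> space (borel \<Otimes>\<^sub>M P) \<union> (if 0 \<in> W then (- fst c) \<times> space P else {})" for z
    by (cases z) (auto simp: space_pair_measure simp del: vimage_Int)
  then have "?f -` W \<inter> space (borel \<Otimes>\<^sub>M P) =
      H -` G \<inter> space (borel \<Otimes>\<^sub>M P) \<union> (if 0 \<in> W then (- fst c) \<times> space P else {})" by blast
  with G D show "?f -` W \<inter> space (borel \<Otimes>\<^sub>M P) \<in> sets (borel \<Otimes>\<^sub>M P)" by auto
qed

lemma measurable_coords_Hb:
  assumes c: "c \<in> \<A>"
  shows "(\<lambda>(x, w). if x \<in> fst c then coords c x (Hb x w) else 0) \<in> borel_measurable (borel \<Otimes>\<^sub>M batch)"
proof -
  define f where "f = (\<lambda>(x, w). if x \<in> fst c then coords c x (snd (H (x, w))) else 0)"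
  have "(\<lambda>z. \<Sum>j\<in>{1..m}. (prob (\<Omega> j) / real (b j)) *\<^sub>R (\<Sum>k\<in>{1..b j}. f (fst z, snd z j k)))
      \<in> borel_measurable (borel \<Otimes>\<^sub>M batch)"
  proof (intro borel_measurable_sum borel_measurable_scaleR borel_measurable_const)
    fix j k assume jk: "j \<in> {1..m}" "k \<in> {1..b j}"
    have "(\<lambda>z. (fst z, snd z j k)) \<in> measurable (borel \<Otimes>\<^sub>M batch) (borel \<Otimes>\<^sub>M P)"
      by (intro measurable_Pair measurable_fst measurable_compose[OF measurable_snd measurable_batch_component] jk)
    then show "(\<lambda>z. f (fst z, snd z j k)) \<in> borel_measurable (borel \<Otimes>\<^sub>M batch)"
      by (rule measurable_compose) (simp add: f_def measurable_coords_H[OF c])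
  qed
  moreover have "(\<Sum>j\<in>{1..m}. (prob (\<Omega> j) / real (b j)) *\<^sub>R (\<Sum>k\<in>{1..b j}. f (fst z, snd z j k))) =
      (\<lambda>(x, w). if x \<in> fst c then coords c x (Hb x w) else 0) z" for z
  proof (cases "fst z \<in> fst c")
    case True
    note lin = linear_coords[OF c True]
    show ?thesis using True
      by (simp add: f_def batch_estimator_def case_prod_beta linear_sum[OF lin] linear_scale[OF lin])
  qed (simp add: f_def case_prod_beta)
  ultimately show ?thesis by simp
qed

text \<open>By the Lindelof property countably many chart domains cover M. Over each of them \<Phi>
  is a continuous function of measurable coordinates, and countably many measurable pieces can be
  glued. \<sigma> is merely Borel, so its value enters f as a coordinate of its own.\<close>

lemma measurable_chartwise:
  fixes \<sigma> :: "real \<Rightarrow> real" and \<Phi> :: "(real \<times> 'm) \<times> (nat \<Rightarrow> nat \<Rightarrow> 'w) \<Rightarrow> 'c::topological_space"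
  assumes \<sigma>: "\<sigma> \<in> borel_measurable borel"
    and cont: "\<And>c. c \<in> \<A> \<Longrightarrow> continuous_on (UNIV \<times> snd c ` fst c \<times> UNIV) (f c)"
    and \<Phi>: "\<And>c V x w. c \<in> \<A> \<Longrightarrow> x \<in> fst c \<Longrightarrow> \<Phi> ((V, x), w) = f c (\<sigma> V, snd c x, coords c x (Hb x w))"
  shows "\<Phi> \<in> borel_measurable ((borel \<Otimes>\<^sub>M borel) \<Otimes>\<^sub>M batch)"
proof -
  let ?M = "((borel :: real measure) \<Otimes>\<^sub>M (borel :: 'm measure)) \<Otimes>\<^sub>M batch"
  obtain \<U> where \<U>: "\<U> \<subseteq> fst ` \<A>" "countable \<U>" "\<Union>\<U> = \<Union>(fst ` \<A>)"
    using Lindelof[of "fst ` \<A>"] open_domain by blast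
  then have "\<Union>\<U> = UNIV" using smooth by (simp add: smooth_atlas_def)
  define D where "D U = {z :: (real \<times> 'm) \<times> (nat \<Rightarrow> nat \<Rightarrow> 'w). snd (fst z) \<in> U}" for U
  show ?thesis
  proof (rule measurable_piecewise_restrict[of "D ` \<U>"])
    show "countable (D ` \<U>)" using \<U>(2) by simp
    show "space ?M \<subseteq> \<Union>(D ` \<U>)" using \<open>\<Union>\<U> = UNIV\<close> by (auto simp: D_def)
    fix E assume "E \<in> D ` \<U>"
    then obtain c where c: "c \<in> \<A>" and E: "E = D (fst c)" using \<U>(1) by auto
    have proj: "(\<lambda>z. snd (fst z)) \<in> measurable ?M borel" by measurable
    have "(\<lambda>z. snd (fst z)) -` fst c \<inter> space ?M \<in> sets ?M"
      using open_domain[OF c] by (intro measurable_sets[OF proj]) auto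
    then show E_sets: "E \<inter> space ?M \<in> sets ?M" by (simp add: E D_def vimage_def)
    \<comment> \<open>The coordinates are extended by 0 off the chart to be measurable on the whole
      space before restriction to the piece \<open>E\<close>.\<close>
    define q where "q z = (\<sigma> (fst (fst z)), (if snd (fst z) \<in> fst c then snd c (snd (fst z)) else 0),
        (if snd (fst z) \<in> fst c then coords c (snd (fst z)) (Hb (snd (fst z)) (snd z)) else 0))" for z
    have "(\<lambda>x. if x \<in> fst c then snd c x else 0) \<in> borel_measurable borel"
      using open_domain[OF c] by (intro borel_measurable_continuous_on_if continuous_chart c) auto
    from measurable_compose[OF proj this]
    have q1: "(\<lambda>z. if snd (fst z) \<in> fst c then snd c (snd (fst z)) else 0) \<in> borel_measurable ?M" .
    have "(\<lambda>z. (snd (fst z), snd z)) \<in> measurable ?M (borel \<Otimes>\<^sub>M batch)" by measurable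
    from measurable_compose[OF this measurable_coords_Hb[OF c]]
    have q2: "(\<lambda>z. if snd (fst z) \<in> fst c then coords c (snd (fst z)) (Hb (snd (fst z)) (snd z)) else 0)
        \<in> borel_measurable ?M" by simp
    have "q \<in> borel_measurable ?M"
      unfolding q_def[abs_def] by (intro borel_measurable_Pair q1 q2 measurable_compose[OF _ \<sigma>]) measurable
    then have "q \<in> measurable (restrict_space ?M E) (restrict_space borel (UNIV \<times> snd c ` fst c \<times> UNIV))"
      by (intro measurable_restrict_space2 measurable_restrict_space1)
        (auto simp: q_def space_restrict_space E D_def)
    from measurable_compose[OF this borel_measurable_continuous_on_restrict[OF cont[OF c]]]
    have "(\<lambda>z. f c (q z)) \<in> borel_measurable (restrict_space ?M E)" .
    then show "\<Phi> \<in> borel_measurable (restrict_space ?M E)"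
      by (rule measurable_cong[THEN iffD1, rotated])
        (auto simp: space_restrict_space E D_def q_def \<Phi>[OF c])
  qed
qed

text \<open>In a chart the pairing with the gradient, the squared norm and the retraction step
  become \<open>chart_diff\<close>, \<open>chart_metric\<close> and R after
  \<open>bundle_chart_inv\<close>, all jointly continuous in base point and vector.\<close>

lemma state_algebra_borel: "state_algebra (borel \<Otimes>\<^sub>M borel)"
  unfolding state_algebra_def
proof (intro conjI ballI)
  let ?M = "((borel :: real measure) \<Otimes>\<^sub>M (borel :: 'm measure)) \<Otimes>\<^sub>M batch"
  show "(\<lambda>((V, x), w). g x (gradient \<A> g F x) (Hb x w)) \<in> borel_measurable ?M"
  proof (rule measurable_chartwise[where \<sigma> = "\<lambda>V. V" and f = "\<lambda>c (s, p, a). chart_diff c p a"])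
    fix c assume c: "c \<in> \<A>"
    show "continuous_on (UNIV \<times> snd c ` fst c \<times> UNIV) (\<lambda>(s :: real, p, a). chart_diff c p a)"
      unfolding case_prod_beta
      by (rule continuous_on_linear_family[where f = "chart_diff c" and S = "snd c ` fst c"])
        (auto intro!: linear_chart_diff continuous_chart_diff c continuous_intros)
  qed (simp_all add: g_gradient_coords)
  fix \<sigma> :: "real \<Rightarrow> real" assume \<sigma>: "\<sigma> \<in> borel_measurable borel"
  have "(\<lambda>z. (rnorm g (snd (fst z)) (Hb (snd (fst z)) (snd z)))\<^sup>2) \<in> borel_measurable ?M"
  proof (rule measurable_chartwise[where \<sigma> = "\<lambda>V. V" and f = "\<lambda>c (s, p, a). chart_metric c p a a"])
    fix c assume c: "c \<in> \<A>"
    show "continuous_on (UNIV \<times> snd c ` fst c \<times> UNIV) (\<lambda>(s :: real, p, a). chart_metric c p a a)"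
      unfolding case_prod_beta
      by (rule continuous_chart_metric2[OF c]) (auto intro!: continuous_intros)
  qed (simp_all add: chart_metric_coords rnorm_sq)
  then have 1: "(\<lambda>z. fst (fst z) + (rnorm g (snd (fst z)) (Hb (snd (fst z)) (snd z)))\<^sup>2) \<in> borel_measurable ?M"
    by (intro borel_measurable_add) auto
  have 2: "(\<lambda>z. R (snd (fst z), - (\<sigma> (fst (fst z)) *\<^sub>R Hb (snd (fst z)) (snd z)))) \<in> borel_measurable ?M"
  proof (rule measurable_chartwise[OF \<sigma>, where f = "\<lambda>c (s, p, a). (R \<circ> bundle_chart_inv \<A> c) (p, - (s *\<^sub>R a))"])
    fix c assume c: "c \<in> \<A>"
    show "continuous_on (UNIV \<times> snd c ` fst c \<times> UNIV)
        (\<lambda>(s :: real, p, a). (R \<circ> bundle_chart_inv \<A> c) (p, - (s *\<^sub>R a)))"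
      unfolding case_prod_beta
      by (rule continuous_on_compose2[OF continuous_R[OF c]]) (auto intro!: continuous_intros)
    fix V x w assume x: "x \<in> fst c"
    note lin = linear_coords[OF c x]
    show "R (snd (fst ((V, x), w)), - (\<sigma> (fst (fst ((V, x), w))) *\<^sub>R Hb (snd (fst ((V, x), w))) (snd ((V, x), w)))) =
        (\<lambda>(s, p, a). (R \<circ> bundle_chart_inv \<A> c) (p, - (s *\<^sub>R a))) (\<sigma> V, snd c x, coords c x (Hb x w))"
      using bundle_chart_inv_coords[OF c x, of "- (\<sigma> V *\<^sub>R Hb x w)"]
      by (simp add: linear_neg[OF lin] linear_scale[OF lin])
  qed
  have "step \<sigma> = (\<lambda>z. (fst (fst z) + (rnorm g (snd (fst z)) (Hb (snd (fst z)) (snd z)))\<^sup>2,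
      R (snd (fst z), - (\<sigma> (fst (fst z)) *\<^sub>R Hb (snd (fst z)) (snd z)))))"
    by (auto simp: step_def fun_eq_iff)
  then show "step \<sigma> \<in> measurable ?M (borel \<Otimes>\<^sub>M borel)"
    using measurable_Pair[OF 1 2] by simp
qed

end

end

section \<open>Step sizes of AdaGrad type\<close>

text \<open>The mean value theorem for v powr (-\<kappa>) on [y, y + a] produces a / s powr (1 +
  \<kappa>) with s inside the interval, whereas the step uses the left end y. As a \<le> D and y
  \<ge> \<beta>, s is at most (1 + D/\<beta>) y; this is the origin of the constant.\<close>

lemma adaptive_increment_le:
  fixes y a \<beta> D \<kappa> :: real
  assumes "0 < \<beta>" "\<beta> \<le> y" "0 \<le> a" "a \<le> D" "0 < \<kappa>"
  shows "a / y powr (1 + \<kappa>) \<le> (1 + D / \<beta>) powr (1 + \<kappa>) / \<kappa> * (y powr (- \<kappa>) - (y + a) powr (- \<kappa>))"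
proof (cases "a = 0")
  case False
  with assms have a: "a > 0" and y: "y > 0" and D: "D > 0" by auto
  have "\<exists>s. y < s \<and> s < y + a \<and> - ((y + a) powr (- \<kappa>)) - - (y powr (- \<kappa>)) = (y + a - y) * (\<kappa> * s powr (- \<kappa> - 1))"
    using a y by (intro MVT2) (auto intro!: derivative_eq_intros simp: field_simps)
  then obtain s where s: "y < s" "s < y + a"
    and eq: "y powr (- \<kappa>) - (y + a) powr (- \<kappa>) = a * (\<kappa> * s powr (- \<kappa> - 1))"
    by (auto simp: algebra_simps)
  have "a \<le> D / \<beta> * y"
  proof -
    have "D / \<beta> * \<beta> \<le> D / \<beta> * y" using assms D by (intro mult_left_mono) auto
    then show ?thesis using assms by simp
  qed
  then have "s \<le> (1 + D / \<beta>) * y" using s by (simp add: algebra_simps)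
  then have "s powr (1 + \<kappa>) \<le> ((1 + D / \<beta>) * y) powr (1 + \<kappa>)"
    using s y assms by (intro powr_mono2) auto
  also have "\<dots> = (1 + D / \<beta>) powr (1 + \<kappa>) * y powr (1 + \<kappa>)"
    by (rule powr_mult)
  finally have "a / y powr (1 + \<kappa>) \<le> (1 + D / \<beta>) powr (1 + \<kappa>) * (a / s powr (1 + \<kappa>))"
    using a y s by (simp add: field_simps)
  also have "a / s powr (1 + \<kappa>) = (y powr (- \<kappa>) - (y + a) powr (- \<kappa>)) / \<kappa>"
  proof -
    have "s powr (- \<kappa> - 1) = s powr (- (1 + \<kappa>))" by (rule arg_cong[where f = "(powr) s"]) simp
    also have "\<dots> = 1 / s powr (1 + \<kappa>)" by (rule powr_minus_divide)
    finally show ?thesis unfolding eq using assms(5) by simp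
  qed
  finally show ?thesis by simp
qed simp

text \<open>The bounds for the single increments telescope, leaving the value at \<beta>. The
  constant depends neither on n nor on the sequence, hence not on the trajectory.\<close>

lemma adaptive_sum_le:
  fixes a :: "nat \<Rightarrow> real" and \<beta> D \<kappa> :: real
  assumes "0 < \<beta>" "0 < \<kappa>" and a: "\<And>t. 0 \<le> a t" "\<And>t. a t \<le> D"
  shows "(\<Sum>t<n. a t / (\<beta> + (\<Sum>p<t. a p)) powr (1 + \<kappa>)) \<le> (1 + D / \<beta>) powr (1 + \<kappa>) / \<kappa> * \<beta> powr (- \<kappa>)"
proof -
  let ?c = "(1 + D / \<beta>) powr (1 + \<kappa>) / \<kappa>"
  have "(\<Sum>t<n. a t / (\<beta> + (\<Sum>p<t. a p)) powr (1 + \<kappa>)) \<le> ?c * (\<beta> powr (- \<kappa>) - (\<beta> + (\<Sum>p<n. a p)) powr (- \<kappa>))"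
  proof (induction n)
    case (Suc n)
    have "a n / (\<beta> + (\<Sum>p<n. a p)) powr (1 + \<kappa>) \<le>
        ?c * ((\<beta> + (\<Sum>p<n. a p)) powr (- \<kappa>) - (\<beta> + (\<Sum>p<n. a p) + a n) powr (- \<kappa>))"
      using assms by (intro adaptive_increment_le) (auto intro!: sum_nonneg)
    with Suc show ?case by (simp add: algebra_simps)
  qed simp
  also have "\<dots> \<le> ?c * \<beta> powr (- \<kappa>)"
    using assms(2) by (intro mult_left_mono) auto
  finally show ?thesis .
qed

text \<open>The accumulated sum grows at most linearly and the exponent is at most 1, so the steps
  dominate a harmonic series.\<close>

lemma adaptive_step_not_summable:
  fixes a :: "nat \<Rightarrow> real" and \<alpha> \<beta> D e :: real
  assumes "0 < \<alpha>" "0 < \<beta>" "0 < e" "e \<le> 1" and a: "\<And>t. 0 \<le> a t" "\<And>t. a t \<le> D"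
  shows "\<not> summable (\<lambda>t. \<alpha> / (\<beta> + (\<Sum>p<t. a p)) powr e)"
proof
  \<comment> \<open>\<open>E\<close> dominates \<beta> and D, so \<beta> plus t terms is at most E
    (t + 1); E \<ge> 1 allows passing from exponent e to exponent 1.\<close>
  define E where "E = max 1 (max \<beta> D)"
  have E: "1 \<le> E" "\<beta> \<le> E" "D \<le> E" by (auto simp: E_def)
  assume summable: "summable (\<lambda>t. \<alpha> / (\<beta> + (\<Sum>p<t. a p)) powr e)"
  have le: "\<alpha> / E * inverse (real (Suc t)) \<le> \<alpha> / (\<beta> + (\<Sum>p<t. a p)) powr e" for t
  proof -
    have pos: "0 < \<beta> + (\<Sum>p<t. a p)" using assms by (auto intro!: add_pos_nonneg sum_nonneg)
    have "(\<Sum>p<t. a p) \<le> (\<Sum>p<t. E)" using a(2) E(3) by (intro sum_mono) (auto intro: order_trans)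
    then have "\<beta> + (\<Sum>p<t. a p) \<le> E * real (Suc t)" using E(2) by (simp add: algebra_simps)
    then have "(\<beta> + (\<Sum>p<t. a p)) powr e \<le> (E * real (Suc t)) powr e"
      using pos assms(3) by (intro powr_mono2) auto
    also have "\<dots> \<le> (E * real (Suc t)) powr 1"
      using assms(4) E(1) mult_mono[OF E(1), of 1 "real (Suc t)"] by (intro powr_mono) auto
    also have "\<dots> = E * real (Suc t)" using E(1) by simp
    finally have "\<alpha> / (E * real (Suc t)) \<le> \<alpha> / (\<beta> + (\<Sum>p<t. a p)) powr e"
      using assms(1) pos E(1) by (intro divide_left_mono mult_pos_pos) auto
    then show ?thesis by (simp add: divide_inverse)
  qed
  have "summable (\<lambda>t. \<alpha> / E * inverse (real (Suc t)))"
    by (rule summable_comparison_test'[OF summable, of 0]) (use le assms(1) E(1) in simp)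
  then have "summable (\<lambda>t. inverse (real (Suc t)))"
    using assms(1) E(1) by (subst (asm) summable_cmult_iff) auto
  then show False
    using not_summable_harmonic[where 'a = real] summable_Suc_iff[of "\<lambda>n. inverse (real n)"] by simp
qed

section \<open>Convergence of stochastic gradient descent\<close>

locale sgd = retracted C \<A> g F R + Q: prob_space Q
  for C :: "'e::{real_inner,banach,heine_borel,second_countable_topology} set"
    and \<A> :: "('m::{t2_space,second_countable_topology}, 'e) chart set"
    and g :: "'m \<Rightarrow> 'e \<Rightarrow> 'e \<Rightarrow> real"
    and F :: "'m \<Rightarrow> real"
    and R :: "'m \<times> 'e \<Rightarrow> 'm"
    and Q :: "'q measure" +
  fixes P :: "'w measure" and H :: "'m \<times> 'w \<Rightarrow> 'm \<times> 'e"
    and m :: "nat \<Rightarrow> nat" and \<Omega> :: "nat \<Rightarrow> nat \<Rightarrow> 'w set" and b :: "nat \<Rightarrow> nat \<Rightarrow> nat"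
    and \<Omega>B :: "nat \<Rightarrow> (nat \<Rightarrow> nat \<Rightarrow> 'w) measure" and Hb :: "nat \<Rightarrow> 'm \<Rightarrow> (nat \<Rightarrow> nat \<Rightarrow> 'w) \<Rightarrow> 'e"
    and \<omega> :: "nat \<Rightarrow> 'q \<Rightarrow> nat \<Rightarrow> nat \<Rightarrow> 'w" and K :: "'m set" and A :: real
  assumes \<Omega>B_eq: "\<Omega>B t = batch_measure P (m t) (\<Omega> t) (b t)"
    and Hb_eq: "Hb t = batch_estimator P H (m t) (\<Omega> t) (b t)"
    and sg: "stochastic_gradient C \<A> g F R P (m t) (\<Omega> t) (b t) H"
    and H_meas: "finite (space P) \<and> sets P = Pow (space P) \<or> H \<in> borel \<Otimes>\<^sub>M P \<rightarrow>\<^sub>M tangent_borel \<A>"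
    and indep: "Q.indep_vars \<Omega>B \<omega> UNIV"
    and distr: "distr Q (\<Omega>B t) (\<omega> t) = \<Omega>B t"
    and K: "compact K" and A: "A > 0" and lip: "R_Lipschitz \<A> g R K A (gradient \<A> g F)"
    and H_le: "y \<in> K \<Longrightarrow> w \<in> space P \<Longrightarrow> rnorm g y (snd (H (y, w))) \<le> A"
begin

lemma Hb_le:
  assumes "y \<in> K" "w \<in> space (\<Omega>B t)"
  shows "rnorm g y (Hb t y w) \<le> A"
proof -
  interpret SG: stochastic_gradient C \<A> g F R P "m t" "\<Omega> t" "b t" H by (rule sg)
  show ?thesis using SG.rnorm_Hb_le[of y A w] H_le assms by (simp add: Hb_eq \<Omega>B_eq)
qed

lemma gradient_le:
  assumes "y \<in> K"
  shows "rnorm g y (gradient \<A> g F y) \<le> A"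
proof -
  interpret SG: stochastic_gradient C \<A> g F R P "m 0" "\<Omega> 0" "b 0" H by (rule sg)
  show ?thesis using SG.rnorm_gradient_le H_le assms by blast
qed

lemma grad_sq_le: "y \<in> K \<Longrightarrow> grad_sq y \<le> A\<^sup>2"
  using power_mono[OF gradient_le rnorm_nonneg, of _ 2] by (simp add: rnorm_sq grad_sq_def)

lemma \<omega>_space: "q \<in> space Q \<Longrightarrow> \<omega> t q \<in> space (\<Omega>B t)"
  using Q.X_space[OF indep] .

text \<open>
  Write \<open>Z\<close> for \<open>\<langle>\<nabla>F, Hb\<rangle>\<close> and \<open>h\<close> for \<open>|\<nabla>F|\<^sup>2\<close>. The differences \<open>\<xi> = s (Z - h)\<close> are centred given
  the past, and \<open>\<xi>\<^sup>2 \<le> (s Z)\<^sup>2 - 2 (s h) \<xi>\<close>, where \<open>(s h) \<xi>\<close> has mean zero; hence the bound on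
  \<open>\<Sum> s\<^sup>2 |Hb|\<^sup>2\<close> controls \<open>\<Sum> E \<xi>\<^sup>2\<close>.
\<close>

lemma stochastic_descent:
  fixes x :: "nat \<Rightarrow> 'q \<Rightarrow> 'm" and \<sigma> :: "nat \<Rightarrow> real \<Rightarrow> real"
  defines "V \<equiv> \<lambda>t q. \<Sum>p<t. (rnorm g (x p q) (Hb p (x p q) (\<omega> p q)))\<^sup>2"
  assumes \<sigma>_meas: "\<And>t. \<sigma> t \<in> borel_measurable borel"
    and \<sigma>: "\<And>t v. 0 \<le> v \<Longrightarrow> 0 < \<sigma> t v" "\<And>t v. 0 \<le> v \<Longrightarrow> \<sigma> t v \<le> 1"
    and x0: "\<And>q. q \<in> space Q \<Longrightarrow> x 0 q = x0"
    and x_Suc: "\<And>t q. q \<in> space Q \<Longrightarrow> x (Suc t) q = R (x t q, - (\<sigma> t (V t q) *\<^sub>R Hb t (x t q) (\<omega> t q)))"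
    and x_in: "\<And>t q. q \<in> space Q \<Longrightarrow> x t q \<in> K"
    and B: "\<And>n q. q \<in> space Q \<Longrightarrow>
      (\<Sum>t<n. (\<sigma> t (V t q))\<^sup>2 * (rnorm g (x t q) (Hb t (x t q) (\<omega> t q)))\<^sup>2) \<le> B"
  shows "AE q in Q. convergent (\<lambda>t. F (x t q)) \<and> summable (\<lambda>t. \<sigma> t (V t q) * grad_sq (x t q))"
    and "\<And>t. (\<lambda>q. grad_sq (x t q)) \<in> borel_measurable Q"
proof -
  interpret SG: stochastic_gradient C \<A> g F R P "m t" "\<Omega> t" "b t" H for t by (rule sg)
  let ?D = "gradient \<A> g F"
  let ?past = "Q.past \<Omega>B \<omega>"
  have prob_\<Omega>B: "prob_space (\<Omega>B t)" for t unfolding \<Omega>B_eq by (rule SG.prob_space_batch)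
  have Hb_le': "rnorm g (x t q) (Hb t (x t q) (\<omega> t q)) \<le> A" if "q \<in> space Q" for t q
    using Hb_le x_in \<omega>_space that by blast
  have V_nonneg: "0 \<le> V t q" for t q by (simp add: V_def sum_nonneg)
  define s where "s t q = \<sigma> t (V t q)" for t q
  have s: "0 < s t q" "s t q \<le> 1" for t q using \<sigma> V_nonneg by (auto simp: s_def)
  define Z where "Z t y w = g y (?D y) (Hb t y w)" for t y w
  have Z_le: "\<bar>Z t y w\<bar> \<le> A * rnorm g y (Hb t y w)" if "y \<in> K" for t y w
    unfolding Z_def using gradient_le[OF that]
    by (intro order_trans[OF rnorm_Cauchy_Schwarz] mult_right_mono rnorm_nonneg)
  \<comment> \<open>In either alternative for H, what follows relies on these properties of the
    \<sigma>-algebra of states: discrete if the sample space is finite, Borel otherwise.\<close>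
  obtain N :: "(real \<times> 'm) measure" where N: "space N = UNIV" "fst \<in> measurable N borel" "snd \<in> measurable N borel"
    and state: "\<And>t. SG.state_algebra t N"
  proof (cases "finite (space P) \<and> sets P = Pow (space P)")
    case True
    then show ?thesis
      by (intro that[of "count_space UNIV"] SG.state_algebra_count_space) auto
  next
    case False
    with H_meas show ?thesis
      by (intro that[of "borel \<Otimes>\<^sub>M borel"] SG.state_algebra_borel) (auto simp: space_pair_measure)
  qed
  define z where "z t q = (V t q, x t q)" for t q
  \<comment> \<open>The state at time t + 1 is a measurable function of the state at time t and the
    batch at time t, both known at time t + 1. The fixed starting point makes the initial state
    constant.\<close>
  have z_meas: "z t \<in> measurable (?past t) N" for t
  proof (induction t)
    case 0
    have "(\<lambda>q. (0, x0)) \<in> measurable (?past 0) N" by (intro measurable_const) (simp add: N)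
    then show ?case
      by (rule measurable_cong[THEN iffD1, rotated]) (simp add: z_def V_def x0 Q.space_past)
  next
    case (Suc t)
    have "z t \<in> measurable (?past (Suc t)) N"
      by (rule Q.measurable_past_mono[OF indep _ Suc]) simp
    moreover have "\<omega> t \<in> measurable (?past (Suc t)) (\<Omega>B t)"
      by (rule Q.measurable_X_past[OF indep]) simp
    ultimately have "(\<lambda>q. (z t q, \<omega> t q)) \<in> measurable (?past (Suc t)) (N \<Otimes>\<^sub>M \<Omega>B t)"
      by (rule measurable_Pair)
    moreover have "SG.step t (\<sigma> t) \<in> measurable (N \<Otimes>\<^sub>M \<Omega>B t) N"
      using state \<sigma>_meas unfolding SG.state_algebra_def \<Omega>B_eq by blast
    ultimately have "(\<lambda>q. SG.step t (\<sigma> t) (z t q, \<omega> t q)) \<in> measurable (?past (Suc t)) N"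
      by (rule measurable_compose)
    then show ?case
      by (rule measurable_cong[THEN iffD1, rotated])
        (simp add: z_def SG.step_def x_Suc Q.space_past Hb_eq V_def)
  qed
  have x_meas: "x t \<in> measurable (?past t) borel" and V_meas: "V t \<in> borel_measurable (?past t)" for t
    using measurable_compose[OF z_meas[of t] N(3)] measurable_compose[OF z_meas[of t] N(2)]
    by (simp_all add: z_def)
  have h_meas: "(\<lambda>q. grad_sq (x t q)) \<in> borel_measurable (?past t)" for t
    using measurable_compose[OF x_meas borel_measurable_continuous_onI[OF continuous_grad_sq]] .
  then show "(\<lambda>q. grad_sq (x t q)) \<in> borel_measurable Q" for t
    by (rule Q.measurable_past_M[OF indep])
  have s_meas: "s t \<in> borel_measurable (?past t)" for t
    using measurable_compose[OF V_meas \<sigma>_meas] by (simp add: s_def[abs_def])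

  \<comment> \<open>The batch is kept as a separate argument, so that it can be integrated with q,
    and hence the current point and step, frozen.\<close>
  define \<phi> where "\<phi> t = (\<lambda>(q, w). s t q * (Z t (x t q) w - grad_sq (x t q)))" for t
  define \<xi> where "\<xi> t q = \<phi> t (q, \<omega> t q)" for t q
  have "martingale_differences Q ?past (\<lambda>t q. \<phi> t (q, \<omega> t q))"
  proof (rule Q.martingale_differences_past[OF indep distr])
    fix t
    have "(\<lambda>p. (z t (fst p), snd p)) \<in> measurable (?past t \<Otimes>\<^sub>M \<Omega>B t) (N \<Otimes>\<^sub>M \<Omega>B t)"
      by (intro measurable_Pair measurable_compose[OF measurable_fst z_meas] measurable_snd)
    moreover have "(\<lambda>((V, y), w). Z t y w) \<in> borel_measurable (N \<Otimes>\<^sub>M \<Omega>B t)"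
      using state unfolding SG.state_algebra_def \<Omega>B_eq Z_def Hb_eq by blast
    ultimately have "(\<lambda>p. (\<lambda>((V, y), w). Z t y w) (z t (fst p), snd p)) \<in> borel_measurable (?past t \<Otimes>\<^sub>M \<Omega>B t)"
      by (rule measurable_compose)
    then have "(\<lambda>p. Z t (x t (fst p)) (snd p)) \<in> borel_measurable (?past t \<Otimes>\<^sub>M \<Omega>B t)"
      by (simp add: z_def)
    then show "\<phi> t \<in> borel_measurable (?past t \<Otimes>\<^sub>M \<Omega>B t)"
      unfolding \<phi>_def case_prod_beta
      by (intro borel_measurable_times borel_measurable_diff measurable_compose[OF measurable_fst s_meas]
          measurable_compose[OF measurable_fst h_meas])
    show "bounded_fun_on (space Q \<times> space (\<Omega>B t)) (\<phi> t)"
    proof (rule bounded_fun_onI)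
      fix p assume "p \<in> space Q \<times> space (\<Omega>B t)"
      then obtain q w where p: "p = (q, w)" "q \<in> space Q" "w \<in> space (\<Omega>B t)" by auto
      have "\<bar>Z t (x t q) w\<bar> \<le> A * A"
        using Z_le[OF x_in[OF p(2)]] Hb_le[OF x_in[OF p(2)] p(3)] A by (meson mult_left_mono order_trans less_imp_le)
      then have "\<bar>Z t (x t q) w - grad_sq (x t q)\<bar> \<le> 2 * A\<^sup>2"
        using grad_sq_le[OF x_in[OF p(2)], of t] grad_sq_nonneg[of "x t q"] unfolding power2_eq_square by linarith
      then have "\<bar>s t q\<bar> * \<bar>Z t (x t q) w - grad_sq (x t q)\<bar> \<le> 1 * (2 * A\<^sup>2)"
        using s[of t q] by (intro mult_mono) auto
      then show "\<bar>\<phi> t p\<bar> \<le> 2 * A\<^sup>2" by (simp add: p \<phi>_def abs_mult)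
    qed
    fix q
    interpret B: prob_space "\<Omega>B t" by (rule prob_\<Omega>B)
    have "has_bochner_integral (\<Omega>B t) (\<lambda>w. Z t (x t q) w) (grad_sq (x t q))"
      unfolding Z_def Hb_eq \<Omega>B_eq grad_sq_def by (rule SG.integral_g_Hb)
    then show "(\<integral>w. \<phi> t (q, w) \<partial>\<Omega>B t) = 0"
      by (simp add: \<phi>_def has_bochner_integral_iff B.prob_space)
  qed
  then interpret MD: martingale_differences Q ?past \<xi> unfolding \<xi>_def .
  have AE_\<xi>: "AE q in Q. summable (\<lambda>t. \<xi> t q)"
  proof (rule MD.AE_summable)
    fix n
    define Y where "Y t q = s t q * grad_sq (x t q)" for t q
    have Y_meas: "Y t \<in> borel_measurable (?past t)" for t
      unfolding Y_def by (intro borel_measurable_times s_meas h_meas)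
    have Y_bdd: "bounded_fun_on (space Q) (Y t)" for t
    proof (rule bounded_fun_onI)
      fix q assume "q \<in> space Q"
      then have "s t q * grad_sq (x t q) \<le> 1 * A\<^sup>2"
        using s[of t q] grad_sq_le[OF x_in] grad_sq_nonneg by (intro mult_mono) auto
      then show "\<bar>Y t q\<bar> \<le> A\<^sup>2" using s[of t q] grad_sq_nonneg[of "x t q"] by (simp add: Y_def abs_mult)
    qed
    have Y_int: "integrable Q (\<lambda>q. Y t q * \<xi> t q)" for t
      by (intro Q.integrable_bounded_fun bounded_fun_on_mult Y_bdd MD.\<xi>_bounded borel_measurable_times
          MD.\<xi>_measurable_M MD.measurable_\<F>_M[OF Y_meas])
    have \<xi>_int: "integrable Q (\<lambda>q. (\<xi> t q)\<^sup>2)" for t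
      unfolding power2_eq_square
      by (intro Q.integrable_bounded_fun bounded_fun_on_mult MD.\<xi>_bounded borel_measurable_times MD.\<xi>_measurable_M)
    have "(\<Sum>t<n. Q.expectation (\<lambda>q. (\<xi> t q)\<^sup>2)) = Q.expectation (\<lambda>q. \<Sum>t<n. (\<xi> t q)\<^sup>2)"
      using \<xi>_int by simp
    also have "\<dots> \<le> Q.expectation (\<lambda>q. A\<^sup>2 * B - 2 * (\<Sum>t<n. Y t q * \<xi> t q))"
    proof (rule integral_mono)
      fix q assume q: "q \<in> space Q"
      have "(\<xi> t q)\<^sup>2 \<le> A\<^sup>2 * ((s t q)\<^sup>2 * (rnorm g (x t q) (Hb t (x t q) (\<omega> t q)))\<^sup>2) - 2 * (Y t q * \<xi> t q)" for t
      proof -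
        let ?Z = "Z t (x t q) (\<omega> t q)" and ?h = "grad_sq (x t q)" and ?r = "rnorm g (x t q) (Hb t (x t q) (\<omega> t q))"
        \<comment> \<open>Write s Z as Y + \<xi> and solve its expanded square for the square of
          \<xi>.\<close>
        have "(\<xi> t q)\<^sup>2 = (s t q * ?Z)\<^sup>2 - 2 * (Y t q * \<xi> t q) - (Y t q)\<^sup>2"
          by (simp add: \<xi>_def \<phi>_def Y_def power2_eq_square algebra_simps)
        also have "(s t q * ?Z)\<^sup>2 \<le> (s t q * (A * ?r))\<^sup>2"
          using Z_le[OF x_in[OF q]] s(1)[of t q] A rnorm_nonneg
          by (intro power2_le_iff_abs_le[THEN iffD2]) (auto simp: abs_mult intro!: mult_left_mono)
        finally show ?thesis by (simp add: power_mult_distrib mult_ac) (smt (verit) zero_le_power2)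
      qed
      then have "(\<Sum>t<n. (\<xi> t q)\<^sup>2) \<le> (\<Sum>t<n. A\<^sup>2 * ((s t q)\<^sup>2 * (rnorm g (x t q) (Hb t (x t q) (\<omega> t q)))\<^sup>2) - 2 * (Y t q * \<xi> t q))"
        by (rule sum_mono)
      also have "\<dots> \<le> A\<^sup>2 * B - 2 * (\<Sum>t<n. Y t q * \<xi> t q)"
        using mult_left_mono[OF B[OF q, of n], of "A\<^sup>2"]
        by (simp add: sum_subtractf sum_distrib_left s_def)
      finally show "(\<Sum>t<n. (\<xi> t q)\<^sup>2) \<le> A\<^sup>2 * B - 2 * (\<Sum>t<n. Y t q * \<xi> t q)" .
    qed (use \<xi>_int Y_int in auto)
    also have "\<dots> = A\<^sup>2 * B"
      using Y_int MD.orthogonal[OF Y_meas Y_bdd] by (simp add: Q.prob_space)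
    finally show "(\<Sum>t<n. Q.expectation (\<lambda>q. (\<xi> t q)\<^sup>2)) \<le> A\<^sup>2 * B" .
  qed

  obtain L where L: "L > 0" and descent: "\<And>y u. y \<in> K \<Longrightarrow> rnorm g y u \<le> A \<Longrightarrow>
      \<bar>F (R (y, u)) - F y - g y (?D y) u\<bar> \<le> L * (rnorm g y u)\<^sup>2"
    using descent[OF lip] by blast
  have "compact (F ` K)"
    using continuous_on_subset[OF continuous_F] K by (intro compact_continuous_image) auto
  then have "bounded (F ` K)" by (rule compact_imp_bounded)
  then obtain M where M: "\<And>y. y \<in> K \<Longrightarrow> \<bar>F y\<bar> \<le> M" by (auto simp: bounded_iff)
  show "AE q in Q. convergent (\<lambda>t. F (x t q)) \<and> summable (\<lambda>t. \<sigma> t (V t q) * grad_sq (x t q))"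
    using AE_\<xi> AE_space
  proof eventually_elim
    case (elim q)
    note q = elim(2)
    define r where "r t = rnorm g (x t q) (Hb t (x t q) (\<omega> t q))" for t
    \<comment> \<open>Since s Z = \<xi> + s h, this is the remainder of the first-order expansion of
      F along the step.\<close>
    define e where "e t = F (x (Suc t) q) - F (x t q) + \<xi> t q + s t q * grad_sq (x t q)" for t
    have e_le: "\<bar>e t\<bar> \<le> L * ((s t q)\<^sup>2 * (r t)\<^sup>2)" for t
    proof -
      let ?u = "- (s t q *\<^sub>R Hb t (x t q) (\<omega> t q))"
      have u: "rnorm g (x t q) ?u = s t q * r t"
        using s(1)[of t q] by (simp add: rnorm_minus rnorm_scale r_def)
      have r: "0 \<le> r t" "r t \<le> A" using Hb_le'[OF q] rnorm_nonneg by (auto simp: r_def)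
      \<comment> \<open>Steps of size at most 1 keep the tangent vector within the radius on which
        the descent estimate holds.\<close>
      have "s t q * r t \<le> 1 * A" using s[of t q] r by (intro mult_mono) auto
      then have "\<bar>F (R (x t q, ?u)) - F (x t q) - g (x t q) (?D (x t q)) ?u\<bar> \<le> L * (s t q * r t)\<^sup>2"
        using descent[OF x_in[OF q], of t ?u] by (simp add: u)
      moreover have "e t = F (R (x t q, ?u)) - F (x t q) - g (x t q) (?D (x t q)) ?u"
        by (simp add: e_def x_Suc[OF q] s_def[symmetric] \<xi>_def \<phi>_def Z_def form_simps algebra_simps)
      ultimately show ?thesis by (simp add: power_mult_distrib)
    qed
    have "summable (\<lambda>t. (s t q)\<^sup>2 * (r t)\<^sup>2)"
      by (rule summableI_nonneg_bounded) (use B[OF q] in \<open>auto simp: s_def r_def\<close>)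
    then have e: "summable e"
      by (rule summable_comparison_test'[OF summable_mult[where c = L], of _ 0]) (use e_le in simp)
    \<comment> \<open>Solved for the nonnegative series, whose partial sums are bounded because F is
      bounded on K and the other two series converge. Read the other way, once all three series
      converge, so does F along the trajectory.\<close>
    have telescope: "(\<Sum>t<n. s t q * grad_sq (x t q)) = F (x 0 q) - F (x n q) - (\<Sum>t<n. \<xi> t q) + (\<Sum>t<n. e t)" for n
      using sum_lessThan_telescope[of "\<lambda>t. F (x t q)" n]
      by (simp add: e_def sum.distrib sum_subtractf)
    obtain c1 where c1: "\<And>n. \<bar>\<Sum>t<n. \<xi> t q\<bar> \<le> c1"
      using convergent_imp_Bseq[OF elim(1)[unfolded summable_iff_convergent]] unfolding Bseq_def real_norm_def by blast
    obtain c2 where c2: "\<And>n. \<bar>\<Sum>t<n. e t\<bar> \<le> c2"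
      using convergent_imp_Bseq[OF e[unfolded summable_iff_convergent]] unfolding Bseq_def real_norm_def by blast
    have sh: "summable (\<lambda>t. s t q * grad_sq (x t q))"
    proof (rule summableI_nonneg_bounded)
      show "0 \<le> s t q * grad_sq (x t q)" for t using s(1)[of t q] grad_sq_nonneg by simp
      show "(\<Sum>t<n. s t q * grad_sq (x t q)) \<le> 2 * M + c1 + c2" for n
        using telescope[of n] M[OF x_in[OF q], of 0] M[OF x_in[OF q], of n] c1[of n] c2[of n]
        unfolding abs_le_iff by linarith
    qed
    have "convergent (\<lambda>n. F (x 0 q) - (\<Sum>t<n. s t q * grad_sq (x t q)) - (\<Sum>t<n. \<xi> t q) + (\<Sum>t<n. e t))"
      using sh elim(1) e unfolding summable_iff_convergent
      by (intro convergent_add convergent_diff convergent_const)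
    also have "(\<lambda>n. F (x 0 q) - (\<Sum>t<n. s t q * grad_sq (x t q)) - (\<Sum>t<n. \<xi> t q) + (\<Sum>t<n. e t)) = (\<lambda>n. F (x n q))"
      by (simp add: telescope)
    finally show ?case using sh by (simp add: s_def)
  qed
qed

text \<open>The step function ignores V, and the pathwise bound is the sum of the squared steps
  times A squared. Mean square convergence follows from the almost sure one by dominated
  convergence, |grad F|^2 being at most A squared on K.\<close>

lemma decreasing_steps:
  fixes x :: "nat \<Rightarrow> 'q \<Rightarrow> 'm" and \<gamma> :: "nat \<Rightarrow> real"
  assumes \<gamma>: "\<And>t. 0 < \<gamma> t" "\<And>t. \<gamma> t \<le> 1" and sq: "summable (\<lambda>t. (\<gamma> t)\<^sup>2)" and div: "\<not> summable \<gamma>"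
    and x0: "\<And>q. q \<in> space Q \<Longrightarrow> x 0 q = x0"
    and x_Suc: "\<And>t q. q \<in> space Q \<Longrightarrow> x (Suc t) q = R (x t q, - (\<gamma> t *\<^sub>R Hb t (x t q) (\<omega> t q)))"
    and x_in: "\<And>t q. q \<in> space Q \<Longrightarrow> x t q \<in> K"
  shows "AE q in Q. convergent (\<lambda>t. F (x t q))"
    and "AE q in Q. (\<lambda>t. rnorm g (x t q) (gradient \<A> g F (x t q))) \<longlonglongrightarrow> 0"
    and "integrable Q (\<lambda>q. (rnorm g (x t q) (gradient \<A> g F (x t q)))\<^sup>2)"
    and "(\<lambda>t. \<integral>q. (rnorm g (x t q) (gradient \<A> g F (x t q)))\<^sup>2 \<partial>Q) \<longlonglongrightarrow> 0"
proof -
  have r_le: "rnorm g (x t q) (Hb t (x t q) (\<omega> t q)) \<le> A" if "q \<in> space Q" for t q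
    using Hb_le x_in \<omega>_space that by blast
  have B: "(\<Sum>t<n. (\<gamma> t)\<^sup>2 * (rnorm g (x t q) (Hb t (x t q) (\<omega> t q)))\<^sup>2) \<le> (\<Sum>t. (\<gamma> t)\<^sup>2) * A\<^sup>2"
    if q: "q \<in> space Q" for n q
  proof -
    have "(\<Sum>t<n. (\<gamma> t)\<^sup>2 * (rnorm g (x t q) (Hb t (x t q) (\<omega> t q)))\<^sup>2) \<le> (\<Sum>t<n. (\<gamma> t)\<^sup>2 * A\<^sup>2)"
      using r_le[OF q] rnorm_nonneg by (intro sum_mono mult_left_mono power_mono) auto
    also have "\<dots> = (\<Sum>t<n. (\<gamma> t)\<^sup>2) * A\<^sup>2" by (simp add: sum_distrib_right)
    also have "\<dots> \<le> (\<Sum>t. (\<gamma> t)\<^sup>2) * A\<^sup>2"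
      using sq by (intro mult_right_mono sum_le_suminf) auto
    finally show ?thesis .
  qed
  have sd: "AE q in Q. convergent (\<lambda>t. F (x t q)) \<and> summable (\<lambda>t. \<gamma> t * grad_sq (x t q))"
    "(\<lambda>q. grad_sq (x t q)) \<in> borel_measurable Q" for t
    by (rule stochastic_descent[where \<sigma> = "\<lambda>t v. \<gamma> t" and x = x and ?x0.0 = x0];
        (rule borel_measurable_const \<gamma> x0 x_Suc x_in B; assumption?))+
  have \<gamma>0: "\<gamma> \<longlonglongrightarrow> 0"
    using tendsto_real_sqrt[OF summable_LIMSEQ_zero[OF sq]] \<gamma>(1) by (simp add: less_imp_le)
  show "AE q in Q. convergent (\<lambda>t. F (x t q))" using sd(1) by eventually_elim simp
  have h0: "AE q in Q. (\<lambda>t. grad_sq (x t q)) \<longlonglongrightarrow> 0"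
    using sd(1) AE_space
  proof eventually_elim
    case (elim q)
    show ?case
      by (rule tendsto_zero_along_steps[where s = \<gamma> and v = "\<lambda>t. Hb t (x t q) (\<omega> t q)", OF K x_in[OF elim(2)]
            continuous_grad_sq grad_sq_nonneg \<gamma>(1) \<gamma>0 div _ x_Suc[OF elim(2)] r_le[OF elim(2)] A])
        (use elim(1) in simp)
  qed
  then show "AE q in Q. (\<lambda>t. rnorm g (x t q) (gradient \<A> g F (x t q))) \<longlonglongrightarrow> 0"
    by eventually_elim (auto simp: rnorm_gradient intro: tendsto_eq_intros)
  have bdd: "bounded_fun_on (space Q) (\<lambda>q. grad_sq (x t q))" for t
    using grad_sq_le[OF x_in] grad_sq_nonneg by (intro bounded_fun_onI[of _ _ "A\<^sup>2"]) auto
  have eq: "(rnorm g y (gradient \<A> g F y))\<^sup>2 = grad_sq y" for y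
    by (simp add: rnorm_sq grad_sq_def)
  show "integrable Q (\<lambda>q. (rnorm g (x t q) (gradient \<A> g F (x t q)))\<^sup>2)"
    unfolding eq by (rule Q.integrable_bounded_fun[OF sd(2) bdd])
  have "(\<lambda>t. \<integral>q. grad_sq (x t q) \<partial>Q) \<longlonglongrightarrow> (\<integral>q. 0 \<partial>Q)"
  proof (rule integral_dominated_convergence[where w = "\<lambda>q. A\<^sup>2"])
    show "AE q in Q. norm (grad_sq (x t q)) \<le> A\<^sup>2" for t
      using grad_sq_le[OF x_in] grad_sq_nonneg by (intro AE_I2) auto
  qed (use sd(2) h0 in auto)
  then show "(\<lambda>t. \<integral>q. (rnorm g (x t q) (gradient \<A> g F (x t q)))\<^sup>2 \<partial>Q) \<longlonglongrightarrow> 0"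
    unfolding eq by simp
qed

text \<open>
  If the adaptive steps do not tend to \<open>0\<close>, they are bounded below, and then \<open>\<Sum> s h < \<infinity>\<close> already
  forces \<open>h\<close> to tend to \<open>0\<close>.
\<close>

lemma adaptive_steps:
  fixes x :: "nat \<Rightarrow> 'q \<Rightarrow> 'm" and \<alpha> \<beta> \<epsilon> :: real
  defines "V \<equiv> \<lambda>t q. \<Sum>p<t. (rnorm g (x p q) (Hb p (x p q) (\<omega> p q)))\<^sup>2"
  defines "s \<equiv> \<lambda>t q. \<alpha> / (\<beta> + V t q) powr (1 / 2 + \<epsilon>)"
  assumes pos: "0 < \<alpha>" "0 < \<beta>" "0 < \<epsilon>" and "\<epsilon> \<le> 1 / 2" and \<alpha>: "\<alpha> \<le> \<beta> powr (1 / 2 + \<epsilon>)"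
    and x0: "\<And>q. q \<in> space Q \<Longrightarrow> x 0 q = x0"
    and x_Suc: "\<And>t q. q \<in> space Q \<Longrightarrow> x (Suc t) q = R (x t q, - (s t q *\<^sub>R Hb t (x t q) (\<omega> t q)))"
    and x_in: "\<And>t q. q \<in> space Q \<Longrightarrow> x t q \<in> K"
  shows "AE q in Q. convergent (\<lambda>t. F (x t q))"
    and "AE q in Q. (\<lambda>t. rnorm g (x t q) (gradient \<A> g F (x t q))) \<longlonglongrightarrow> 0"
proof -
  define a where "a t q = (rnorm g (x t q) (Hb t (x t q) (\<omega> t q)))\<^sup>2" for t q
  have V_eq: "V t q = (\<Sum>p<t. a p q)" for t q by (simp add: V_def a_def)
  have r_le: "rnorm g (x t q) (Hb t (x t q) (\<omega> t q)) \<le> A" if "q \<in> space Q" for t q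
    using Hb_le x_in \<omega>_space that by blast
  have a: "0 \<le> a t q" "q \<in> space Q \<Longrightarrow> a t q \<le> A\<^sup>2" for t q
    using r_le rnorm_nonneg by (auto simp: a_def intro: power_mono)
  have V: "0 \<le> V t q" for t q unfolding V_eq using a by (intro sum_nonneg)
  define \<sigma> where "\<sigma> v = \<alpha> / (\<beta> + v) powr (1 / 2 + \<epsilon>)" for v
  have s_eq: "s t q = \<sigma> (V t q)" for t q by (simp add: s_def \<sigma>_def)
  \<comment> \<open>The largest step occurs at v = 0, where the assumption on \<alpha> bounds it by
    1.\<close>
  have \<sigma>: "0 < \<sigma> v" "\<sigma> v \<le> 1" if "0 \<le> v" for v
  proof -
    have "\<beta> powr (1 / 2 + \<epsilon>) \<le> (\<beta> + v) powr (1 / 2 + \<epsilon>)" using pos that by (intro powr_mono2) auto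
    then show "\<sigma> v \<le> 1" using \<alpha> pos that by (simp add: \<sigma>_def)
    show "0 < \<sigma> v" using pos that by (simp add: \<sigma>_def)
  qed
  have \<sigma>_meas: "\<sigma> \<in> borel_measurable borel" unfolding \<sigma>_def[abs_def] by measurable
  \<comment> \<open>Squaring the step doubles its exponent to 1 + 2\<epsilon>, so
    \<open>adaptive_sum_le\<close> applies with \<kappa> = 2\<epsilon> and D = A squared.\<close>
  define B where "B = \<alpha>\<^sup>2 * ((1 + A\<^sup>2 / \<beta>) powr (1 + 2 * \<epsilon>) / (2 * \<epsilon>) * \<beta> powr (- (2 * \<epsilon>)))"
  have B: "(\<Sum>t<n. (\<sigma> (V t q))\<^sup>2 * (rnorm g (x t q) (Hb t (x t q) (\<omega> t q)))\<^sup>2) \<le> B"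
    if q: "q \<in> space Q" for n q
  proof -
    have "(\<sigma> (V t q))\<^sup>2 * a t q = \<alpha>\<^sup>2 * (a t q / (\<beta> + (\<Sum>p<t. a p q)) powr (1 + 2 * \<epsilon>))" for t
    proof -
      have "((\<beta> + V t q) powr (1 / 2 + \<epsilon>))\<^sup>2 = (\<beta> + V t q) powr (1 + 2 * \<epsilon>)"
        by (simp add: power2_eq_square powr_add[symmetric])
      then show ?thesis by (simp add: \<sigma>_def power_divide V_eq)
    qed
    then have "(\<Sum>t<n. (\<sigma> (V t q))\<^sup>2 * a t q) = \<alpha>\<^sup>2 * (\<Sum>t<n. a t q / (\<beta> + (\<Sum>p<t. a p q)) powr (1 + 2 * \<epsilon>))"
      by (simp add: sum_distrib_left)
    also have "\<dots> \<le> B"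
      unfolding B_def using pos a q by (intro mult_left_mono adaptive_sum_le) auto
    finally show ?thesis by (simp add: a_def)
  qed
  have sd: "AE q in Q. convergent (\<lambda>t. F (x t q)) \<and> summable (\<lambda>t. s t q * grad_sq (x t q))"
    unfolding s_eq V_def
    by (rule stochastic_descent(1)[where \<sigma> = "\<lambda>t. \<sigma>" and x = x and ?x0.0 = x0];
        (rule \<sigma>_meas \<sigma> x0 x_Suc[unfolded s_eq V_def] x_in B[unfolded V_def]; assumption?))
  show "AE q in Q. convergent (\<lambda>t. F (x t q))" using sd by eventually_elim simp
  have h0: "AE q in Q. (\<lambda>t. grad_sq (x t q)) \<longlonglongrightarrow> 0"
    using sd AE_space
  proof eventually_elim
    case (elim q)
    have s_pos: "0 < s t q" for t unfolding s_eq by (rule \<sigma>(1)[OF V])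
    have not_summable: "\<not> summable (\<lambda>t. s t q)"
      unfolding s_def V_eq using pos \<open>\<epsilon> \<le> 1 / 2\<close> a elim(2) by (intro adaptive_step_not_summable) auto
    have "s (Suc t) q \<le> s t q" for t
      using pos V[of t q] a(1)[of t q] unfolding s_def V_eq
      by (intro divide_left_mono powr_mono2 mult_pos_pos) (auto intro!: add_pos_nonneg sum_nonneg a)
    then have dec: "decseq (\<lambda>t. s t q)" by (rule decseq_SucI)
    then obtain l where l: "(\<lambda>t. s t q) \<longlonglongrightarrow> l" "\<And>t. l \<le> s t q"
      using decseq_convergent[of "\<lambda>t. s t q" 0] s_pos less_imp_le by blast
    have "0 \<le> l" using s_pos by (intro LIMSEQ_le_const[OF l(1)]) (auto intro: less_imp_le)
    show ?case
    proof (cases "l = 0")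
      case True
      with l(1) have s0: "(\<lambda>t. s t q) \<longlonglongrightarrow> 0" by simp
      show ?thesis
        by (rule tendsto_zero_along_steps[where s = "\<lambda>t. s t q" and v = "\<lambda>t. Hb t (x t q) (\<omega> t q)", OF K x_in[OF elim(2)]
              continuous_grad_sq grad_sq_nonneg s_pos s0 not_summable _ x_Suc[OF elim(2)] r_le[OF elim(2)] A])
          (use elim(1) in simp)
    next
      case False
      with \<open>0 \<le> l\<close> have "l > 0" by simp
      have "(\<lambda>t. s t q * grad_sq (x t q)) \<longlonglongrightarrow> 0" using elim(1) by (intro summable_LIMSEQ_zero) simp
      then have lim: "(\<lambda>t. s t q * grad_sq (x t q) / l) \<longlonglongrightarrow> 0"
        by (rule tendsto_divide_zero)
      show ?thesis
      proof (rule tendsto_sandwich[OF _ _ tendsto_const lim])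
        have "grad_sq (x t q) \<le> s t q * grad_sq (x t q) / l" for t
          using mult_right_mono[OF l(2)[of t] grad_sq_nonneg[of "x t q"]] \<open>l > 0\<close> by (simp add: field_simps)
        then show "\<forall>\<^sub>F t in sequentially. grad_sq (x t q) \<le> s t q * grad_sq (x t q) / l" by simp
      qed (simp add: grad_sq_nonneg)
    qed
  qed
  then show "AE q in Q. (\<lambda>t. rnorm g (x t q) (gradient \<A> g F (x t q))) \<longlonglongrightarrow> 0"
    by eventually_elim (auto simp: rnorm_gradient intro: tendsto_eq_intros)
qed

end

section \<open>Both step rules as instances of the common setting\<close>

theorem corollary2p11:
  fixes \<A> :: "('m::{t2_space,second_countable_topology},
      'e::{real_inner,banach,heine_borel,second_countable_topology}) chart set"
    and g :: "'m \<Rightarrow> 'e \<Rightarrow> 'e \<Rightarrow> real"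
    and R :: "'m \<times> 'e \<Rightarrow> 'm"
    and F :: "'m \<Rightarrow> real"
    and K :: "'m set"
    and A :: real
    and P :: "'w measure"
    and H :: "'m \<times> 'w \<Rightarrow> 'm \<times> 'e"
    and m :: "nat \<Rightarrow> nat"
    and \<Omega> :: "nat \<Rightarrow> nat \<Rightarrow> 'w set"
    and b :: "nat \<Rightarrow> nat \<Rightarrow> nat"
    and Q :: "'q measure"
    and \<omega> :: "nat \<Rightarrow> 'q \<Rightarrow> nat \<Rightarrow> nat \<Rightarrow> 'w"
  defines "\<Omega>B \<equiv> \<lambda>t. batch_measure P (m t) (\<Omega> t) (b t)"
    and "Hb \<equiv> \<lambda>t. batch_estimator P H (m t) (\<Omega> t) (b t)"
  assumes "smooth_atlas \<A>" and "connected (UNIV :: 'm set)" and "riemannian_metric \<A> g"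
    and "manifold_retraction \<A> R"
    and "C1_function \<A> F"
    and "compact K" and "A > 0" and "R_Lipschitz \<A> g R K A (gradient \<A> g F)"
    and "prob_space P"
    and "\<forall>w\<in>space P. \<forall>x. fst (H (x, w)) = x"
    and "finite (space P) \<and> sets P = Pow (space P) \<or> H \<in> borel \<Otimes>\<^sub>M P \<rightarrow>\<^sub>M tangent_borel \<A>"
    and "\<forall>x. has_bochner_integral P (\<lambda>w. snd (H (x, w))) (gradient \<A> g F x)"
    and "\<forall>x\<in>K. \<forall>w\<in>space P. rnorm g x (snd (H (x, w))) \<le> A"
    and "\<forall>t. \<forall>j\<in>{1..m t}. \<Omega> t j \<in> sets P \<and> measure P (\<Omega> t j) > 0"
    and "\<forall>t. disjoint_family_on (\<Omega> t) {1..m t} \<and> (\<Union>j\<in>{1..m t}. \<Omega> t j) = space P"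
    and "\<forall>t. \<forall>j\<in>{1..m t}. b t j > 0"
    and "prob_space Q"
    and "prob_space.indep_vars Q \<Omega>B \<omega> UNIV"
    and "\<forall>t. distr Q (\<Omega>B t) (\<omega> t) = \<Omega>B t"
  shows "(\<forall>(\<gamma> :: nat \<Rightarrow> real) x0 (x :: nat \<Rightarrow> 'q \<Rightarrow> 'm).
            (\<forall>t. 0 < \<gamma> t \<and> \<gamma> t \<le> 1) \<and> summable (\<lambda>t. (\<gamma> t)\<^sup>2) \<and>
            filterlim (\<lambda>n. \<Sum>t<n. \<gamma> t) at_top sequentially \<and>
            x0 \<in> K \<and> (\<forall>q\<in>space Q. x 0 q = x0) \<and>
            (\<forall>t. \<forall>q\<in>space Q. x (Suc t) q = R (x t q, - (\<gamma> t *\<^sub>R Hb t (x t q) (\<omega> t q)))) \<and>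
            (\<forall>t. \<forall>q\<in>space Q. x t q \<in> K)
            \<longrightarrow>
            (AE q in Q. convergent (\<lambda>t. F (x t q))) \<and>
            (AE q in Q. (\<lambda>t. rnorm g (x t q) (gradient \<A> g F (x t q))) \<longlonglongrightarrow> 0) \<and>
            (\<forall>t. integrable Q (\<lambda>q. (rnorm g (x t q) (gradient \<A> g F (x t q)))\<^sup>2)) \<and>
            (\<lambda>t. \<integral>q. (rnorm g (x t q) (gradient \<A> g F (x t q)))\<^sup>2 \<partial>Q) \<longlonglongrightarrow> 0)
       \<and> (\<forall>x0 \<alpha> \<beta> \<epsilon> (x :: nat \<Rightarrow> 'q \<Rightarrow> 'm) (\<eta> :: nat \<Rightarrow> 'q \<Rightarrow> real).
            x0 \<in> K \<and> 0 < \<alpha> \<and> 0 < \<beta> \<and> 0 < \<epsilon> \<and> \<epsilon> \<le> 1 / 2 \<and> \<alpha> \<le> \<beta> powr (1 / 2 + \<epsilon>) \<and>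
            (\<forall>q\<in>space Q. x 0 q = x0) \<and>
            (\<forall>t. \<forall>q\<in>space Q. x (Suc t) q = R (x t q, - (\<eta> t q *\<^sub>R Hb t (x t q) (\<omega> t q)))) \<and>
            (\<forall>t. \<forall>q\<in>space Q. \<eta> t q =
               \<alpha> / (\<beta> + (\<Sum>p<t. (rnorm g (x p q) (Hb p (x p q) (\<omega> p q)))\<^sup>2)) powr (1 / 2 + \<epsilon>)) \<and>
            (\<forall>t. \<forall>q\<in>space Q. x t q \<in> K)
            \<longrightarrow>
            (AE q in Q. convergent (\<lambda>t. F (x t q))) \<and>
            (AE q in Q. (\<lambda>t. rnorm g (x t q) (gradient \<A> g F (x t q))) \<longlonglongrightarrow> 0))"
proof -
  note \<Omega>B = assms(1) and Hb = assms(2) and atl = assms(3) and met = assms(5) and ret = assms(6)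
    and c1 = assms(7) and K = assms(8) and A = assms(9) and lip = assms(10) and P = assms(11)
    and fst_H = assms(12) and H_meas = assms(13) and int_H = assms(14) and H_le = assms(15)
    and strata = assms(16) and part = assms(17) and b = assms(18) and Q = assms(19)
    and indep = assms(20) and distr = assms(21)
  \<comment> \<open>The finite spanning set contained in the notion of atlas supplies the frame on
    which all the locales depend.\<close>
  obtain B :: "'e set" where "finite B" "span B = UNIV"
    using atl unfolding smooth_atlas_def by blast
  then obtain C :: "'e set" where C: "orthonormal_frame C"
    using orthonormal_frame_exists by blast
  have retr: "retracted C \<A> g F R"
    by (intro retracted.intro retracted_axioms.intro C1_potential.intro C1_potential_axioms.intro
        riemannian.intro riemannian_axioms.intro atlas.intro atlas_axioms.intro C atl met c1 ret)
  have "stochastic_gradient C \<A> g F R P (m t) (\<Omega> t) (b t) H" for t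
    by (intro stochastic_gradient.intro stochastic_gradient_axioms.intro stratification.intro
        stratification_axioms.intro retr P)
      (use fst_H int_H strata part b in auto)
  then interpret sgd C \<A> g F R Q P H m \<Omega> b \<Omega>B Hb \<omega> K A
    using \<Omega>B Hb H_meas indep distr K A lip H_le
    by (intro sgd.intro sgd_axioms.intro retr Q) auto
  show ?thesis
  proof (intro conjI allI impI; elim conjE)
    fix \<gamma> :: "nat \<Rightarrow> real" and x0 and x :: "nat \<Rightarrow> 'q \<Rightarrow> 'm"
    assume \<gamma>: "\<forall>t. 0 < \<gamma> t \<and> \<gamma> t \<le> 1" and sq: "summable (\<lambda>t. (\<gamma> t)\<^sup>2)"
      and div: "filterlim (\<lambda>n. \<Sum>t<n. \<gamma> t) at_top sequentially"
      and x: "\<forall>q\<in>space Q. x 0 q = x0"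
        "\<forall>t. \<forall>q\<in>space Q. x (Suc t) q = R (x t q, - (\<gamma> t *\<^sub>R Hb t (x t q) (\<omega> t q)))"
        "\<forall>t. \<forall>q\<in>space Q. x t q \<in> K"
    have "\<not> summable \<gamma>"
    proof
      assume "summable \<gamma>"
      then have "(\<lambda>n. \<Sum>t<n. \<gamma> t) \<longlonglongrightarrow> suminf \<gamma>" by (rule summable_LIMSEQ)
      with div show False by (metis filterlim_at_top_imp_at_infinity not_tendsto_and_filterlim_at_infinity sequentially_bot)
    qed
    note d = decreasing_steps[of \<gamma> x x0, OF _ _ sq this]
    show "AE q in Q. convergent (\<lambda>t. F (x t q))" by (rule d) (use \<gamma> x in auto)
    show "AE q in Q. (\<lambda>t. rnorm g (x t q) (gradient \<A> g F (x t q))) \<longlonglongrightarrow> 0" by (rule d) (use \<gamma> x in auto)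
    show "integrable Q (\<lambda>q. (rnorm g (x t q) (gradient \<A> g F (x t q)))\<^sup>2)" for t by (rule d) (use \<gamma> x in auto)
    show "(\<lambda>t. \<integral>q. (rnorm g (x t q) (gradient \<A> g F (x t q)))\<^sup>2 \<partial>Q) \<longlonglongrightarrow> 0" by (rule d) (use \<gamma> x in auto)
  next
    fix x0 and \<alpha> \<beta> \<epsilon> :: real and x :: "nat \<Rightarrow> 'q \<Rightarrow> 'm" and \<eta> :: "nat \<Rightarrow> 'q \<Rightarrow> real"
    assume pos: "0 < \<alpha>" "0 < \<beta>" "0 < \<epsilon>" "\<epsilon> \<le> 1 / 2" "\<alpha> \<le> \<beta> powr (1 / 2 + \<epsilon>)"
      and x: "\<forall>q\<in>space Q. x 0 q = x0"
        "\<forall>t. \<forall>q\<in>space Q. x (Suc t) q = R (x t q, - (\<eta> t q *\<^sub>R Hb t (x t q) (\<omega> t q)))"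
        "\<forall>t. \<forall>q\<in>space Q. x t q \<in> K"
      and \<eta>: "\<forall>t. \<forall>q\<in>space Q. \<eta> t q =
        \<alpha> / (\<beta> + (\<Sum>p<t. (rnorm g (x p q) (Hb p (x p q) (\<omega> p q)))\<^sup>2)) powr (1 / 2 + \<epsilon>)"
    note a = adaptive_steps[of \<alpha> \<beta> \<epsilon> x x0, OF pos]
    show "AE q in Q. convergent (\<lambda>t. F (x t q))" by (rule a) (use x \<eta> in auto)
    show "AE q in Q. (\<lambda>t. rnorm g (x t q) (gradient \<A> g F (x t q))) \<longlonglongrightarrow> 0" by (rule a) (use x \<eta> in auto)
  qed
qed

end
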